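(* Let $\widehat{\mathfrak{stl}}_4(R)=\mathcal W\oplus\mathfrak{stl}_4(R)$ with bracket $[(c,x),(c',y)]=(\psi(x,y),[x,y])$ and let $\pi:\widehat{\mathfrak{stl}}_4(R)\to\mathfrak{stl}_4(R)$ be the projection onto the second factor. Then $(\widehat{\mathfrak{stl}}_4(R),\pi)$ is the universal central extension of $\mathfrak{stl}_4(R)$ in the category of Leibniz algebras over $K$, and hence $HL_2(\mathfrak{stl}_4(R))\cong\mathcal W=R_2^6$.
   Context: $K$ unital commutative ring, $R$ unital associative $K$-algebra, free as $K$-module with basis containing $1$. Leibniz algebra: $K$-bilinear bracket with $[x,[y,z]]=[[x,y],z]-[[x,z],y]$. A central extension of a Leibniz algebra $L$ is a surjective homomorphism $\pi:\hat L\to L$ whose kernel is central in $\hat L$ and which splits as a $K$-module map; it is universal if for every central extension $\tau:\tilde L\to L$ there is a unique homomorphism $\eta:\hat L\to\tilde L$ with $\tau\circ\eta=\pi$. $HL_2(L)$ is the second homology of the Leibniz complex $(L^{\otimes n},\delta)$, $\delta(x_1\otimes\cdots\otimes x_n)=\sum_{1\le i<j\le n}(-1)^{j+1}x_1\otimes\cdots\otimes x_{i-1}\otimes[x_i,x_j]\otimes x_{i+1}\otimes\cdots\widehat{x_j}\cdots\otimes x_n$. $\mathfrak{stl}_4(R)$: Leibniz algebra over $K$ generated by $X_{ij}(a)$, $a\in R$, $1\le i\ne j\le 4$, subject to $K$-linearity in $a$, $[X_{ij}(a),X_{jk}(b)]=X_{ik}(ab)$ and $[X_{ij}(a),X_{ki}(b)]=-X_{kj}(ba)$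 for distinct $i,j,k$, $[X_{ij}(a),X_{kl}(b)]=0$ for $j\ne k$, $i\ne l$. $H$ is the $K$-span of all $[X_{ij}(a),X_{ji}(b)]$; $\mathfrak{stl}_4(R)=H\oplus\bigoplus_{i\ne j}X_{ij}(R)$ with $a\mapsto X_{ij}(a)$ injective. $R_2=R/(2R+R[R,R])$, $\bar a$ the class of $a$; $\mathcal W=R_2^6$, $\epsilon_m(\bar a)$ the element with $m$-th coordinate $\bar a$, others $0$. $P$ = quadruples $(i,j,k,l)$ with $\{i,j,k,l\}=\{1,2,3,4\}$, $G=\{(1),(13),(24),(13)(24)\}\le S_4$ acting componentwise; $P$ splits into six classes $(\sigma G)((1,2,3,4))$ labelled $1,\dots,6$ (class of $(1,2,3,4)$ labelled $1$), $\theta:P\to\{1,\dots,6\}$ the label map. $\psi$ is the $K$-bilinear map with $\psi(X_{ij}(a),X_{kl}(b))=\epsilon_{\theta((i,j,k,l))}(\overline{ab})$ for pairwise distinct $i,j,k,l$, zero on $X_{ij}(a),X_{kl}(b)$ with $i,j,k,l$ not pairwise distinct, and zero whenever an argument lies in $H$. *)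

theory Defs
  imports Main
begin

text \<open>A K-module / Leibniz algebra over the commutative ring K (a type 'k) is
given by a carrier set together with addition, zero, scalar multiplication and a
bracket.  For plain modules the bracket field is ignored.\<close>

record ('k, 'a) lalg =
  lcarrier :: "'a set"
  ladd :: "'a \<Rightarrow> 'a \<Rightarrow> 'a"
  lzero :: "'a"
  lsmult :: "'k \<Rightarrow> 'a \<Rightarrow> 'a"
  lbr :: "'a \<Rightarrow> 'a \<Rightarrow> 'a"

definition lsub :: "('k::comm_ring_1, 'a) lalg \<Rightarrow> 'a \<Rightarrow> 'a \<Rightarrow> 'a" where
  "lsub A x y = ladd A x (lsmult A (-1) y)"

definition kmodule :: "('k::comm_ring_1, 'a) lalg \<Rightarrow> bool" where
  "kmodule M \<longleftrightarrow>
     lzero M \<in> lcarrier M \<and>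
     (\<forall>x\<in>lcarrier M. \<forall>y\<in>lcarrier M. ladd M x y \<in> lcarrier M) \<and>
     (\<forall>c. \<forall>x\<in>lcarrier M. lsmult M c x \<in> lcarrier M) \<and>
     (\<forall>x\<in>lcarrier M. \<forall>y\<in>lcarrier M. \<forall>z\<in>lcarrier M.
         ladd M (ladd M x y) z = ladd M x (ladd M y z)) \<and>
     (\<forall>x\<in>lcarrier M. \<forall>y\<in>lcarrier M. ladd M x y = ladd M y x) \<and>
     (\<forall>x\<in>lcarrier M. ladd M (lzero M) x = x) \<and>
     (\<forall>x\<in>lcarrier M. ladd M x (lsmult M (-1) x) = lzero M) \<and>
     (\<forall>x\<in>lcarrier M. lsmult M 1 x = x) \<and>
     (\<forall>a b. \<forall>x\<in>lcarrier M. lsmult M (a * b) x = lsmult M a (lsmult M b x)) \<and>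
     (\<forall>a b. \<forall>x\<in>lcarrier M. lsmult M (a + b) x = ladd M (lsmult M a x) (lsmult M b x)) \<and>
     (\<forall>a. \<forall>x\<in>lcarrier M. \<forall>y\<in>lcarrier M.
         lsmult M a (ladd M x y) = ladd M (lsmult M a x) (lsmult M a y))"

definition leibniz :: "('k::comm_ring_1, 'a) lalg \<Rightarrow> bool" where
  "leibniz L \<longleftrightarrow> kmodule L \<and>
     (\<forall>x\<in>lcarrier L. \<forall>y\<in>lcarrier L. lbr L x y \<in> lcarrier L) \<and>
     (\<forall>x\<in>lcarrier L. \<forall>y\<in>lcarrier L. \<forall>z\<in>lcarrier L.
         lbr L (ladd L x y) z = ladd L (lbr L x z) (lbr L y z) \<and>
         lbr L z (ladd L x y) = ladd L (lbr L z x) (lbr L z y)) \<and>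
     (\<forall>c. \<forall>x\<in>lcarrier L. \<forall>y\<in>lcarrier L.
         lbr L (lsmult L c x) y = lsmult L c (lbr L x y) \<and>
         lbr L x (lsmult L c y) = lsmult L c (lbr L x y)) \<and>
     (\<forall>x\<in>lcarrier L. \<forall>y\<in>lcarrier L. \<forall>z\<in>lcarrier L.
         lbr L x (lbr L y z) = lsub L (lbr L (lbr L x y) z) (lbr L (lbr L x z) y))"

definition klinear :: "('k::comm_ring_1, 'a) lalg \<Rightarrow> ('k, 'b) lalg \<Rightarrow> ('a \<Rightarrow> 'b) \<Rightarrow> bool" where
  "klinear M N f \<longleftrightarrow>
     f ` lcarrier M \<subseteq> lcarrier N \<and>
     (\<forall>x\<in>lcarrier M. \<forall>y\<in>lcarrier M. f (ladd M x y) = ladd N (f x) (f y)) \<and>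
     (\<forall>c. \<forall>x\<in>lcarrier M. f (lsmult M c x) = lsmult N c (f x))"

definition lhom :: "('k::comm_ring_1, 'a) lalg \<Rightarrow> ('k, 'b) lalg \<Rightarrow> ('a \<Rightarrow> 'b) \<Rightarrow> bool" where
  "lhom L M f \<longleftrightarrow> klinear L M f \<and>
     (\<forall>x\<in>lcarrier L. \<forall>y\<in>lcarrier L. f (lbr L x y) = lbr M (f x) (f y))"

definition kiso :: "('k::comm_ring_1, 'a) lalg \<Rightarrow> ('k, 'b) lalg \<Rightarrow> ('a \<Rightarrow> 'b) \<Rightarrow> bool" where
  "kiso M N f \<longleftrightarrow> klinear M N f \<and> bij_betw f (lcarrier M) (lcarrier N)"

definition central_ext :: "('k::comm_ring_1, 'a) lalg \<Rightarrow> ('k, 'b) lalg \<Rightarrow> ('a \<Rightarrow> 'b) \<Rightarrow> bool" where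
  "central_ext Lh L p \<longleftrightarrow> leibniz Lh \<and> leibniz L \<and> lhom Lh L p \<and>
     p ` lcarrier Lh = lcarrier L \<and>
     (\<forall>z\<in>lcarrier Lh. p z = lzero L \<longrightarrow>
        (\<forall>x\<in>lcarrier Lh. lbr Lh z x = lzero Lh \<and> lbr Lh x z = lzero Lh)) \<and>
     (\<exists>s. klinear L Lh s \<and> (\<forall>x\<in>lcarrier L. p (s x) = x))"

text \<open>Universality, tested against central extensions whose total algebra lives on
the type 'c; in the theorem 'c is a free (hence arbitrary) type variable.\<close>

definition universal_central_ext ::
  "'c itself \<Rightarrow> ('k::comm_ring_1, 'a) lalg \<Rightarrow> ('k, 'b) lalg \<Rightarrow> ('a \<Rightarrow> 'b) \<Rightarrow> bool" where
  "universal_central_ext (_ :: 'c itself) Lh L p \<longleftrightarrow> central_ext Lh L p \<and>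
     (\<forall>(Lt :: ('k, 'c) lalg) t. central_ext Lt L t \<longrightarrow>
        (\<exists>e. lhom Lh Lt e \<and> (\<forall>x\<in>lcarrier Lh. t (e x) = p x)) \<and>
        (\<forall>e1 e2. lhom Lh Lt e1 \<and> (\<forall>x\<in>lcarrier Lh. t (e1 x) = p x) \<and>
                 lhom Lh Lt e2 \<and> (\<forall>x\<in>lcarrier Lh. t (e2 x) = p x) \<longrightarrow>
                 (\<forall>x\<in>lcarrier Lh. e1 x = e2 x)))"

inductive_set lspan :: "('k::comm_ring_1, 'a) lalg \<Rightarrow> 'a set \<Rightarrow> 'a set"
  for A :: "('k, 'a) lalg" and S :: "'a set" where
  span_gen: "s \<in> S \<Longrightarrow> s \<in> lspan A S"
| span_zero: "lzero A \<in> lspan A S"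
| span_add: "x \<in> lspan A S \<Longrightarrow> y \<in> lspan A S \<Longrightarrow> ladd A x y \<in> lspan A S"
| span_smult: "x \<in> lspan A S \<Longrightarrow> lsmult A c x \<in> lspan A S"

inductive_set lideal :: "('k::comm_ring_1, 'a) lalg \<Rightarrow> 'a set \<Rightarrow> 'a set"
  for A :: "('k, 'a) lalg" and S :: "'a set" where
  ideal_gen: "s \<in> S \<Longrightarrow> s \<in> lideal A S"
| ideal_zero: "lzero A \<in> lideal A S"
| ideal_add: "x \<in> lideal A S \<Longrightarrow> y \<in> lideal A S \<Longrightarrow> ladd A x y \<in> lideal A S"
| ideal_smult: "x \<in> lideal A S \<Longrightarrow> lsmult A c x \<in> lideal A S"
| ideal_left: "x \<in> lideal A S \<Longrightarrow> a \<in> lcarrier A \<Longrightarrow> lbr A a x \<in> lideal A S"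
| ideal_right: "x \<in> lideal A S \<Longrightarrow> a \<in> lcarrier A \<Longrightarrow> lbr A x a \<in> lideal A S"

definition lcoset :: "('k, 'a) lalg \<Rightarrow> 'a set \<Rightarrow> 'a \<Rightarrow> 'a set" where
  "lcoset A I x = {ladd A x i | i. i \<in> I}"

definition lquot :: "('k, 'a) lalg \<Rightarrow> 'a set \<Rightarrow> ('k, 'a set) lalg" where
  "lquot A I = \<lparr> lcarrier = lcoset A I ` lcarrier A,
     ladd = (\<lambda>C D. lcoset A I (ladd A (SOME x. x \<in> C) (SOME y. y \<in> D))),
     lzero = lcoset A I (lzero A),
     lsmult = (\<lambda>c C. lcoset A I (lsmult A c (SOME x. x \<in> C))),
     lbr = (\<lambda>C D. lcoset A I (lbr A (SOME x. x \<in> C) (SOME y. y \<in> D))) \<rparr>"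

datatype 'g mag = Leaf 'g | Node "'g mag" "'g mag"

text \<open>K-linear combinations of non-empty bracketings (binary trees) of generators
in G; the bracket is the bilinear extension of tree formation.\<close>
definition fm :: "'g set \<Rightarrow> ('k::comm_ring_1, 'g mag \<Rightarrow> 'k) lalg" where
  "fm G = \<lparr> lcarrier = {f. finite {t. f t \<noteq> 0} \<and> (\<forall>t. f t \<noteq> 0 \<longrightarrow> set_mag t \<subseteq> G)},
     ladd = (\<lambda>f g t. f t + g t),
     lzero = (\<lambda>t. 0),
     lsmult = (\<lambda>c f t. c * f t),
     lbr = (\<lambda>f g t. case t of Leaf _ \<Rightarrow> 0 | Node u v \<Rightarrow> f u * g v) \<rparr>"

definition fgen :: "'g \<Rightarrow> ('g mag \<Rightarrow> 'k::comm_ring_1)" where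
  "fgen g = (\<lambda>t. if t = Leaf g then 1 else 0)"

definition leib_rel :: "('k::comm_ring_1, 'a) lalg \<Rightarrow> 'a set" where
  "leib_rel A = {lsub A (lbr A x (lbr A y z)) (lsub A (lbr A (lbr A x y) z) (lbr A (lbr A x z) y))
                 | x y z. x \<in> lcarrier A \<and> y \<in> lcarrier A \<and> z \<in> lcarrier A}"

definition k_algebra :: "('k::comm_ring_1 \<Rightarrow> 'r::ring_1 \<Rightarrow> 'r) \<Rightarrow> bool" where
  "k_algebra sR \<longleftrightarrow>
     (\<forall>a. sR 1 a = a) \<and> (\<forall>c d a. sR (c * d) a = sR c (sR d a)) \<and>
     (\<forall>c d a. sR (c + d) a = sR c a + sR d a) \<and> (\<forall>c a b. sR c (a + b) = sR c a + sR c b) \<and>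
     (\<forall>c a b. sR c (a * b) = sR c a * b \<and> sR c (a * b) = a * sR c b)"

definition free_basis_one :: "('k::comm_ring_1 \<Rightarrow> 'r::ring_1 \<Rightarrow> 'r) \<Rightarrow> bool" where
  "free_basis_one sR \<longleftrightarrow> (\<exists>B. 1 \<in> B \<and>
     (\<forall>r. \<exists>!c. (\<forall>b. b \<notin> B \<longrightarrow> c b = 0) \<and> finite {b. c b \<noteq> 0} \<and>
              r = (\<Sum>b\<in>{b. c b \<noteq> 0}. sR (c b) b)))"

definition stG :: "(nat \<times> nat \<times> 'r) set" where
  "stG = {(i, j, a). i \<in> {1..4} \<and> j \<in> {1..4} \<and> i \<noteq> j}"

definition FMst :: "('k::comm_ring_1 \<Rightarrow> 'r \<Rightarrow> 'r) \<Rightarrow> ('k, (nat \<times> nat \<times> 'r) mag \<Rightarrow> 'k) lalg" where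
  "FMst sR = fm stG"

definition Xf :: "('k::comm_ring_1 \<Rightarrow> 'r \<Rightarrow> 'r) \<Rightarrow> nat \<Rightarrow> nat \<Rightarrow> 'r \<Rightarrow> ((nat \<times> nat \<times> 'r) mag \<Rightarrow> 'k)" where
  "Xf sR i j a = fgen (i, j, a)"

definition st_rel :: "('k::comm_ring_1 \<Rightarrow> 'r::ring_1 \<Rightarrow> 'r) \<Rightarrow> ((nat \<times> nat \<times> 'r) mag \<Rightarrow> 'k) set" where
  "st_rel sR =
     {lsub (FMst sR) (Xf sR i j (sR c a + b))
         (ladd (FMst sR) (lsmult (FMst sR) c (Xf sR i j a)) (Xf sR i j b))
       | i j c a b. i \<in> {1..4} \<and> j \<in> {1..4} \<and> i \<noteq> j}
   \<union> {lsub (FMst sR) (lbr (FMst sR) (Xf sR i j a) (Xf sR j k b)) (Xf sR i k (a * b))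
       | i j k a b. i \<in> {1..4} \<and> j \<in> {1..4} \<and> k \<in> {1..4} \<and> i \<noteq> j \<and> j \<noteq> k \<and> i \<noteq> k}
   \<union> {ladd (FMst sR) (lbr (FMst sR) (Xf sR i j a) (Xf sR k i b)) (Xf sR k j (b * a))
       | i j k a b. i \<in> {1..4} \<and> j \<in> {1..4} \<and> k \<in> {1..4} \<and> i \<noteq> j \<and> j \<noteq> k \<and> i \<noteq> k}
   \<union> {lbr (FMst sR) (Xf sR i j a) (Xf sR k l b)
       | i j k l a b. i \<in> {1..4} \<and> j \<in> {1..4} \<and> k \<in> {1..4} \<and> l \<in> {1..4} \<and>
                      i \<noteq> j \<and> k \<noteq> l \<and> j \<noteq> k \<and> i \<noteq> l}"

text \<open>st(4,R): the Leibniz algebra presented by generators X_ij(a) and the relations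
above, i.e. the free algebra modulo the ideal generated by all instances of the
Leibniz identity together with the defining relations.\<close>
definition st_ideal :: "('k::comm_ring_1 \<Rightarrow> 'r::ring_1 \<Rightarrow> 'r) \<Rightarrow> ((nat \<times> nat \<times> 'r) mag \<Rightarrow> 'k) set" where
  "st_ideal sR = lideal (FMst sR) (leib_rel (FMst sR) \<union> st_rel sR)"

definition stl4 :: "('k::comm_ring_1 \<Rightarrow> 'r::ring_1 \<Rightarrow> 'r) \<Rightarrow> ('k, ((nat \<times> nat \<times> 'r) mag \<Rightarrow> 'k) set) lalg" where
  "stl4 sR = lquot (FMst sR) (st_ideal sR)"

definition stX :: "('k::comm_ring_1 \<Rightarrow> 'r::ring_1 \<Rightarrow> 'r) \<Rightarrow> nat \<Rightarrow> nat \<Rightarrow> 'r \<Rightarrow> ((nat \<times> nat \<times> 'r) mag \<Rightarrow> 'k) set" where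
  "stX sR i j a = lcoset (FMst sR) (st_ideal sR) (Xf sR i j a)"

definition stH :: "('k::comm_ring_1 \<Rightarrow> 'r::ring_1 \<Rightarrow> 'r) \<Rightarrow> ((nat \<times> nat \<times> 'r) mag \<Rightarrow> 'k) set set" where
  "stH sR = lspan (stl4 sR) {lbr (stl4 sR) (stX sR i j a) (stX sR j i b)
                             | i j a b. i \<in> {1..4} \<and> j \<in> {1..4} \<and> i \<noteq> j}"

inductive_set rspan :: "('k::comm_ring_1 \<Rightarrow> 'r::ring_1 \<Rightarrow> 'r) \<Rightarrow> 'r set \<Rightarrow> 'r set"
  for sR :: "'k \<Rightarrow> 'r \<Rightarrow> 'r" and S :: "'r set" where
  rspan_gen: "s \<in> S \<Longrightarrow> s \<in> rspan sR S"
| rspan_zero: "0 \<in> rspan sR S"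
| rspan_add: "x \<in> rspan sR S \<Longrightarrow> y \<in> rspan sR S \<Longrightarrow> x + y \<in> rspan sR S"
| rspan_smult: "x \<in> rspan sR S \<Longrightarrow> sR c x \<in> rspan sR S"

definition R2I :: "('k::comm_ring_1 \<Rightarrow> 'r::ring_1 \<Rightarrow> 'r) \<Rightarrow> 'r set" where
  "R2I sR = rspan sR ({2 * r | r. True} \<union> {r * (s * t - t * s) | r s t. True})"

definition R2cl :: "('k::comm_ring_1 \<Rightarrow> 'r::ring_1 \<Rightarrow> 'r) \<Rightarrow> 'r \<Rightarrow> 'r set" where
  "R2cl sR a = {a + i | i. i \<in> R2I sR}"

definition Wmod :: "('k::comm_ring_1 \<Rightarrow> 'r::ring_1 \<Rightarrow> 'r) \<Rightarrow> ('k, nat \<Rightarrow> 'r set) lalg" where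
  "Wmod sR = \<lparr> lcarrier = {w. (\<forall>m. w m \<in> range (R2cl sR)) \<and> (\<forall>m. m \<notin> {1..6} \<longrightarrow> w m = R2cl sR 0)},
     ladd = (\<lambda>w w' m. R2cl sR ((SOME a. a \<in> w m) + (SOME b. b \<in> w' m))),
     lzero = (\<lambda>m. R2cl sR 0),
     lsmult = (\<lambda>c w m. R2cl sR (sR c (SOME a. a \<in> w m))),
     lbr = (\<lambda>w w' m. R2cl sR 0) \<rparr>"

definition epsW :: "('k::comm_ring_1 \<Rightarrow> 'r::ring_1 \<Rightarrow> 'r) \<Rightarrow> nat \<Rightarrow> 'r \<Rightarrow> (nat \<Rightarrow> 'r set)" where
  "epsW sR m a = (\<lambda>m'. if m' = m then R2cl sR a else R2cl sR 0)"

definition Pset :: "(nat \<times> nat \<times> nat \<times> nat) set" where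
  "Pset = {(i, j, k, l). {i, j, k, l} = {1, 2, 3, 4}}"

definition Gset :: "(nat \<Rightarrow> nat) set" where
  "Gset = {id,
           (\<lambda>x. if x = 1 then 3 else if x = 3 then 1 else x),
           (\<lambda>x. if x = 2 then 4 else if x = 4 then 2 else x),
           (\<lambda>x. if x = 1 then 3 else if x = 3 then 1 else if x = 2 then 4 else if x = 4 then 2 else x)}"

definition Pclass :: "(nat \<Rightarrow> nat) \<Rightarrow> (nat \<times> nat \<times> nat \<times> nat) set" where
  "Pclass \<sigma> = {(\<sigma> (g 1), \<sigma> (g 2), \<sigma> (g 3), \<sigma> (g 4)) | g. g \<in> Gset}"

text \<open>theta labels the six classes bijectively by 1..6, the class of (1,2,3,4) by 1.\<close>
definition valid_label :: "(nat \<times> nat \<times> nat \<times> nat \<Rightarrow> nat) \<Rightarrow> bool" where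
  "valid_label \<theta> \<longleftrightarrow> (\<forall>p\<in>Pset. \<theta> p \<in> {1..6}) \<and> \<theta> (1, 2, 3, 4) = 1 \<and>
     (\<forall>p\<in>Pset. \<forall>q\<in>Pset. \<theta> p = \<theta> q \<longleftrightarrow>
        (\<exists>\<sigma>. bij_betw \<sigma> {1..4} {1..4} \<and> p \<in> Pclass \<sigma> \<and> q \<in> Pclass \<sigma>))"

definition psi :: "('k::comm_ring_1 \<Rightarrow> 'r::ring_1 \<Rightarrow> 'r) \<Rightarrow> (nat \<times> nat \<times> nat \<times> nat \<Rightarrow> nat)
    \<Rightarrow> ((nat \<times> nat \<times> 'r) mag \<Rightarrow> 'k) set \<Rightarrow> ((nat \<times> nat \<times> 'r) mag \<Rightarrow> 'k) set \<Rightarrow> (nat \<Rightarrow> 'r set)" where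
  "psi sR \<theta> = (THE \<psi>.
     (\<forall>x\<in>lcarrier (stl4 sR). \<forall>y\<in>lcarrier (stl4 sR). \<psi> x y \<in> lcarrier (Wmod sR)) \<and>
     (\<forall>x\<in>lcarrier (stl4 sR). \<forall>y\<in>lcarrier (stl4 sR). \<forall>z\<in>lcarrier (stl4 sR).
        \<psi> (ladd (stl4 sR) x y) z = ladd (Wmod sR) (\<psi> x z) (\<psi> y z) \<and>
        \<psi> z (ladd (stl4 sR) x y) = ladd (Wmod sR) (\<psi> z x) (\<psi> z y)) \<and>
     (\<forall>c. \<forall>x\<in>lcarrier (stl4 sR). \<forall>y\<in>lcarrier (stl4 sR).
        \<psi> (lsmult (stl4 sR) c x) y = lsmult (Wmod sR) c (\<psi> x y) \<and>
        \<psi> x (lsmult (stl4 sR) c y) = lsmult (Wmod sR) c (\<psi> x y)) \<and>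
     (\<forall>i j k l a b. i \<in> {1..4} \<and> j \<in> {1..4} \<and> k \<in> {1..4} \<and> l \<in> {1..4} \<and> i \<noteq> j \<and> k \<noteq> l \<longrightarrow>
        \<psi> (stX sR i j a) (stX sR k l b) =
          (if (i, j, k, l) \<in> Pset then epsW sR (\<theta> (i, j, k, l)) (a * b) else lzero (Wmod sR))) \<and>
     (\<forall>h\<in>stH sR. \<forall>y\<in>lcarrier (stl4 sR). \<psi> h y = lzero (Wmod sR) \<and> \<psi> y h = lzero (Wmod sR)) \<and>
     (\<forall>x y. x \<notin> lcarrier (stl4 sR) \<or> y \<notin> lcarrier (stl4 sR) \<longrightarrow> \<psi> x y = lzero (Wmod sR)))"

definition stlhat :: "('k::comm_ring_1 \<Rightarrow> 'r::ring_1 \<Rightarrow> 'r) \<Rightarrow> (nat \<times> nat \<times> nat \<times> nat \<Rightarrow> nat)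
    \<Rightarrow> ('k, (nat \<Rightarrow> 'r set) \<times> ((nat \<times> nat \<times> 'r) mag \<Rightarrow> 'k) set) lalg" where
  "stlhat sR \<theta> = \<lparr> lcarrier = lcarrier (Wmod sR) \<times> lcarrier (stl4 sR),
     ladd = (\<lambda>(c, x) (c', y). (ladd (Wmod sR) c c', ladd (stl4 sR) x y)),
     lzero = (lzero (Wmod sR), lzero (stl4 sR)),
     lsmult = (\<lambda>k (c, x). (lsmult (Wmod sR) k c, lsmult (stl4 sR) k x)),
     lbr = (\<lambda>(c, x) (c', y). (psi sR \<theta> x y, lbr (stl4 sR) x y)) \<rparr>"

definition ftens :: "('k::comm_ring_1, 'a) lalg \<Rightarrow> nat \<Rightarrow> ('k, 'a list \<Rightarrow> 'k) lalg" where
  "ftens M n = \<lparr> lcarrier = {f. finite {xs. f xs \<noteq> 0} \<and>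
                     (\<forall>xs. f xs \<noteq> 0 \<longrightarrow> length xs = n \<and> set xs \<subseteq> lcarrier M)},
     ladd = (\<lambda>f g xs. f xs + g xs),
     lzero = (\<lambda>xs. 0),
     lsmult = (\<lambda>c f xs. c * f xs),
     lbr = (\<lambda>f g xs. 0) \<rparr>"

definition fvec :: "'a list \<Rightarrow> ('a list \<Rightarrow> 'k::comm_ring_1)" where
  "fvec xs = (\<lambda>ys. if ys = xs then 1 else 0)"

definition mlrel :: "('k::comm_ring_1, 'a) lalg \<Rightarrow> nat \<Rightarrow> ('a list \<Rightarrow> 'k) set" where
  "mlrel M n =
     {(\<lambda>ys. fvec (xs[p := ladd M x y]) ys - fvec (xs[p := x]) ys - fvec (xs[p := y]) ys)
       | xs p x y. length xs = n \<and> p < n \<and> set xs \<subseteq> lcarrier M \<and> x \<in> lcarrier M \<and> y \<in> lcarrier M}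
   \<union> {(\<lambda>ys. fvec (xs[p := lsmult M c x]) ys - c * fvec (xs[p := x]) ys)
       | xs p c x. length xs = n \<and> p < n \<and> set xs \<subseteq> lcarrier M \<and> x \<in> lcarrier M}"

definition tpow :: "('k::comm_ring_1, 'a) lalg \<Rightarrow> nat \<Rightarrow> ('k, ('a list \<Rightarrow> 'k) set) lalg" where
  "tpow M n = lquot (ftens M n) (lspan (ftens M n) (mlrel M n))"

definition tens :: "('k::comm_ring_1, 'a) lalg \<Rightarrow> nat \<Rightarrow> 'a list \<Rightarrow> ('a list \<Rightarrow> 'k) set" where
  "tens M n xs = lcoset (ftens M n) (lspan (ftens M n) (mlrel M n)) (fvec xs)"

definition delta2 :: "('k::comm_ring_1, 'a) lalg \<Rightarrow> ('a list \<Rightarrow> 'k) set \<Rightarrow> 'a" where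
  "delta2 L = (THE d. klinear (tpow L 2) L d \<and>
     (\<forall>x\<in>lcarrier L. \<forall>y\<in>lcarrier L. d (tens L 2 [x, y]) = lsmult L (-1) (lbr L x y)) \<and>
     (\<forall>z. z \<notin> lcarrier (tpow L 2) \<longrightarrow> d z = lzero L))"

definition delta3 :: "('k::comm_ring_1, 'a) lalg \<Rightarrow> ('a list \<Rightarrow> 'k) set \<Rightarrow> ('a list \<Rightarrow> 'k) set" where
  "delta3 L = (THE d. klinear (tpow L 3) (tpow L 2) d \<and>
     (\<forall>x\<in>lcarrier L. \<forall>y\<in>lcarrier L. \<forall>z\<in>lcarrier L.
        d (tens L 3 [x, y, z]) =
          ladd (tpow L 2)
            (ladd (tpow L 2) (lsmult (tpow L 2) (-1) (tens L 2 [lbr L x y, z]))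
                             (tens L 2 [lbr L x z, y]))
            (tens L 2 [x, lbr L y z])) \<and>
     (\<forall>z. z \<notin> lcarrier (tpow L 3) \<longrightarrow> d z = lzero (tpow L 2)))"

definition HL2 :: "('k::comm_ring_1, 'a) lalg \<Rightarrow> ('k, ('a list \<Rightarrow> 'k) set set) lalg" where
  "HL2 L = lquot ((tpow L 2)\<lparr> lcarrier := {z \<in> lcarrier (tpow L 2). delta2 L z = lzero L} \<rparr>)
                 (delta3 L ` lcarrier (tpow L 3))"

end

theory Submission
  imports Defs "HOL-Algebra.FiniteProduct"
begin

text \<open>Write \<open>L\<close> for \<open>stl4 sR\<close>. Mapping \<open>X i j a\<close> to \<open>a\<close> times a matrix unit is a homomorphism from \<open>L\<close> to
  matrices whose trace lies in \<open>R2I\<close>, and \<open>\<psi>\<close> is the pull-back of the polarised 2x2 minors with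
  complementary rows and columns; over a commutative ring of characteristic 2 these are cocycles on
  trace-zero matrices.

  Let \<open>B\<close> be a bilinear map on \<open>L\<close> with values in a module \<open>N\<close> satisfying
  \<open>B x [y, z] = B [x, y] z - B [x, z] y\<close>, and let \<open>d\<close> be a linear map from \<open>N\<close> to \<open>L\<close> with
  \<open>d (B x y) = [x, y]\<close>. The elements \<open>Y i j a = B (X i k a) (X k j 1)\<close> satisfy the relations of \<open>L\<close> except
  that \<open>B (X i j a) (X k l b)\<close> need not vanish for distinct indices; its values factor through \<open>\<psi>\<close> by a
  linear map \<open>E\<close>. Replacing \<open>B\<close> by \<open>B' = B - E \<circ> \<psi>\<close> makes \<open>N\<close>, with the bracket \<open>B' (d n) (d m)\<close>, a
  Leibniz algebra in which the \<open>Y i j a\<close> satisfy all relations. This gives a section \<open>\<phi>\<close> of \<open>d\<close>, and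
  \<open>(c, x) \<mapsto> E c + \<phi> x\<close> sends \<open>(\<psi> x y, [x, y])\<close> to \<open>B x y\<close>.

  For a central extension of \<open>L\<close>, take for \<open>B x y\<close> the bracket of lifts of \<open>x\<close> and \<open>y\<close>: this yields
  universality, uniqueness coming from perfectness of \<open>stlhat\<close>. For \<open>N\<close> the cokernel of \<open>delta3\<close> and
  \<open>B\<close> the tensor product, it yields a left inverse of the map \<open>x \<otimes> y \<mapsto> (\<psi> x y, [x, y])\<close>, which
  therefore identifies \<open>HL2 L\<close>, the kernel of the bracket map, with \<open>W\<close>.\<close>

section \<open>Modules on carriers\<close>

text \<open>Four is the critical size. A pair \<open>X i j a\<close>, \<open>X k l b\<close> with
  zero bracket and a repeated index leaves an index free, and factoring \<open>X k l b\<close>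
  through it forces \<open>B\<close> to vanish there; with four distinct indices none is left. The
  surviving values can only be compared by factoring one argument through an index of the other.
  This gives the exchange of columns with both signs, hence 2-torsion, and the exchange of rows with
  the coefficients turned around, hence invariance under commutators: so \<open>R2I\<close> arises.
  For a given coefficient the value then depends on the unordered row pair {i, k} alone, and there
  are six of these.

  Conversely, modulo \<open>R2I\<close> coefficients commute and signs disappear, and the vanishing
  trace makes the minors cocycles. Passing through matrices also supplies \<psi> as a well-defined
  map on a quotient of a free algebra.

  The two claims have targets of different kinds, an algebra over \<open>L\<close> and a mere
  module. The splitting argument therefore assumes no bracket on \<open>N\<close>: it makes one from
  \<open>B'\<close> and \<open>d\<close>, which satisfies the Leibniz identity whatever the kernel
  of \<open>d\<close> is.\<close>

notation ladd (infixl "\<oplus>\<index>" 65)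
notation lsub (infixl "\<ominus>\<index>" 65)
notation lzero ("\<zero>\<index>")
notation lsmult (infixr "\<odot>\<index>" 75)
notation lbr (infixl "\<bullet>\<index>" 70)

locale kmod =
  fixes M :: "('k::comm_ring_1, 'a) lalg" (structure)
  assumes kmodule: "kmodule M"
begin

lemma zero_closed [simp, intro]: "\<zero> \<in> lcarrier M"
  and add_closed [simp, intro]: "\<And>x y. x \<in> lcarrier M \<Longrightarrow> y \<in> lcarrier M \<Longrightarrow> x \<oplus> y \<in> lcarrier M"
  and smult_closed [simp, intro]: "\<And>c x. x \<in> lcarrier M \<Longrightarrow> c \<odot> x \<in> lcarrier M"
  and add_assoc: "\<And>x y z. x \<in> lcarrier M \<Longrightarrow> y \<in> lcarrier M \<Longrightarrow> z \<in> lcarrier M \<Longrightarrow>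
    x \<oplus> y \<oplus> z = x \<oplus> (y \<oplus> z)"
  and add_comm: "\<And>x y. x \<in> lcarrier M \<Longrightarrow> y \<in> lcarrier M \<Longrightarrow> x \<oplus> y = y \<oplus> x"
  and add_zero_left [simp]: "\<And>x. x \<in> lcarrier M \<Longrightarrow> \<zero> \<oplus> x = x"
  and add_neg [simp]: "\<And>x. x \<in> lcarrier M \<Longrightarrow> x \<oplus> (- 1) \<odot> x = \<zero>"
  and smult_one [simp]: "\<And>x. x \<in> lcarrier M \<Longrightarrow> 1 \<odot> x = x"
  and smult_assoc: "\<And>a b x. x \<in> lcarrier M \<Longrightarrow> (a * b) \<odot> x = a \<odot> b \<odot> x"
  and smult_add_left: "\<And>a b x. x \<in> lcarrier M \<Longrightarrow> (a + b) \<odot> x = a \<odot> x \<oplus> b \<odot> x"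
  and smult_add_right: "\<And>a x y. x \<in> lcarrier M \<Longrightarrow> y \<in> lcarrier M \<Longrightarrow>
    a \<odot> (x \<oplus> y) = a \<odot> x \<oplus> a \<odot> y"
  using kmodule unfolding kmodule_def by auto

lemma add_zero_right [simp]: "x \<in> lcarrier M \<Longrightarrow> x \<oplus> \<zero> = x"
  using add_comm [of x \<zero>] by simp

lemma add_left_comm:
  assumes "x \<in> lcarrier M" "y \<in> lcarrier M" "z \<in> lcarrier M"
  shows "x \<oplus> (y \<oplus> z) = y \<oplus> (x \<oplus> z)"
  using assms by (simp add: add_assoc [symmetric] add_comm [of x y])

lemmas add_ac = add_assoc add_comm add_left_comm

lemma add_left_cancel:
  assumes "x \<in> lcarrier M" "y \<in> lcarrier M" "z \<in> lcarrier M"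
  shows "x \<oplus> y = x \<oplus> z \<longleftrightarrow> y = z"
proof
  assume "x \<oplus> y = x \<oplus> z"
  then have "((- 1) \<odot> x) \<oplus> (x \<oplus> y) = ((- 1) \<odot> x) \<oplus> (x \<oplus> z)" by simp
  moreover have "((- 1) \<odot> x) \<oplus> (x \<oplus> w) = w" if "w \<in> lcarrier M" for w
    using assms that by (simp add: add_assoc [symmetric] add_comm [of "(- 1) \<odot> x" x])
  ultimately show "y = z" using assms by simp
qed simp

lemma smult_zero_right [simp]: "c \<odot> \<zero> = \<zero>"
  using smult_add_right [of \<zero> \<zero> c] add_left_cancel [of "c \<odot> \<zero>" "c \<odot> \<zero>" \<zero>] by simp

lemma smult_zero_left [simp]: "x \<in> lcarrier M \<Longrightarrow> 0 \<odot> x = \<zero>"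
  using smult_add_left [of x 0 0] add_left_cancel [of "0 \<odot> x" "0 \<odot> x" \<zero>] by simp

lemma neg_neg [simp]: "x \<in> lcarrier M \<Longrightarrow> (- 1) \<odot> (- 1) \<odot> x = x"
  using smult_assoc [of x "- 1" "- 1"] by simp

lemma smult_neg: "x \<in> lcarrier M \<Longrightarrow> c \<odot> (- 1) \<odot> x = (- 1) \<odot> c \<odot> x"
  using smult_assoc [of x "- 1" c] smult_assoc [of x c "- 1"] by (simp add: mult.commute)

lemma sub_closed [simp, intro]: "x \<in> lcarrier M \<Longrightarrow> y \<in> lcarrier M \<Longrightarrow> x \<ominus> y \<in> lcarrier M"
  by (simp add: lsub_def)

lemma sub_zero_right [simp]: "x \<in> lcarrier M \<Longrightarrow> x \<ominus> \<zero> = x"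
  by (simp add: lsub_def)

lemma sub_zero_left: "x \<in> lcarrier M \<Longrightarrow> \<zero> \<ominus> x = (- 1) \<odot> x"
  by (simp add: lsub_def)

lemma sub_self [simp]: "x \<in> lcarrier M \<Longrightarrow> x \<ominus> x = \<zero>"
  by (simp add: lsub_def)

lemma add_sub_cancel:
  assumes "x \<in> lcarrier M" "y \<in> lcarrier M"
  shows "y \<oplus> (x \<ominus> y) = x"
  using assms by (simp add: lsub_def add_left_comm [of y x])

lemma sub_eq_iff:
  assumes "x \<in> lcarrier M" "y \<in> lcarrier M" "z \<in> lcarrier M"
  shows "x \<ominus> y = z \<longleftrightarrow> x = z \<oplus> y"
  using add_left_cancel [of y "x \<ominus> y" z] assms by (simp add: add_sub_cancel add_comm)

lemma sub_eq_zero_iff: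
  assumes "x \<in> lcarrier M" "y \<in> lcarrier M"
  shows "x \<ominus> y = \<zero> \<longleftrightarrow> x = y"
  using assms by (simp add: sub_eq_iff)

lemma sub_sub_swap:
  assumes "a \<in> lcarrier M" "b \<in> lcarrier M" "c \<in> lcarrier M" "d \<in> lcarrier M"
  shows "(a \<ominus> b) \<ominus> (c \<ominus> d) = (a \<ominus> c) \<ominus> (b \<ominus> d)"
    and "(a \<oplus> b) \<ominus> (c \<oplus> d) = (a \<ominus> c) \<oplus> (b \<ominus> d)"
  using assms by (simp_all add: lsub_def smult_add_right add_ac)

lemma smult_sub:
  assumes "a \<in> lcarrier M" "b \<in> lcarrier M"
  shows "c \<odot> (a \<ominus> b) = c \<odot> a \<ominus> c \<odot> b"
  using assms by (simp add: lsub_def smult_add_right smult_neg)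

end

section \<open>Finite linear combinations and free modules\<close>

definition add_monoid_of :: "('k, 'a) lalg \<Rightarrow> 'a monoid" where
  "add_monoid_of M = \<lparr>carrier = lcarrier M, mult = ladd M, one = lzero M\<rparr>"

text \<open>The linear extension of a map \<open>g\<close> on basis elements, evaluated at a
  finitely supported coefficient function \<open>f\<close>.\<close>

definition kspan_sum :: "('k, 'a) lalg \<Rightarrow> ('b \<Rightarrow> 'a) \<Rightarrow> ('b \<Rightarrow> 'k::zero) \<Rightarrow> 'a" where
  "kspan_sum N g f = finprod (add_monoid_of N) (\<lambda>t. f t \<odot>\<^bsub>N\<^esub> g t) {t. f t \<noteq> 0}"

definition fsupp :: "'b set \<Rightarrow> ('b \<Rightarrow> 'k::zero) set" where
  "fsupp T = {f. finite {t. f t \<noteq> 0} \<and> (\<forall>t. t \<notin> T \<longrightarrow> f t = 0)}"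

definition delta :: "'b \<Rightarrow> 'b \<Rightarrow> 'k::zero_neq_one" where
  "delta s = (\<lambda>t. if t = s then 1 else 0)"

lemma add_monoid_of_simps [simp]:
  "carrier (add_monoid_of M) = lcarrier M" "mult (add_monoid_of M) = ladd M"
  "one (add_monoid_of M) = lzero M"
  by (simp_all add: add_monoid_of_def)

text \<open>The bracket is left open, so that the algebra of bracketings and the modules of formal
  tensors, whose brackets differ, share one universal property.\<close>

definition free_on :: "'b set \<Rightarrow> ('k::comm_ring_1, 'b \<Rightarrow> 'k) lalg \<Rightarrow> bool" where
  "free_on T A \<longleftrightarrow> lcarrier A = fsupp T \<and> ladd A = (\<lambda>f g t. f t + g t) \<and>
     lzero A = (\<lambda>t. 0) \<and> lsmult A = (\<lambda>c f t. c * f t)"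

lemma fsupp_add:
  fixes f g :: "'b \<Rightarrow> 'k::comm_ring_1"
  assumes "f \<in> fsupp T" "g \<in> fsupp T"
  shows "(\<lambda>t. f t + g t) \<in> fsupp T"
proof -
  have "finite {t. f t + g t \<noteq> 0}"
    by (rule finite_subset [of _ "{t. f t \<noteq> 0} \<union> {t. g t \<noteq> 0}"])
      (use assms in \<open>auto simp: fsupp_def\<close>)
  then show ?thesis using assms by (auto simp: fsupp_def)
qed

lemma fsupp_smult:
  fixes f :: "'b \<Rightarrow> 'k::comm_ring_1"
  assumes "f \<in> fsupp T"
  shows "(\<lambda>t. c * f t) \<in> fsupp T"
proof -
  have "finite {t. c * f t \<noteq> 0}"
    by (rule finite_subset [of _ "{t. f t \<noteq> 0}"]) (use assms in \<open>auto simp: fsupp_def\<close>)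
  then show ?thesis using assms by (auto simp: fsupp_def)
qed

lemma delta_fsupp: "s \<in> T \<Longrightarrow> (delta s :: _ \<Rightarrow> 'k::comm_ring_1) \<in> fsupp T"
  unfolding fsupp_def delta_def by auto

lemma free_on_kmodule:
  assumes "free_on T A"
  shows "kmodule A"
proof -
  have "(\<lambda>t. 0) \<in> fsupp T" by (simp add: fsupp_def)
  with assms show ?thesis unfolding kmodule_def free_on_def
    by (simp add: fsupp_add fsupp_smult distrib_left distrib_right add.assoc mult.assoc add.commute add.left_commute)
qed

text \<open>One point of the support is split off at a time. The induction runs over finite sets
  that merely contain the support, since the coefficient split off may already be zero.\<close>

lemma free_on_induct [consumes 2, case_names zero delta add smult]:
  assumes A: "free_on T A" and f: "f \<in> lcarrier A"
    and z: "P (lzero A)" and d: "\<And>s. s \<in> T \<Longrightarrow> P (delta s)"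
    and a: "\<And>f g. f \<in> lcarrier A \<Longrightarrow> g \<in> lcarrier A \<Longrightarrow> P f \<Longrightarrow> P g \<Longrightarrow> P (ladd A f g)"
    and s: "\<And>c f. f \<in> lcarrier A \<Longrightarrow> P f \<Longrightarrow> P (lsmult A c f)"
  shows "P f"
proof -
  have "finite S \<Longrightarrow> S \<subseteq> T \<Longrightarrow> {t. f t \<noteq> 0} \<subseteq> S \<Longrightarrow> P f" for S f
  proof (induction S arbitrary: f rule: finite_induct)
    case empty
    then have "f = lzero A" using A by (auto simp: free_on_def)
    then show ?case using z by simp
  next
    case (insert s S)
    let ?g = "f(s := 0)" and ?d = "lsmult A (f s) (delta s)"
    have eq: "f = ladd A ?g ?d" using A by (auto simp: free_on_def delta_def)
    have sub: "{t. ?g t \<noteq> 0} \<subseteq> S" using insert.prems by auto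
    have "finite {t. ?g t \<noteq> 0}" using sub insert.hyps(1) by (rule finite_subset)
    then have g: "?g \<in> lcarrier A" using A insert.prems by (auto simp: free_on_def fsupp_def)
    have d': "delta s \<in> lcarrier A" using A insert.prems(1) by (auto simp: free_on_def delta_fsupp)
    have "?d \<in> lcarrier A" "P ?d"
      using A d' d s insert.prems(1) by (auto simp: free_on_def fsupp_smult)
    moreover have "P ?g" using insert.IH insert.prems(1) sub by blast
    ultimately show ?case using eq a g by metis
  qed
  then show ?thesis using f A by (auto simp: free_on_def fsupp_def)
qed

context kmod
begin

lemma comm_monoid_add: "comm_monoid (add_monoid_of M)"
  by (rule comm_monoidI) (auto simp: add_monoid_of_def add_ac)

interpretation AM: comm_monoid "add_monoid_of M" by (rule comm_monoid_add)

text \<open>The support of a sum is in general neither of the two supports, so additivity is proved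
  with all sums taken over one common index set.\<close>

lemma kspan_sum_superset:
  assumes "finite S" "{t. f t \<noteq> 0} \<subseteq> S" "g ` S \<subseteq> lcarrier M"
  shows "kspan_sum M g f = finprod (add_monoid_of M) (\<lambda>t. f t \<odot> g t) S"
  unfolding kspan_sum_def
proof (rule AM.finprod_mono_neutral_cong_left)
  show "(\<lambda>t. f t \<odot> g t) \<in> S \<rightarrow> carrier (add_monoid_of M)"
    using assms by (auto)
  show "\<And>i. i \<in> S - {t. f t \<noteq> 0} \<Longrightarrow> f i \<odot> g i = \<one>\<^bsub>add_monoid_of M\<^esub>"
    using assms by (auto)
qed (use assms in auto)

lemma kspan_sum_klinear:
  assumes A: "free_on T A" and g: "g ` T \<subseteq> lcarrier M"
  shows "klinear A M (kspan_sum M g)"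
  unfolding klinear_def
proof (intro conjI ballI allI)
  let ?G = "add_monoid_of M"
  have fs: "finite {t. f t \<noteq> 0}" "{t. f t \<noteq> 0} \<subseteq> T" if "f \<in> lcarrier A" for f
    using that A by (auto simp: free_on_def fsupp_def)
  show "kspan_sum M g ` lcarrier A \<subseteq> lcarrier M"
  proof clarify
    fix f assume f: "f \<in> lcarrier A"
    have "kspan_sum M g f \<in> carrier ?G" unfolding kspan_sum_def
      by (rule AM.finprod_closed) (use fs[OF f] g in auto)
    then show "kspan_sum M g f \<in> lcarrier M" by simp
  qed
  fix f assume f: "f \<in> lcarrier A"
  let ?F = "{t. f t \<noteq> 0}"
  show "kspan_sum M g (ladd A f h) = kspan_sum M g f \<oplus> kspan_sum M g h" if h: "h \<in> lcarrier A" for h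
  proof -
    let ?S = "?F \<union> {t. h t \<noteq> 0}"
    have S: "finite ?S" "g ` ?S \<subseteq> lcarrier M" using fs[OF f] fs[OF h] g by auto
    have "kspan_sum M g (ladd A f h) = finprod ?G (\<lambda>t. (f t + h t) \<odot> g t) ?S"
      using A S by (subst kspan_sum_superset[where S = ?S]) (auto simp: free_on_def)
    also have "\<dots> = finprod ?G (\<lambda>t. f t \<odot> g t \<otimes>\<^bsub>?G\<^esub> h t \<odot> g t) ?S"
      by (rule AM.finprod_cong') (use S in \<open>auto simp: smult_add_left\<close>)
    also have "\<dots> = finprod ?G (\<lambda>t. f t \<odot> g t) ?S \<otimes>\<^bsub>?G\<^esub> finprod ?G (\<lambda>t. h t \<odot> g t) ?S"
      by (rule AM.finprod_multf) (use S in auto)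
    also have "\<dots> = kspan_sum M g f \<oplus> kspan_sum M g h"
      using S by (subst (1 2) kspan_sum_superset[where S = ?S]) (auto)
    finally show ?thesis .
  qed
  fix c
  have "finite S \<Longrightarrow> g ` S \<subseteq> lcarrier M \<Longrightarrow>
      finprod ?G (\<lambda>t. (c * f t) \<odot> g t) S = c \<odot> finprod ?G (\<lambda>t. f t \<odot> g t) S" for S
  proof (induction S rule: finite_induct)
    case empty
    then show ?case by simp
  next
    case (insert s S)
    have 1: "finprod ?G (\<lambda>t. (c * f t) \<odot> g t) (insert s S) =
        (c * f s) \<odot> g s \<oplus> finprod ?G (\<lambda>t. (c * f t) \<odot> g t) S"
      using insert by (subst AM.finprod_insert) (auto)
    have 2: "finprod ?G (\<lambda>t. f t \<odot> g t) (insert s S) =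
        f s \<odot> g s \<oplus> finprod ?G (\<lambda>t. f t \<odot> g t) S"
      using insert by (subst AM.finprod_insert) (auto)
    have "finprod ?G (\<lambda>t. f t \<odot> g t) S \<in> carrier ?G"
      by (rule AM.finprod_closed) (use insert in auto)
    then show ?case using insert 1 2
      by (simp add: smult_add_right smult_assoc)
  qed
  from this[of ?F] show "kspan_sum M g (lsmult A c f) = c \<odot> kspan_sum M g f"
    using A fs[OF f] g f
    by (subst (1 2) kspan_sum_superset[where S = ?F]) (auto simp: free_on_def)
qed

lemma kspan_sum_delta:
  assumes "g s \<in> lcarrier M"
  shows "kspan_sum M g (delta s) = g s"
  using assms
  by (subst kspan_sum_superset[where S = "{s}"]) (auto simp: delta_def)

end

section \<open>Linear and bilinear maps\<close>

lemma klinearI: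
  assumes "\<And>x. x \<in> lcarrier M \<Longrightarrow> f x \<in> lcarrier N"
    and "\<And>x y. x \<in> lcarrier M \<Longrightarrow> y \<in> lcarrier M \<Longrightarrow> f (x \<oplus>\<^bsub>M\<^esub> y) = f x \<oplus>\<^bsub>N\<^esub> f y"
    and "\<And>c x. x \<in> lcarrier M \<Longrightarrow> f (c \<odot>\<^bsub>M\<^esub> x) = c \<odot>\<^bsub>N\<^esub> f x"
  shows "klinear M N f"
  using assms unfolding klinear_def by auto

lemma
  assumes "klinear M N f"
  shows klinear_closed: "x \<in> lcarrier M \<Longrightarrow> f x \<in> lcarrier N"
    and klinear_add: "x \<in> lcarrier M \<Longrightarrow> y \<in> lcarrier M \<Longrightarrow> f (x \<oplus>\<^bsub>M\<^esub> y) = f x \<oplus>\<^bsub>N\<^esub> f y"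
    and klinear_smult: "x \<in> lcarrier M \<Longrightarrow> f (c \<odot>\<^bsub>M\<^esub> x) = c \<odot>\<^bsub>N\<^esub> f x"
  using assms unfolding klinear_def by auto

lemma klinear_zero:
  assumes "klinear M N f" "kmodule M" "kmodule N"
  shows "f \<zero>\<^bsub>M\<^esub> = \<zero>\<^bsub>N\<^esub>"
proof -
  interpret M: kmod M using assms(2) by (rule kmod.intro)
  interpret N: kmod N using assms(3) by (rule kmod.intro)
  have "f (0 \<odot>\<^bsub>M\<^esub> \<zero>\<^bsub>M\<^esub>) = 0 \<odot>\<^bsub>N\<^esub> f \<zero>\<^bsub>M\<^esub>"
    using assms(1) by (intro klinear_smult) auto
  then show ?thesis using klinear_closed [OF assms(1) M.zero_closed] by simp
qed

lemma klinear_sub: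
  assumes "klinear M N f" "kmodule M" "x \<in> lcarrier M" "y \<in> lcarrier M"
  shows "f (x \<ominus>\<^bsub>M\<^esub> y) = f x \<ominus>\<^bsub>N\<^esub> f y"
proof -
  interpret M: kmod M using assms(2) by (rule kmod.intro)
  show ?thesis using assms by (simp add: lsub_def klinear_add klinear_smult)
qed

lemma klinear_comp:
  assumes "klinear M N f" "klinear N P g"
  shows "klinear M P (\<lambda>x. g (f x))"
  using assms by (intro klinearI) (simp_all add: klinear_closed klinear_add klinear_smult)

definition kbilinear ::
  "('k::comm_ring_1, 'a) lalg \<Rightarrow> ('k, 'b) lalg \<Rightarrow> ('a \<Rightarrow> 'a \<Rightarrow> 'b) \<Rightarrow> bool" where
  "kbilinear L N B \<longleftrightarrow>
     (\<forall>x\<in>lcarrier L. klinear L N (B x)) \<and> (\<forall>y\<in>lcarrier L. klinear L N (\<lambda>x. B x y))"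

lemma kbilinear_left: "kbilinear L N B \<Longrightarrow> y \<in> lcarrier L \<Longrightarrow> klinear L N (\<lambda>x. B x y)"
  and kbilinear_right: "kbilinear L N B \<Longrightarrow> x \<in> lcarrier L \<Longrightarrow> klinear L N (B x)"
  by (auto simp: kbilinear_def)

lemma
  assumes "kbilinear L N B"
  shows kbilinear_closed: "x \<in> lcarrier L \<Longrightarrow> y \<in> lcarrier L \<Longrightarrow> B x y \<in> lcarrier N"
    and kbilinear_add_left: "x \<in> lcarrier L \<Longrightarrow> y \<in> lcarrier L \<Longrightarrow> z \<in> lcarrier L \<Longrightarrow>
      B (x \<oplus>\<^bsub>L\<^esub> y) z = B x z \<oplus>\<^bsub>N\<^esub> B y z"
    and kbilinear_add_right: "x \<in> lcarrier L \<Longrightarrow> y \<in> lcarrier L \<Longrightarrow> z \<in> lcarrier L \<Longrightarrow>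
      B z (x \<oplus>\<^bsub>L\<^esub> y) = B z x \<oplus>\<^bsub>N\<^esub> B z y"
    and kbilinear_smult_left: "x \<in> lcarrier L \<Longrightarrow> y \<in> lcarrier L \<Longrightarrow>
      B (c \<odot>\<^bsub>L\<^esub> x) y = c \<odot>\<^bsub>N\<^esub> B x y"
    and kbilinear_smult_right: "x \<in> lcarrier L \<Longrightarrow> y \<in> lcarrier L \<Longrightarrow>
      B x (c \<odot>\<^bsub>L\<^esub> y) = c \<odot>\<^bsub>N\<^esub> B x y"
  using assms unfolding kbilinear_def klinear_def by (auto simp: image_subset_iff)

lemma kbilinearI:
  assumes "\<And>x y. x \<in> lcarrier L \<Longrightarrow> y \<in> lcarrier L \<Longrightarrow> B x y \<in> lcarrier N"
    and "\<And>x y z. x \<in> lcarrier L \<Longrightarrow> y \<in> lcarrier L \<Longrightarrow> z \<in> lcarrier L \<Longrightarrow>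
      B (x \<oplus>\<^bsub>L\<^esub> y) z = B x z \<oplus>\<^bsub>N\<^esub> B y z"
    and "\<And>x y z. x \<in> lcarrier L \<Longrightarrow> y \<in> lcarrier L \<Longrightarrow> z \<in> lcarrier L \<Longrightarrow>
      B z (x \<oplus>\<^bsub>L\<^esub> y) = B z x \<oplus>\<^bsub>N\<^esub> B z y"
    and "\<And>c x y. x \<in> lcarrier L \<Longrightarrow> y \<in> lcarrier L \<Longrightarrow> B (c \<odot>\<^bsub>L\<^esub> x) y = c \<odot>\<^bsub>N\<^esub> B x y"
    and "\<And>c x y. x \<in> lcarrier L \<Longrightarrow> y \<in> lcarrier L \<Longrightarrow> B x (c \<odot>\<^bsub>L\<^esub> y) = c \<odot>\<^bsub>N\<^esub> B x y"
  shows "kbilinear L N B"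
  using assms unfolding kbilinear_def klinear_def by auto

text \<open>The stage before the Leibniz identity is imposed; the free algebra on bracketings
  reaches only this one.\<close>

definition kalgebra :: "('k::comm_ring_1, 'a) lalg \<Rightarrow> bool" where
  "kalgebra A \<longleftrightarrow> kmodule A \<and> kbilinear A A (lbr A)"

lemma leibniz_iff:
  "leibniz L \<longleftrightarrow> kalgebra L \<and>
     (\<forall>x\<in>lcarrier L. \<forall>y\<in>lcarrier L. \<forall>z\<in>lcarrier L.
         x \<bullet>\<^bsub>L\<^esub> (y \<bullet>\<^bsub>L\<^esub> z) = (x \<bullet>\<^bsub>L\<^esub> y) \<bullet>\<^bsub>L\<^esub> z \<ominus>\<^bsub>L\<^esub> (x \<bullet>\<^bsub>L\<^esub> z) \<bullet>\<^bsub>L\<^esub> y)"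
  unfolding leibniz_def kalgebra_def kbilinear_def klinear_def by (rule iffI; auto simp: image_subset_iff)

lemma leibnizI:
  assumes "kmodule L" "kbilinear L L (lbr L)"
    and "\<And>x y z. x \<in> lcarrier L \<Longrightarrow> y \<in> lcarrier L \<Longrightarrow> z \<in> lcarrier L \<Longrightarrow>
         x \<bullet>\<^bsub>L\<^esub> (y \<bullet>\<^bsub>L\<^esub> z) = (x \<bullet>\<^bsub>L\<^esub> y) \<bullet>\<^bsub>L\<^esub> z \<ominus>\<^bsub>L\<^esub> (x \<bullet>\<^bsub>L\<^esub> z) \<bullet>\<^bsub>L\<^esub> y"
  shows "leibniz L"
  using assms by (simp add: leibniz_iff kalgebra_def)

lemma leibniz_kmodule: "leibniz L \<Longrightarrow> kmodule L"
  and leibniz_kbilinear: "leibniz L \<Longrightarrow> kbilinear L L (lbr L)"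
  by (simp_all add: leibniz_iff kalgebra_def)

lemma leibniz_identity:
  "leibniz L \<Longrightarrow> x \<in> lcarrier L \<Longrightarrow> y \<in> lcarrier L \<Longrightarrow> z \<in> lcarrier L \<Longrightarrow>
    x \<bullet>\<^bsub>L\<^esub> (y \<bullet>\<^bsub>L\<^esub> z) = (x \<bullet>\<^bsub>L\<^esub> y) \<bullet>\<^bsub>L\<^esub> z \<ominus>\<^bsub>L\<^esub> (x \<bullet>\<^bsub>L\<^esub> z) \<bullet>\<^bsub>L\<^esub> y"
  by (simp add: leibniz_iff)

section \<open>Quotients by submodules and ideals\<close>

definition submodule :: "('k::comm_ring_1, 'a) lalg \<Rightarrow> 'a set \<Rightarrow> bool" where
  "submodule M I \<longleftrightarrow> I \<subseteq> lcarrier M \<and> lzero M \<in> I \<and>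
     (\<forall>x\<in>I. \<forall>y\<in>I. ladd M x y \<in> I) \<and> (\<forall>c. \<forall>x\<in>I. lsmult M c x \<in> I)"

locale quotient_module = kmod +
  fixes I
  assumes submodule: "submodule M I"
begin

abbreviation cls :: "'b \<Rightarrow> 'b set" where "cls \<equiv> lcoset M I"

lemma sub_carrier: "x \<in> I \<Longrightarrow> x \<in> lcarrier M"
  and sub_zero [simp]: "\<zero> \<in> I"
  and sub_add: "x \<in> I \<Longrightarrow> y \<in> I \<Longrightarrow> x \<oplus> y \<in> I"
  and sub_smult: "x \<in> I \<Longrightarrow> c \<odot> x \<in> I"
  using submodule by (auto simp: submodule_def)

lemma sub_diff: "x \<in> I \<Longrightarrow> y \<in> I \<Longrightarrow> x \<ominus> y \<in> I"
  by (simp add: lsub_def sub_add sub_smult)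

lemma lcoset_self: "x \<in> lcarrier M \<Longrightarrow> x \<in> cls x"
  by (auto simp: lcoset_def intro!: exI [of _ \<zero>])

lemma lcoset_add_sub:
  assumes x: "x \<in> lcarrier M" and i: "i \<in> I"
  shows "cls (x \<oplus> i) = cls x"
proof -
  have "x \<oplus> i \<oplus> j \<in> cls x" if "j \<in> I" for j
    using x i that unfolding lcoset_def by (auto intro!: exI[of _ "i \<oplus> j"] simp: add_assoc sub_carrier sub_add)
  moreover have "x \<oplus> j \<in> cls (x \<oplus> i)" if "j \<in> I" for j
    using x i that add_sub_cancel[of j i] unfolding lcoset_def
    by (auto intro!: exI[of _ "j \<ominus> i"] simp: add_assoc sub_carrier sub_diff)
  ultimately show ?thesis unfolding lcoset_def[of M I x] lcoset_def[of M I "x \<oplus> i"]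
    by (auto simp: lcoset_def)
qed

lemma lcoset_eq_iff:
  assumes "x \<in> lcarrier M" "y \<in> lcarrier M"
  shows "cls x = cls y \<longleftrightarrow> x \<ominus> y \<in> I"
proof
  assume "cls x = cls y"
  then obtain i where "i \<in> I" "x = y \<oplus> i"
    using lcoset_self[OF assms(1)] by (auto simp: lcoset_def)
  then show "x \<ominus> y \<in> I" using assms sub_eq_iff[of x y i] by (simp add: sub_carrier add_comm)
next
  assume "x \<ominus> y \<in> I"
  then show "cls x = cls y" using lcoset_add_sub[of y "x \<ominus> y"] assms by (simp add: add_sub_cancel)
qed

text \<open>The operations of \<open>lquot\<close> act on representatives picked by
  \<open>SOME\<close>. Such a pick differs from a given representative by an element of
  \<open>I\<close>, and each well-definedness argument below only absorbs that difference.\<close>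

lemma some_lcoset:
  assumes "x \<in> lcarrier M"
  obtains i where "i \<in> I" "(SOME y. y \<in> cls x) = x \<oplus> i"
proof -
  have "(SOME y. y \<in> cls x) \<in> cls x" using lcoset_self[OF assms] by (rule someI)
  then show ?thesis using that by (auto simp: lcoset_def)
qed

lemma lcarrier_lquot: "lcarrier (lquot M I) = cls ` lcarrier M"
  and lzero_lquot: "lzero (lquot M I) = cls \<zero>"
  by (simp_all add: lquot_def)

lemma lcoset_carrier [simp, intro]: "x \<in> lcarrier M \<Longrightarrow> cls x \<in> lcarrier (lquot M I)"
  by (simp add: lcarrier_lquot)

lemma lquot_add:
  assumes "x \<in> lcarrier M" "y \<in> lcarrier M"
  shows "cls x \<oplus>\<^bsub>lquot M I\<^esub> cls y = cls (x \<oplus> y)"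
proof -
  obtain i where i: "i \<in> I" "(SOME y. y \<in> cls x) = x \<oplus> i" using some_lcoset[OF assms(1)] .
  obtain j where j: "j \<in> I" "(SOME x. x \<in> cls y) = y \<oplus> j" using some_lcoset[OF assms(2)] .
  have "x \<oplus> i \<oplus> (y \<oplus> j) = x \<oplus> y \<oplus> (i \<oplus> j)"
    using assms i j by (simp add: add_ac sub_carrier)
  then show ?thesis using assms i j
    by (simp add: lquot_def lcoset_add_sub sub_add)
qed

lemma lquot_smult:
  assumes "x \<in> lcarrier M"
  shows "c \<odot>\<^bsub>lquot M I\<^esub> cls x = cls (c \<odot> x)"
proof -
  obtain i where i: "i \<in> I" "(SOME y. y \<in> cls x) = x \<oplus> i" using some_lcoset[OF assms(1)] .
  then show ?thesis using assms
    by (simp add: lquot_def smult_add_right lcoset_add_sub sub_smult sub_carrier)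
qed

lemma kmodule_lquot: "kmodule (lquot M I)"
  unfolding kmodule_def lcarrier_lquot lzero_lquot
  by (simp add: lquot_add lquot_smult smult_assoc smult_add_left smult_add_right)
    (simp add: add_ac)

lemma klinear_lcoset: "klinear M (lquot M I) cls"
  by (rule klinearI) (simp_all add: lquot_add lquot_smult)

end

definition quot_lift :: "('a \<Rightarrow> 'b) \<Rightarrow> 'a set \<Rightarrow> 'b" where
  "quot_lift f C = f (SOME x. x \<in> C)"

context quotient_module
begin

lemma quot_lift_lcoset:
  assumes f: "klinear M N f" and N: "kmodule N" and I: "\<And>i. i \<in> I \<Longrightarrow> f i = lzero N"
    and x: "x \<in> lcarrier M"
  shows "quot_lift f (cls x) = f x"
proof -
  interpret N: kmod N using N by (rule kmod.intro)
  obtain i where i: "i \<in> I" "(SOME y. y \<in> cls x) = x \<oplus> i" using some_lcoset[OF x] .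
  then show ?thesis using x f I
    by (simp add: quot_lift_def klinear_add sub_carrier klinear_closed)
qed

lemma klinear_quot_lift:
  assumes f: "klinear M N f" and N: "kmodule N" and I: "\<And>i. i \<in> I \<Longrightarrow> f i = lzero N"
  shows "klinear (lquot M I) N (quot_lift f)"
  by (rule klinearI)
    (auto simp: lcarrier_lquot lquot_add lquot_smult quot_lift_lcoset[OF f N I]
      klinear_closed[OF f] klinear_add[OF f] klinear_smult[OF f])

end

locale quotient_algebra = quotient_module +
  assumes kalgebra: "kalgebra M"
    and ideal_left: "x \<in> I \<Longrightarrow> a \<in> lcarrier M \<Longrightarrow> a \<bullet> x \<in> I"
    and ideal_right: "x \<in> I \<Longrightarrow> a \<in> lcarrier M \<Longrightarrow> x \<bullet> a \<in> I"
begin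

lemma lbr_bilinear: "kbilinear M M (\<bullet>)"
  using kalgebra by (simp add: kalgebra_def)

lemma lquot_lbr:
  assumes "x \<in> lcarrier M" "y \<in> lcarrier M"
  shows "cls x \<bullet>\<^bsub>lquot M I\<^esub> cls y = cls (x \<bullet> y)"
proof -
  note b = kbilinear_add_left[OF lbr_bilinear] kbilinear_add_right[OF lbr_bilinear]
    kbilinear_closed[OF lbr_bilinear]
  obtain i where i: "i \<in> I" "(SOME y. y \<in> cls x) = x \<oplus> i" using some_lcoset[OF assms(1)] .
  obtain j where j: "j \<in> I" "(SOME x. x \<in> cls y) = y \<oplus> j" using some_lcoset[OF assms(2)] .
  have "(x \<oplus> i) \<bullet> (y \<oplus> j) = x \<bullet> y \<oplus> (i \<bullet> y \<oplus> (x \<oplus> i) \<bullet> j)"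
    using assms i j by (simp add: add_ac sub_carrier b)
  moreover have "i \<bullet> y \<oplus> (x \<oplus> i) \<bullet> j \<in> I" using assms i j
    by (simp add: sub_add ideal_left ideal_right sub_carrier)
  ultimately show ?thesis using assms i j
    by (simp add: lquot_def lcoset_add_sub b)
qed

lemma kbilinear_lquot: "kbilinear (lquot M I) (lquot M I) (lbr (lquot M I))"
proof -
  note b = kbilinear_add_left[OF lbr_bilinear] kbilinear_add_right[OF lbr_bilinear]
    kbilinear_closed[OF lbr_bilinear] kbilinear_smult_left[OF lbr_bilinear]
    kbilinear_smult_right[OF lbr_bilinear]
  show ?thesis
    by (rule kbilinearI) (auto simp: lcarrier_lquot lquot_add lquot_smult lquot_lbr b)
qed

end

lemma lideal_carrier:
  assumes "kalgebra A" "S \<subseteq> lcarrier A" "x \<in> lideal A S"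
  shows "x \<in> lcarrier A"
proof -
  interpret kmod A using assms(1) by (simp add: kmod.intro kalgebra_def)
  show ?thesis using assms(3)
    by induction (use assms kbilinear_closed[of A A "lbr A"] in \<open>auto simp: kalgebra_def\<close>)
qed

lemma quotient_algebra_lideal:
  assumes "kalgebra A" "S \<subseteq> lcarrier A"
  shows "quotient_algebra A (lideal A S)"
proof unfold_locales
  show "submodule A (lideal A S)" unfolding submodule_def
    using lideal_carrier[OF assms]
    by (auto intro: lideal.intros)
qed (use assms in \<open>auto simp: kalgebra_def intro: lideal.intros\<close>)

lemma lspan_carrier:
  assumes "kmodule A" "S \<subseteq> lcarrier A" "x \<in> lspan A S"
  shows "x \<in> lcarrier A"
proof -
  interpret kmod A using assms(1) by (rule kmod.intro)
  show ?thesis using assms(3) by induction (use assms in auto)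
qed

lemma quotient_module_lspan:
  assumes "kmodule A" "S \<subseteq> lcarrier A"
  shows "quotient_module A (lspan A S)"
proof unfold_locales
  show "submodule A (lspan A S)" unfolding submodule_def
    using lspan_carrier[OF assms]
    by (auto intro: lspan.intros)
qed (use assms in auto)

lemma klinear_eq_on_lspan:
  assumes "klinear M N f" "klinear M N g" "kmodule M" "kmodule N" "S \<subseteq> lcarrier M"
    and "\<And>s. s \<in> S \<Longrightarrow> f s = g s" and x: "x \<in> lspan M S"
  shows "f x = g x"
  using x
proof induction
  case span_zero
  then show ?case using assms klinear_zero by metis
qed (use assms lspan_carrier[OF assms(3,5)] in \<open>auto simp: klinear_add klinear_smult\<close>)

section \<open>The Steinberg Leibniz algebra\<close>

lemma lhomI:
  assumes "klinear L M f"
    and "\<And>x y. x \<in> lcarrier L \<Longrightarrow> y \<in> lcarrier L \<Longrightarrow> f (x \<bullet>\<^bsub>L\<^esub> y) = f x \<bullet>\<^bsub>M\<^esub> f y"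
  shows "lhom L M f"
  using assms by (simp add: lhom_def)

lemma lhom_klinear: "lhom L M f \<Longrightarrow> klinear L M f"
  and lhom_lbr: "lhom L M f \<Longrightarrow> x \<in> lcarrier L \<Longrightarrow> y \<in> lcarrier L \<Longrightarrow>
    f (x \<bullet>\<^bsub>L\<^esub> y) = f x \<bullet>\<^bsub>M\<^esub> f y"
  by (simp_all add: lhom_def)

section \<open>The free algebra on bracketings and its universal property\<close>

primrec mag_eval :: "('k, 'a) lalg \<Rightarrow> ('g \<Rightarrow> 'a) \<Rightarrow> 'g mag \<Rightarrow> 'a" where
  "mag_eval A \<gamma> (Leaf g) = \<gamma> g"
| "mag_eval A \<gamma> (Node u v) = mag_eval A \<gamma> u \<bullet>\<^bsub>A\<^esub> mag_eval A \<gamma> v"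

lemma free_on_fm: "free_on {t. set_mag t \<subseteq> G} (fm G)"
  unfolding free_on_def fm_def fsupp_def by auto

lemma kalgebra_fm: "kalgebra (fm G :: ('k::comm_ring_1, 'g mag \<Rightarrow> 'k) lalg)"
  unfolding kalgebra_def
proof
  show "kmodule (fm G :: ('k::comm_ring_1, 'g mag \<Rightarrow> 'k) lalg)"
    using free_on_fm by (rule free_on_kmodule)
  let ?A = "fm G :: ('k, 'g mag \<Rightarrow> 'k) lalg"
  show "kbilinear ?A ?A (lbr ?A)"
  proof (rule kbilinearI)
    fix f g assume f: "f \<in> lcarrier ?A" and g: "g \<in> lcarrier ?A"
    let ?S = "(\<lambda>(u, v). Node u v) ` ({t. f t \<noteq> 0} \<times> {t. g t \<noteq> 0})"
    have "{t. (f \<bullet>\<^bsub>?A\<^esub> g) t \<noteq> 0} \<subseteq> ?S"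
    proof
      fix t assume "t \<in> {t. (f \<bullet>\<^bsub>?A\<^esub> g) t \<noteq> 0}"
      then show "t \<in> ?S" by (cases t) (force simp: fm_def)+
    qed
    moreover have "finite ?S" using f g by (auto simp: fm_def)
    ultimately have "finite {t. (f \<bullet>\<^bsub>?A\<^esub> g) t \<noteq> 0}" by (rule finite_subset)
    moreover have "set_mag t \<subseteq> G" if "(f \<bullet>\<^bsub>?A\<^esub> g) t \<noteq> 0" for t
    proof (cases t)
      case (Node u v)
      then have "f u \<noteq> 0" "g v \<noteq> 0" using that by (auto simp: fm_def)
      then show ?thesis using f g Node by (auto simp: fm_def)
    qed (use that in \<open>simp add: fm_def\<close>)
    ultimately show "f \<bullet>\<^bsub>?A\<^esub> g \<in> lcarrier ?A" by (simp add: fm_def)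
  qed (auto simp: fm_def algebra_simps fun_eq_iff split: mag.split)
qed

lemma fgen_eq_delta: "fgen g = delta (Leaf g)"
  by (simp add: fgen_def delta_def)

lemma fgen_closed: "g \<in> G \<Longrightarrow> fgen g \<in> lcarrier (fm G :: ('k::comm_ring_1, _) lalg)"
  by (simp add: fm_def fgen_def)

lemma delta_Node: "delta (Node u v) = delta u \<bullet>\<^bsub>fm G\<^esub> (delta v :: _ \<Rightarrow> 'k::comm_ring_1)"
  by (auto simp: delta_def fm_def fun_eq_iff split: mag.split)

lemma mag_eval_closed:
  assumes "kalgebra A" "\<gamma> ` G \<subseteq> lcarrier A" "set_mag t \<subseteq> G"
  shows "mag_eval A \<gamma> t \<in> lcarrier A"
  using assms(3)
  by (induction t) (use assms(1,2) in \<open>auto simp: kalgebra_def intro: kbilinear_closed\<close>)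

text \<open>Both sides of the multiplicativity equation are bilinear, so it is enough to compare
  them on two trees, where they agree by the recursion of \<open>mag_eval\<close>. The right factor
  is made general first, with a tree kept on the left.\<close>

lemma lhom_fm:
  fixes A :: "('k::comm_ring_1, 'a) lalg"
  assumes A: "kalgebra A" and \<gamma>: "\<gamma> ` G \<subseteq> lcarrier A"
  shows "lhom (fm G) A (kspan_sum A (mag_eval A \<gamma>))" (is "lhom ?F A ?h")
    and "g \<in> G \<Longrightarrow> kspan_sum A (mag_eval A \<gamma>) (fgen g) = \<gamma> g"
proof -
  interpret A: kmod A using A by (simp add: kmod_def kalgebra_def)
  have bA: "kbilinear A A (lbr A)" using A by (simp add: kalgebra_def)
  have "kalgebra ?F" by (rule kalgebra_fm)
  then have bF: "kbilinear ?F ?F (lbr ?F)" and kF: "kmodule ?F" by (simp_all add: kalgebra_def)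
  interpret F: kmod ?F using kF by (rule kmod.intro)
  let ?T = "{t. set_mag t \<subseteq> G}"
  have ev: "mag_eval A \<gamma> t \<in> lcarrier A" if "t \<in> ?T" for t
    using mag_eval_closed[OF A \<gamma>] that by simp
  have lin: "klinear ?F A ?h"
    by (rule A.kspan_sum_klinear[OF free_on_fm]) (use ev in auto)
  have h_delta: "?h (delta t) = mag_eval A \<gamma> t" if "t \<in> ?T" for t
    using A.kspan_sum_delta[where g = "mag_eval A \<gamma>" and s = t] ev[OF that] by simp
  have free: "free_on ?T ?F" by (rule free_on_fm)
  have dF: "delta t \<in> lcarrier ?F" if "t \<in> ?T" for t
    using delta_fsupp[OF that] free by (simp add: free_on_def)
  have z: "?h \<zero>\<^bsub>?F\<^esub> = \<zero>\<^bsub>A\<^esub>" by (rule klinear_zero[OF lin kF A.kmodule])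
  note lins = klinear_add[OF lin] klinear_smult[OF lin] klinear_closed[OF lin]
    kbilinear_closed[OF bF] kbilinear_closed[OF bA]
    kbilinear_add_left[OF bF] kbilinear_add_left[OF bA]
    kbilinear_add_right[OF bF] kbilinear_add_right[OF bA]
    kbilinear_smult_left[OF bF] kbilinear_smult_left[OF bA]
    kbilinear_smult_right[OF bF] kbilinear_smult_right[OF bA]
  have zA: "\<zero>\<^bsub>A\<^esub> \<bullet>\<^bsub>A\<^esub> x = \<zero>\<^bsub>A\<^esub>" "x \<bullet>\<^bsub>A\<^esub> \<zero>\<^bsub>A\<^esub> = \<zero>\<^bsub>A\<^esub>" if "x \<in> lcarrier A" for x
    using klinear_zero[OF kbilinear_left[OF bA that] A.kmodule A.kmodule]
      klinear_zero[OF kbilinear_right[OF bA that] A.kmodule A.kmodule] by auto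
  have zF: "\<zero>\<^bsub>?F\<^esub> \<bullet>\<^bsub>?F\<^esub> x = \<zero>\<^bsub>?F\<^esub>" "x \<bullet>\<^bsub>?F\<^esub> \<zero>\<^bsub>?F\<^esub> = \<zero>\<^bsub>?F\<^esub>" if "x \<in> lcarrier ?F" for x
    using klinear_zero[OF kbilinear_left[OF bF that] kF kF]
      klinear_zero[OF kbilinear_right[OF bF that] kF kF] by auto
  show "lhom ?F A ?h"
  proof (rule lhomI[OF lin])
    fix f g assume f: "f \<in> lcarrier ?F" and g: "g \<in> lcarrier ?F"
    have 1: "?h (delta t \<bullet>\<^bsub>?F\<^esub> g) = ?h (delta t) \<bullet>\<^bsub>A\<^esub> ?h g" if t: "t \<in> ?T" for t
      using free_on_fm g
    proof (induction g rule: free_on_induct)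
      case (delta s)
      then show ?case using t h_delta[of "Node t s"] by (simp add: delta_Node[symmetric] h_delta)
    qed (use dF[OF t] z in \<open>simp_all add: lins zA zF\<close>)
    show "?h (f \<bullet>\<^bsub>?F\<^esub> g) = ?h f \<bullet>\<^bsub>A\<^esub> ?h g"
      using free_on_fm f
      by (induction f rule: free_on_induct) (use 1 g z in \<open>simp_all add: lins zA zF\<close>)
  qed
  show "g \<in> G \<Longrightarrow> ?h (fgen g) = \<gamma> g"
    by (simp add: fgen_eq_delta h_delta)
qed

section \<open>The presentation of stl4 and its universal property\<close>

locale steinberg =
  fixes sR :: "'k::comm_ring_1 \<Rightarrow> 'r::ring_1 \<Rightarrow> 'r"
  assumes k_algebra: "k_algebra sR"
begin

abbreviation "L \<equiv> stl4 sR"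
abbreviation "F \<equiv> FMst sR"
abbreviation "X \<equiv> stX sR"

lemma sR_one [simp]: "sR 1 a = a"
  and sR_assoc: "sR (c * d) a = sR c (sR d a)"
  and sR_add_left: "sR (c + d) a = sR c a + sR d a"
  and sR_add_right: "sR c (a + b) = sR c a + sR c b"
  and sR_mult_left: "sR c a * b = sR c (a * b)"
  and sR_mult_right: "a * sR c b = sR c (a * b)"
  using k_algebra unfolding k_algebra_def by metis+

lemma sR_zero [simp]: "sR c 0 = 0"
  using sR_add_right[of c 0 0] by simp

lemma sR_diff: "sR c (a - b) = sR c a - sR c b"
  using sR_add_right[of c "a - b" b] by (simp add: algebra_simps)

lemma kalgebra_FM: "kalgebra F"
  by (simp add: FMst_def kalgebra_fm)

sublocale F: kmod F
  using kalgebra_FM by (simp add: kmod_def kalgebra_def)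

lemma bilinear_FM: "kbilinear F F (lbr F)"
  using kalgebra_FM by (simp add: kalgebra_def)

lemma Xf_closed: "i \<in> {1..4} \<Longrightarrow> j \<in> {1..4} \<Longrightarrow> i \<noteq> j \<Longrightarrow> Xf sR i j a \<in> lcarrier F"
  by (simp add: Xf_def FMst_def fgen_closed stG_def)

lemma leib_rel_closed: "leib_rel F \<subseteq> lcarrier F"
  by (auto simp: leib_rel_def kbilinear_closed[OF bilinear_FM])

lemma st_rel_cases:
  assumes "x \<in> st_rel sR"
  obtains
    (linear) i j c a b where "i \<in> {1..4}" "j \<in> {1..4}" "i \<noteq> j"
      "x = Xf sR i j (sR c a + b) \<ominus>\<^bsub>F\<^esub> (c \<odot>\<^bsub>F\<^esub> Xf sR i j a \<oplus>\<^bsub>F\<^esub> Xf sR i j b)"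
  | (br1) i j k a b where "i \<in> {1..4}" "j \<in> {1..4}" "k \<in> {1..4}" "i \<noteq> j" "j \<noteq> k" "i \<noteq> k"
      "x = Xf sR i j a \<bullet>\<^bsub>F\<^esub> Xf sR j k b \<ominus>\<^bsub>F\<^esub> Xf sR i k (a * b)"
  | (br2) i j k a b where "i \<in> {1..4}" "j \<in> {1..4}" "k \<in> {1..4}" "i \<noteq> j" "j \<noteq> k" "i \<noteq> k"
      "x = Xf sR i j a \<bullet>\<^bsub>F\<^esub> Xf sR k i b \<oplus>\<^bsub>F\<^esub> Xf sR k j (b * a)"
  | (br0) i j k l a b where "i \<in> {1..4}" "j \<in> {1..4}" "k \<in> {1..4}" "l \<in> {1..4}"
      "i \<noteq> j" "k \<noteq> l" "j \<noteq> k" "i \<noteq> l" "x = Xf sR i j a \<bullet>\<^bsub>F\<^esub> Xf sR k l b"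
  using assms unfolding st_rel_def Un_iff mem_Collect_eq by (elim disjE exE conjE) (rule that; assumption)+

lemma st_relI:
  shows "i \<in> {1..4} \<Longrightarrow> j \<in> {1..4} \<Longrightarrow> i \<noteq> j \<Longrightarrow>
      Xf sR i j (sR c a + b) \<ominus>\<^bsub>F\<^esub> (c \<odot>\<^bsub>F\<^esub> Xf sR i j a \<oplus>\<^bsub>F\<^esub> Xf sR i j b) \<in> st_rel sR"
    and "i \<in> {1..4} \<Longrightarrow> j \<in> {1..4} \<Longrightarrow> k \<in> {1..4} \<Longrightarrow> i \<noteq> j \<Longrightarrow> j \<noteq> k \<Longrightarrow> i \<noteq> k \<Longrightarrow>
      Xf sR i j a \<bullet>\<^bsub>F\<^esub> Xf sR j k b \<ominus>\<^bsub>F\<^esub> Xf sR i k (a * b) \<in> st_rel sR"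
    and "i \<in> {1..4} \<Longrightarrow> j \<in> {1..4} \<Longrightarrow> k \<in> {1..4} \<Longrightarrow> i \<noteq> j \<Longrightarrow> j \<noteq> k \<Longrightarrow> i \<noteq> k \<Longrightarrow>
      Xf sR i j a \<bullet>\<^bsub>F\<^esub> Xf sR k i b \<oplus>\<^bsub>F\<^esub> Xf sR k j (b * a) \<in> st_rel sR"
    and "i \<in> {1..4} \<Longrightarrow> j \<in> {1..4} \<Longrightarrow> k \<in> {1..4} \<Longrightarrow> l \<in> {1..4} \<Longrightarrow>
      i \<noteq> j \<Longrightarrow> k \<noteq> l \<Longrightarrow> j \<noteq> k \<Longrightarrow> i \<noteq> l \<Longrightarrow> Xf sR i j a \<bullet>\<^bsub>F\<^esub> Xf sR k l b \<in> st_rel sR"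
  unfolding st_rel_def
  subgoal by (rule UnI1, rule UnI1, rule UnI1, rule CollectI) (intro exI conjI; (rule refl | assumption))
  subgoal by (rule UnI1, rule UnI1, rule UnI2, rule CollectI) (intro exI conjI; (rule refl | assumption))
  subgoal by (rule UnI1, rule UnI2, rule CollectI) (intro exI conjI; (rule refl | assumption))
  subgoal by (rule UnI2, rule CollectI) (intro exI conjI; (rule refl | assumption))
  done

lemma st_rel_closed: "st_rel sR \<subseteq> lcarrier F"
proof
  fix x assume "x \<in> st_rel sR"
  then show "x \<in> lcarrier F"
    by (cases rule: st_rel_cases) (simp_all add: Xf_closed kbilinear_closed[OF bilinear_FM] del: atLeastAtMost_iff)
qed

sublocale FI: quotient_algebra F "st_ideal sR"
  unfolding st_ideal_def using kalgebra_FM leib_rel_closed st_rel_closed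
  by (intro quotient_algebra_lideal) auto

lemma X_closed [simp, intro]: "i \<in> {1..4} \<Longrightarrow> j \<in> {1..4} \<Longrightarrow> i \<noteq> j \<Longrightarrow> X i j a \<in> lcarrier L"
  unfolding stX_def stl4_def by (intro FI.lcoset_carrier Xf_closed)

lemma leibniz_stl4: "leibniz L"
proof (rule leibnizI)
  show "kmodule L" unfolding stl4_def by (rule FI.kmodule_lquot)
  show "kbilinear L L (lbr L)" unfolding stl4_def by (rule FI.kbilinear_lquot)
  fix x y z assume "x \<in> lcarrier L" "y \<in> lcarrier L" "z \<in> lcarrier L"
  then obtain a b c where abc: "a \<in> lcarrier F" "b \<in> lcarrier F" "c \<in> lcarrier F"
    and eq: "x = FI.cls a" "y = FI.cls b" "z = FI.cls c"
    by (auto simp: stl4_def FI.lcarrier_lquot)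
  have "a \<bullet>\<^bsub>F\<^esub> (b \<bullet>\<^bsub>F\<^esub> c) \<ominus>\<^bsub>F\<^esub> ((a \<bullet>\<^bsub>F\<^esub> b) \<bullet>\<^bsub>F\<^esub> c \<ominus>\<^bsub>F\<^esub> (a \<bullet>\<^bsub>F\<^esub> c) \<bullet>\<^bsub>F\<^esub> b) \<in> st_ideal sR"
    unfolding st_ideal_def leib_rel_def using abc by (intro ideal_gen UnI1) blast
  then have "FI.cls (a \<bullet>\<^bsub>F\<^esub> (b \<bullet>\<^bsub>F\<^esub> c)) = FI.cls ((a \<bullet>\<^bsub>F\<^esub> b) \<bullet>\<^bsub>F\<^esub> c \<ominus>\<^bsub>F\<^esub> (a \<bullet>\<^bsub>F\<^esub> c) \<bullet>\<^bsub>F\<^esub> b)"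
    using abc by (subst FI.lcoset_eq_iff) (auto intro!: kbilinear_closed[OF bilinear_FM])
  then show "x \<bullet>\<^bsub>L\<^esub> (y \<bullet>\<^bsub>L\<^esub> z) = (x \<bullet>\<^bsub>L\<^esub> y) \<bullet>\<^bsub>L\<^esub> z \<ominus>\<^bsub>L\<^esub> (x \<bullet>\<^bsub>L\<^esub> z) \<bullet>\<^bsub>L\<^esub> y"
    using abc unfolding eq stl4_def
    by (simp add: FI.lquot_lbr kbilinear_closed[OF bilinear_FM] klinear_sub[OF FI.klinear_lcoset F.kmodule])
qed

sublocale L: kmod L
  using leibniz_stl4 by (simp add: kmod_def leibniz_kmodule)

lemma bilinear_L: "kbilinear L L (lbr L)"
  using leibniz_stl4 by (rule leibniz_kbilinear)

lemmas L_closed [simp, intro] = kbilinear_closed[OF bilinear_L]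

lemma st_rel_eq:
  assumes "u \<ominus>\<^bsub>F\<^esub> v \<in> st_rel sR" "u \<in> lcarrier F" "v \<in> lcarrier F"
  shows "FI.cls u = FI.cls v"
  using assms by (subst FI.lcoset_eq_iff) (auto simp: st_ideal_def intro: ideal_gen)

lemma X_linear:
  assumes "i \<in> {1..4}" "j \<in> {1..4}" "i \<noteq> j"
  shows "X i j (sR c a + b) = c \<odot>\<^bsub>L\<^esub> X i j a \<oplus>\<^bsub>L\<^esub> X i j b"
proof -
  note X = Xf_closed[OF assms]
  have "FI.cls (Xf sR i j (sR c a + b)) = FI.cls (c \<odot>\<^bsub>F\<^esub> Xf sR i j a \<oplus>\<^bsub>F\<^esub> Xf sR i j b)"
  proof (rule st_rel_eq)
    show "Xf sR i j (sR c a + b) \<ominus>\<^bsub>F\<^esub> (c \<odot>\<^bsub>F\<^esub> Xf sR i j a \<oplus>\<^bsub>F\<^esub> Xf sR i j b) \<in> st_rel sR"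
      using assms by (intro st_relI)
  qed (use X in auto)
  then show ?thesis using X by (simp add: stX_def stl4_def FI.lquot_add FI.lquot_smult)
qed

lemma X_add: "i \<in> {1..4} \<Longrightarrow> j \<in> {1..4} \<Longrightarrow> i \<noteq> j \<Longrightarrow> X i j (a + b) = X i j a \<oplus>\<^bsub>L\<^esub> X i j b"
  using X_linear[of i j 1 a b] by simp

lemma X_zero: "i \<in> {1..4} \<Longrightarrow> j \<in> {1..4} \<Longrightarrow> i \<noteq> j \<Longrightarrow> X i j 0 = \<zero>\<^bsub>L\<^esub>"
  using X_add[of i j 0 0] L.add_left_cancel[of "X i j 0" "X i j 0" "\<zero>\<^bsub>L\<^esub>"] by simp

lemma X_smult: "i \<in> {1..4} \<Longrightarrow> j \<in> {1..4} \<Longrightarrow> i \<noteq> j \<Longrightarrow> X i j (sR c a) = c \<odot>\<^bsub>L\<^esub> X i j a"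
  using X_linear[of i j c a 0] by (simp add: X_zero)

lemma X_br1:
  assumes "i \<in> {1..4}" "j \<in> {1..4}" "k \<in> {1..4}" "i \<noteq> j" "j \<noteq> k" "i \<noteq> k"
  shows "X i j a \<bullet>\<^bsub>L\<^esub> X j k b = X i k (a * b)"
proof -
  have "FI.cls (Xf sR i j a \<bullet>\<^bsub>F\<^esub> Xf sR j k b) = FI.cls (Xf sR i k (a * b))"
  proof (rule st_rel_eq)
    show "Xf sR i j a \<bullet>\<^bsub>F\<^esub> Xf sR j k b \<ominus>\<^bsub>F\<^esub> Xf sR i k (a * b) \<in> st_rel sR"
      using assms by (intro st_relI)
  qed (use assms in \<open>auto intro!: kbilinear_closed[OF bilinear_FM] Xf_closed\<close>)
  then show ?thesis using assms by (simp add: stX_def stl4_def FI.lquot_lbr Xf_closed)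
qed

lemma X_br2:
  assumes "i \<in> {1..4}" "j \<in> {1..4}" "k \<in> {1..4}" "i \<noteq> j" "j \<noteq> k" "i \<noteq> k"
  shows "X i j a \<bullet>\<^bsub>L\<^esub> X k i b = (- 1) \<odot>\<^bsub>L\<^esub> X k j (b * a)"
proof -
  have c: "Xf sR i j a \<bullet>\<^bsub>F\<^esub> Xf sR k i b \<in> lcarrier F" "Xf sR k j (b * a) \<in> lcarrier F"
    using assms by (auto intro!: kbilinear_closed[OF bilinear_FM] Xf_closed)
  have "Xf sR i j a \<bullet>\<^bsub>F\<^esub> Xf sR k i b \<oplus>\<^bsub>F\<^esub> Xf sR k j (b * a) \<in> st_rel sR"
    using assms by (intro st_relI)
  then have "FI.cls (Xf sR i j a \<bullet>\<^bsub>F\<^esub> Xf sR k i b) = FI.cls ((- 1) \<odot>\<^bsub>F\<^esub> Xf sR k j (b * a))"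
    using c by (intro st_rel_eq) (auto simp: lsub_def)
  then show ?thesis using assms c by (simp add: stX_def stl4_def FI.lquot_lbr FI.lquot_smult Xf_closed)
qed

lemma X_br0:
  assumes "i \<in> {1..4}" "j \<in> {1..4}" "k \<in> {1..4}" "l \<in> {1..4}" "i \<noteq> j" "k \<noteq> l" "j \<noteq> k" "i \<noteq> l"
  shows "X i j a \<bullet>\<^bsub>L\<^esub> X k l b = \<zero>\<^bsub>L\<^esub>"
proof -
  have c: "Xf sR i j a \<bullet>\<^bsub>F\<^esub> Xf sR k l b \<in> lcarrier F"
    using assms by (auto intro!: kbilinear_closed[OF bilinear_FM] Xf_closed)
  have "Xf sR i j a \<bullet>\<^bsub>F\<^esub> Xf sR k l b \<in> st_rel sR"
    using assms by (intro st_relI)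
  then have "FI.cls (Xf sR i j a \<bullet>\<^bsub>F\<^esub> Xf sR k l b) = FI.cls \<zero>\<^bsub>F\<^esub>"
    using c by (intro st_rel_eq) auto
  then show ?thesis using assms by (simp add: stX_def stl4_def FI.lquot_lbr Xf_closed FI.lzero_lquot)
qed

text \<open>The maps out of \<open>L\<close> that extend prescribed values on the generators come
  from here: it is applied to matrix units and to the elements \<open>Y\<close> of the modified
  target. The relations need testing on generators only, because the elements killed by the
  extension to the free algebra form an ideal.\<close>

lemma stl4_lhom:
  fixes A :: "('k, 'c) lalg" and Y :: "nat \<Rightarrow> nat \<Rightarrow> 'r \<Rightarrow> 'c"
  assumes A: "leibniz A"
    and Y: "\<And>i j a. i \<in> {1..4} \<Longrightarrow> j \<in> {1..4} \<Longrightarrow> i \<noteq> j \<Longrightarrow> Y i j a \<in> lcarrier A"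
    and lin: "\<And>i j c a b. i \<in> {1..4} \<Longrightarrow> j \<in> {1..4} \<Longrightarrow> i \<noteq> j \<Longrightarrow>
      Y i j (sR c a + b) = c \<odot>\<^bsub>A\<^esub> Y i j a \<oplus>\<^bsub>A\<^esub> Y i j b"
    and Y1: "\<And>i j k a b. i \<in> {1..4} \<Longrightarrow> j \<in> {1..4} \<Longrightarrow> k \<in> {1..4} \<Longrightarrow> i \<noteq> j \<Longrightarrow> j \<noteq> k \<Longrightarrow>
      i \<noteq> k \<Longrightarrow> Y i j a \<bullet>\<^bsub>A\<^esub> Y j k b = Y i k (a * b)"
    and Y2: "\<And>i j k a b. i \<in> {1..4} \<Longrightarrow> j \<in> {1..4} \<Longrightarrow> k \<in> {1..4} \<Longrightarrow> i \<noteq> j \<Longrightarrow> j \<noteq> k \<Longrightarrow>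
      i \<noteq> k \<Longrightarrow> Y i j a \<bullet>\<^bsub>A\<^esub> Y k i b = (- 1) \<odot>\<^bsub>A\<^esub> Y k j (b * a)"
    and Y0: "\<And>i j k l a b. i \<in> {1..4} \<Longrightarrow> j \<in> {1..4} \<Longrightarrow> k \<in> {1..4} \<Longrightarrow> l \<in> {1..4} \<Longrightarrow>
      i \<noteq> j \<Longrightarrow> k \<noteq> l \<Longrightarrow> j \<noteq> k \<Longrightarrow> i \<noteq> l \<Longrightarrow> Y i j a \<bullet>\<^bsub>A\<^esub> Y k l b = \<zero>\<^bsub>A\<^esub>"
  obtains f where "lhom L A f"
    "\<And>i j a. i \<in> {1..4} \<Longrightarrow> j \<in> {1..4} \<Longrightarrow> i \<noteq> j \<Longrightarrow> f (X i j a) = Y i j a"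
proof -
  let ?g = "\<lambda>(i, j, a). Y i j a"
  let ?h = "kspan_sum A (mag_eval A ?g)"
  have kA: "kalgebra A" and mA: "kmodule A" using A by (auto simp: leibniz_iff kalgebra_def)
  interpret A: kmod A using mA by (rule kmod.intro)
  have g: "?g ` stG \<subseteq> lcarrier A" using Y by (auto simp: stG_def)
  have h: "lhom F A ?h" unfolding FMst_def by (rule lhom_fm[OF kA g])
  have hX: "?h (Xf sR i j a) = Y i j a" if "i \<in> {1..4}" "j \<in> {1..4}" "i \<noteq> j" for i j a
    unfolding Xf_def using lhom_fm(2)[OF kA g, of "(i, j, a)"] that by (auto simp: stG_def)
  note hl = lhom_klinear[OF h]
  note simps = klinear_add[OF hl] klinear_smult[OF hl] klinear_closed[OF hl] lhom_lbr[OF h]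
    klinear_sub[OF hl F.kmodule] kbilinear_closed[OF bilinear_FM]
    kbilinear_closed[OF leibniz_kbilinear[OF A]]
  have z: "?h \<zero>\<^bsub>F\<^esub> = \<zero>\<^bsub>A\<^esub>" using klinear_zero[OF hl F.kmodule mA] .
  have zA: "\<zero>\<^bsub>A\<^esub> \<bullet>\<^bsub>A\<^esub> x = \<zero>\<^bsub>A\<^esub>" "x \<bullet>\<^bsub>A\<^esub> \<zero>\<^bsub>A\<^esub> = \<zero>\<^bsub>A\<^esub>" if "x \<in> lcarrier A" for x
    using klinear_zero[OF kbilinear_left[OF leibniz_kbilinear[OF A] that] mA mA]
      klinear_zero[OF kbilinear_right[OF leibniz_kbilinear[OF A] that] mA mA] by auto
  have gen: "?h x = \<zero>\<^bsub>A\<^esub>" if "x \<in> leib_rel F \<union> st_rel sR" for x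
    using that
  proof
    assume "x \<in> leib_rel F"
    then show ?thesis unfolding leib_rel_def
      using leibniz_identity[OF A] by (auto simp: simps)
  next
    assume "x \<in> st_rel sR"
    then show ?thesis
    proof (cases rule: st_rel_cases)
      case (linear i j c a b)
      then have "?h x = Y i j (sR c a + b) \<ominus>\<^bsub>A\<^esub> (c \<odot>\<^bsub>A\<^esub> Y i j a \<oplus>\<^bsub>A\<^esub> Y i j b)"
        by (simp add: simps hX Xf_closed del: atLeastAtMost_iff)
      then show ?thesis using linear Y lin by simp
    next
      case (br1 i j k a b)
      then have "?h x = Y i j a \<bullet>\<^bsub>A\<^esub> Y j k b \<ominus>\<^bsub>A\<^esub> Y i k (a * b)"
        by (simp add: simps hX Xf_closed del: atLeastAtMost_iff)
      then show ?thesis using br1 Y Y1 by simp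
    next
      case (br2 i j k a b)
      then have "?h x = Y i j a \<bullet>\<^bsub>A\<^esub> Y k i b \<oplus>\<^bsub>A\<^esub> Y k j (b * a)"
        by (simp add: simps hX Xf_closed del: atLeastAtMost_iff)
      then show ?thesis using br2 Y Y2 A.add_comm by simp
    next
      case (br0 i j k l a b)
      then have "?h x = Y i j a \<bullet>\<^bsub>A\<^esub> Y k l b"
        by (simp add: simps hX Xf_closed del: atLeastAtMost_iff)
      then show ?thesis using br0 Y0 by simp
    qed
  qed
  have ker: "?h x = \<zero>\<^bsub>A\<^esub>" if "x \<in> st_ideal sR" for x
    using that unfolding st_ideal_def
  proof induction
    case (ideal_gen s)
    then show ?case by (rule gen)
  next
    case ideal_zero
    then show ?case by (rule z)
  next
    case (ideal_add x y)
    then show ?case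
      using FI.sub_carrier[of x] FI.sub_carrier[of y] by (simp add: simps st_ideal_def)
  next
    case (ideal_smult x c)
    then show ?case
      using FI.sub_carrier[of x] by (simp add: simps st_ideal_def)
  next
    case (ideal_left x a)
    then show ?case
      using FI.sub_carrier[of x] by (simp add: simps st_ideal_def zA)
  next
    case (ideal_right x a)
    then show ?case
      using FI.sub_carrier[of x] by (simp add: simps st_ideal_def zA)
  qed
  note ql = FI.quot_lift_lcoset[OF hl mA ker]
  have "lhom L A (quot_lift ?h)"
  proof (rule lhomI)
    show "klinear L A (quot_lift ?h)" unfolding stl4_def
      by (rule FI.klinear_quot_lift[OF hl mA ker])
    show "quot_lift ?h (x \<bullet>\<^bsub>L\<^esub> y) = quot_lift ?h x \<bullet>\<^bsub>A\<^esub> quot_lift ?h y"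
      if "x \<in> lcarrier L" "y \<in> lcarrier L" for x y
      using that by (auto simp: stl4_def FI.lcarrier_lquot FI.lquot_lbr ql simps)
  qed
  moreover have "quot_lift ?h (X i j a) = Y i j a"
    if "i \<in> {1..4}" "j \<in> {1..4}" "i \<noteq> j" for i j a
    unfolding stX_def using that ql[OF _ Xf_closed[OF that]] hX[OF that] by simp
  ultimately show ?thesis using that by blast
qed

lemma stl4_induct [consumes 1, case_names X zero add smult lbr]:
  assumes x: "x \<in> lcarrier L"
    and X: "\<And>i j a. i \<in> {1..4} \<Longrightarrow> j \<in> {1..4} \<Longrightarrow> i \<noteq> j \<Longrightarrow> P (X i j a)"
    and z: "P \<zero>\<^bsub>L\<^esub>"
    and add: "\<And>x y. x \<in> lcarrier L \<Longrightarrow> y \<in> lcarrier L \<Longrightarrow> P x \<Longrightarrow> P y \<Longrightarrow> P (x \<oplus>\<^bsub>L\<^esub> y)"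
    and smult: "\<And>c x. x \<in> lcarrier L \<Longrightarrow> P x \<Longrightarrow> P (c \<odot>\<^bsub>L\<^esub> x)"
    and br: "\<And>x y. x \<in> lcarrier L \<Longrightarrow> y \<in> lcarrier L \<Longrightarrow> P x \<Longrightarrow> P y \<Longrightarrow> P (x \<bullet>\<^bsub>L\<^esub> y)"
  shows "P x"
proof -
  obtain f where f: "f \<in> lcarrier F" "x = FI.cls f"
    using x by (auto simp: stl4_def FI.lcarrier_lquot)
  have free: "free_on {t. set_mag t \<subseteq> stG} F" unfolding FMst_def by (rule free_on_fm)
  have dF: "delta t \<in> lcarrier F" if "set_mag t \<subseteq> stG" for t
    using delta_fsupp[of t "{t. set_mag t \<subseteq> stG}"] that free by (simp add: free_on_def)
  have d: "P (FI.cls (delta t))" if "set_mag t \<subseteq> stG" for t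
    using that
  proof (induction t)
    case (Leaf g)
    then show ?case using X by (auto simp: stX_def Xf_def fgen_eq_delta stG_def)
  next
    case (Node u v)
    have "delta (Node u v) = delta u \<bullet>\<^bsub>F\<^esub> (delta v :: _ \<Rightarrow> 'k)"
      unfolding FMst_def by (rule delta_Node)
    then show ?case using Node br[of "FI.cls (delta u)" "FI.cls (delta v)"] dF
      by (simp add: stl4_def FI.lquot_lbr)
  qed
  have "P (FI.cls f)" using free f(1)
  proof (induction f rule: free_on_induct)
    case zero
    then show ?case using z by (simp add: stl4_def FI.lzero_lquot)
  next
    case (delta s)
    then show ?case using d by simp
  next
    case (add f g)
    then show ?case using assms(4)[of "FI.cls f" "FI.cls g"] by (simp add: stl4_def FI.lquot_add)
  next
    case (smult c f)
    then show ?case using assms(5)[of "FI.cls f" c] by (simp add: stl4_def FI.lquot_smult)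
  qed
  then show ?thesis using f by simp
qed

end

context steinberg
begin

lemma L_zero_br [simp]:
  assumes "x \<in> lcarrier L"
  shows "\<zero>\<^bsub>L\<^esub> \<bullet>\<^bsub>L\<^esub> x = \<zero>\<^bsub>L\<^esub>" "x \<bullet>\<^bsub>L\<^esub> \<zero>\<^bsub>L\<^esub> = \<zero>\<^bsub>L\<^esub>"
  using klinear_zero[OF kbilinear_left[OF bilinear_L assms] L.kmodule L.kmodule]
    klinear_zero[OF kbilinear_right[OF bilinear_L assms] L.kmodule L.kmodule] by auto

lemmas L_bilinear = kbilinear_add_left[OF bilinear_L] kbilinear_add_right[OF bilinear_L]
  kbilinear_smult_left[OF bilinear_L] kbilinear_smult_right[OF bilinear_L]

lemmas L_leibniz = leibniz_identity[OF leibniz_stl4]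

lemma L_leibniz_left:
  assumes "x \<in> lcarrier L" "y \<in> lcarrier L" "z \<in> lcarrier L"
  shows "(x \<bullet>\<^bsub>L\<^esub> y) \<bullet>\<^bsub>L\<^esub> z = x \<bullet>\<^bsub>L\<^esub> (y \<bullet>\<^bsub>L\<^esub> z) \<oplus>\<^bsub>L\<^esub> (x \<bullet>\<^bsub>L\<^esub> z) \<bullet>\<^bsub>L\<^esub> y"
  using L_leibniz[OF assms] assms by (metis L.sub_eq_iff L_closed)

text \<open>In a Leibniz algebra left-normed products of generators span, so closure under right
  multiplication by generators suffices.\<close>

lemma stl4_right_induct [consumes 1, case_names X zero add smult right]:
  assumes x: "x \<in> lcarrier L"
    and X: "\<And>i j a. i \<in> {1..4} \<Longrightarrow> j \<in> {1..4} \<Longrightarrow> i \<noteq> j \<Longrightarrow> P (X i j a)"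
    and z: "P \<zero>\<^bsub>L\<^esub>"
    and add: "\<And>x y. x \<in> lcarrier L \<Longrightarrow> y \<in> lcarrier L \<Longrightarrow> P x \<Longrightarrow> P y \<Longrightarrow> P (x \<oplus>\<^bsub>L\<^esub> y)"
    and smult: "\<And>c x. x \<in> lcarrier L \<Longrightarrow> P x \<Longrightarrow> P (c \<odot>\<^bsub>L\<^esub> x)"
    and right: "\<And>x i j a. x \<in> lcarrier L \<Longrightarrow> P x \<Longrightarrow> i \<in> {1..4} \<Longrightarrow> j \<in> {1..4} \<Longrightarrow> i \<noteq> j \<Longrightarrow>
      P (x \<bullet>\<^bsub>L\<^esub> X i j a)"
  shows "P x"
proof -
  have Q: "\<forall>s\<in>lcarrier L. P s \<longrightarrow> P (s \<bullet>\<^bsub>L\<^esub> z)" if "z \<in> lcarrier L" for z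
    using that
  proof (induction z rule: stl4_induct)
    case (lbr x y)
    then have "P (s \<bullet>\<^bsub>L\<^esub> x \<bullet>\<^bsub>L\<^esub> y) \<and> P (s \<bullet>\<^bsub>L\<^esub> y \<bullet>\<^bsub>L\<^esub> x)" if "s \<in> lcarrier L" "P s" for s
      using that by (simp add: L_closed)
    then show ?case using lbr(1,2) by (simp add: L_leibniz lsub_def add smult L_closed)
  qed (use z add smult right in \<open>auto simp: L_bilinear L_closed\<close>)
  show ?thesis using x
    by (induction x rule: stl4_induct) (use X z add smult Q in auto)
qed

section \<open>A spanning set: generators and brackets of opposite generators\<close>

definition gens :: "((nat \<times> nat \<times> 'r) mag \<Rightarrow> 'k) set set" where
  "gens = {X i j a | i j a. i \<in> {1..4} \<and> j \<in> {1..4} \<and> i \<noteq> j} \<union>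
     {X i j a \<bullet>\<^bsub>L\<^esub> X j i b | i j a b. i \<in> {1..4} \<and> j \<in> {1..4} \<and> i \<noteq> j}"

lemma gens_cases:
  assumes "g \<in> gens"
  obtains (X) i j a where "i \<in> {1..4}" "j \<in> {1..4}" "i \<noteq> j" "g = X i j a"
  | (H) i j a b where "i \<in> {1..4}" "j \<in> {1..4}" "i \<noteq> j" "g = X i j a \<bullet>\<^bsub>L\<^esub> X j i b"
  using assms unfolding gens_def by blast

lemma
  assumes "i \<in> {1..4}" "j \<in> {1..4}" "i \<noteq> j"
  shows span_X: "X i j a \<in> lspan L gens"
    and span_H: "X i j a \<bullet>\<^bsub>L\<^esub> X j i b \<in> lspan L gens"
  unfolding gens_def using assms by (intro span_gen; blast)+

lemma third_index:
  obtains m :: nat where "m \<in> {1..4}" "m \<noteq> i" "m \<noteq> j"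
proof -
  have "\<not> {1..4::nat} \<subseteq> {i, j}"
    using card_mono[of "{i, j}" "{1..4::nat}"] card_insert_le_m1[of 2 "{j}" i] by auto
  then show ?thesis using that by blast
qed

text \<open>In matrix terms \<open>X i j a \<bullet> X j i b\<close> is the diagonal matrix with
  entry \<open>a * b\<close> at i and \<open>- b * a\<close> at j; this explains the four products,
  their order of coefficients and their signs.\<close>

lemma
  assumes "i \<in> {1..4}" "j \<in> {1..4}" "m \<in> {1..4}" "i \<noteq> j" "m \<noteq> i" "m \<noteq> j"
  shows h_br_im: "X i j a \<bullet>\<^bsub>L\<^esub> X j i b \<bullet>\<^bsub>L\<^esub> X i m c = X i m (a * (b * c))"
    and h_br_mj: "X i j a \<bullet>\<^bsub>L\<^esub> X j i b \<bullet>\<^bsub>L\<^esub> X m j c = X m j (c * b * a)"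
    and h_br_jm: "X i j a \<bullet>\<^bsub>L\<^esub> X j i b \<bullet>\<^bsub>L\<^esub> X j m c = (- 1) \<odot>\<^bsub>L\<^esub> X j m (b * (a * c))"
    and h_br_mi: "X i j a \<bullet>\<^bsub>L\<^esub> X j i b \<bullet>\<^bsub>L\<^esub> X m i c = (- 1) \<odot>\<^bsub>L\<^esub> X m i (c * a * b)"
  using assms
  by (simp_all del: atLeastAtMost_iff add: L_leibniz_left X_closed L_closed X_br1 X_br2 X_br0 L_bilinear)

text \<open>Unless two generators are opposite, their bracket is a multiple of one generator.
  Writing the three relations in this single shape, with scalar 1, -1 or 0, saves case distinctions
  when products are iterated.\<close>

lemma X_br_scalar:
  assumes "i \<in> {1..4}" "j \<in> {1..4}" "k \<in> {1..4}" "l \<in> {1..4}" "i \<noteq> j" "k \<noteq> l" "(k, l) \<noteq> (j, i)"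
  obtains p q s d where "p \<in> {1..4}" "q \<in> {1..4}" "p \<noteq> q"
    "X i j a \<bullet>\<^bsub>L\<^esub> X k l b = s \<odot>\<^bsub>L\<^esub> X p q d"
proof -
  consider "j = k" "i \<noteq> l" | "i = l" "j \<noteq> k" | "j \<noteq> k" "i \<noteq> l" using assms by auto
  then show ?thesis
  proof cases
    case 1
    then have "X i j a \<bullet>\<^bsub>L\<^esub> X k l b = 1 \<odot>\<^bsub>L\<^esub> X i l (a * b)" using assms
      by (simp del: atLeastAtMost_iff add: X_br1 X_closed)
    then show ?thesis using that assms 1 by blast
  next
    case 2
    then have "X i j a \<bullet>\<^bsub>L\<^esub> X k l b = (- 1) \<odot>\<^bsub>L\<^esub> X k j (b * a)" using assms X_br2[of i j k] by simp
    then show ?thesis using that assms 2 by metis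
  next
    case 3
    then have "X i j a \<bullet>\<^bsub>L\<^esub> X k l b = 0 \<odot>\<^bsub>L\<^esub> X i j a" using assms
      by (simp del: atLeastAtMost_iff add: X_br0 X_closed)
    then show ?thesis using that assms by blast
  qed
qed

lemma gens_carrier: "gens \<subseteq> lcarrier L"
  by (auto simp del: atLeastAtMost_iff intro!: X_closed L_closed elim!: gens_cases)

lemma span_XX:
  assumes "i \<in> {1..4}" "j \<in> {1..4}" "k \<in> {1..4}" "l \<in> {1..4}" "i \<noteq> j" "k \<noteq> l"
  shows "X i j a \<bullet>\<^bsub>L\<^esub> X k l b \<in> lspan L gens"
proof (cases "(k, l) = (j, i)")
  case True
  then show ?thesis using assms span_H by simp
next
  case False
  then obtain p q s d where "p \<in> {1..4}" "q \<in> {1..4}" "p \<noteq> q"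
    "X i j a \<bullet>\<^bsub>L\<^esub> X k l b = s \<odot>\<^bsub>L\<^esub> X p q d" using X_br_scalar assms by metis
  then show ?thesis by (simp del: atLeastAtMost_iff add: span_smult span_X)
qed

text \<open>If \<open>X k l c\<close> is opposite to neither factor of the bracket, the Leibniz rule
  leaves two products of generators. Otherwise the rule would bring back a bracket of opposite
  generators as a factor, so \<open>X k l c\<close> is first factored through a third index
  \<open>m\<close>; on both factors the bracket acts like a diagonal matrix.\<close>

lemma span_hX:
  assumes "i \<in> {1..4}" "j \<in> {1..4}" "k \<in> {1..4}" "l \<in> {1..4}" "i \<noteq> j" "k \<noteq> l"
  shows "X i j a \<bullet>\<^bsub>L\<^esub> X j i b \<bullet>\<^bsub>L\<^esub> X k l c \<in> lspan L gens" (is "?h \<bullet>\<^bsub>L\<^esub> _ \<in> ?S")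
proof -
  note XX = span_XX
  have sX: "X i j a \<bullet>\<^bsub>L\<^esub> s \<odot>\<^bsub>L\<^esub> X p q d \<in> ?S" "s \<odot>\<^bsub>L\<^esub> X p q d \<bullet>\<^bsub>L\<^esub> X i j a \<in> ?S"
    if "i \<in> {1..4}" "j \<in> {1..4}" "i \<noteq> j" "p \<in> {1..4}" "q \<in> {1..4}" "p \<noteq> q" for i j a s p q d
    using that by (simp_all del: atLeastAtMost_iff add: X_closed L_bilinear span_smult XX)
  obtain m where m: "m \<in> {1..4}" "m \<noteq> i" "m \<noteq> j" by (rule third_index)
  have c: "?h \<in> lcarrier L" using assms by blast
  consider "(k, l) = (i, j)" | "(k, l) = (j, i)" | "(k, l) \<noteq> (i, j)" "(k, l) \<noteq> (j, i)" by blast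
  then show ?thesis
  proof cases
    case 1
    have "?h \<bullet>\<^bsub>L\<^esub> X i j c = ?h \<bullet>\<^bsub>L\<^esub> (X i m c \<bullet>\<^bsub>L\<^esub> X m j 1)"
      using X_br1[of i m j c 1] m assms by simp
    also have "\<dots> = ?h \<bullet>\<^bsub>L\<^esub> X i m c \<bullet>\<^bsub>L\<^esub> X m j 1 \<ominus>\<^bsub>L\<^esub> ?h \<bullet>\<^bsub>L\<^esub> X m j 1 \<bullet>\<^bsub>L\<^esub> X i m c"
      using m assms c by (intro L_leibniz) auto
    also have "\<dots> \<in> ?S" using m assms
      by (simp del: atLeastAtMost_iff add: h_br_im h_br_mj lsub_def) (intro span_add span_smult XX; simp)
    finally show ?thesis using 1 by simp
  next
    case 2
    have "?h \<bullet>\<^bsub>L\<^esub> X j i c = ?h \<bullet>\<^bsub>L\<^esub> (X j m c \<bullet>\<^bsub>L\<^esub> X m i 1)"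
      using X_br1[of j m i c 1] m assms by simp
    also have "\<dots> = ?h \<bullet>\<^bsub>L\<^esub> X j m c \<bullet>\<^bsub>L\<^esub> X m i 1 \<ominus>\<^bsub>L\<^esub> ?h \<bullet>\<^bsub>L\<^esub> X m i 1 \<bullet>\<^bsub>L\<^esub> X j m c"
      using m assms c by (intro L_leibniz) auto
    also have "\<dots> \<in> ?S" using m assms
      by (simp del: atLeastAtMost_iff add: h_br_jm h_br_mi lsub_def) (intro span_add span_smult sX; simp)
    finally show ?thesis using 2 by simp
  next
    case 3
    obtain p q s d where 1: "p \<in> {1..4}" "q \<in> {1..4}" "p \<noteq> q"
      "X j i b \<bullet>\<^bsub>L\<^esub> X k l c = s \<odot>\<^bsub>L\<^esub> X p q d"
      using X_br_scalar[of j i k l b c] assms 3(1) by metis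
    obtain p' q' s' d' where 2: "p' \<in> {1..4}" "q' \<in> {1..4}" "p' \<noteq> q'"
      "X i j a \<bullet>\<^bsub>L\<^esub> X k l c = s' \<odot>\<^bsub>L\<^esub> X p' q' d'"
      using X_br_scalar[of i j k l a c] assms 3(2) by metis
    have "?h \<bullet>\<^bsub>L\<^esub> X k l c = X i j a \<bullet>\<^bsub>L\<^esub> (X j i b \<bullet>\<^bsub>L\<^esub> X k l c) \<oplus>\<^bsub>L\<^esub> (X i j a \<bullet>\<^bsub>L\<^esub> X k l c) \<bullet>\<^bsub>L\<^esub> X j i b"
      using assms by (intro L_leibniz_left) auto
    also have "\<dots> \<in> ?S" unfolding 1(4) 2(4) using 1 2 assms by (intro span_add sX) auto
    finally show ?thesis .
  qed
qed

lemma stl4_span: "x \<in> lcarrier L \<Longrightarrow> x \<in> lspan L gens"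
proof (induction x rule: stl4_right_induct)
  case (X i j a)
  then show ?case by (rule span_X)
next
  case (right x k l c)
  note kl = right.hyps(2-)
  from right.IH show ?case
  proof induction
    case (span_gen s)
    then show ?case using kl span_XX span_hX by (auto simp del: atLeastAtMost_iff elim!: gens_cases)
  next
    case span_zero
    then show ?case using kl by (auto intro: lspan.intros)
  next
    case (span_add x y)
    then show ?case using kl lspan_carrier[OF L.kmodule gens_carrier]
      by (simp add: L_bilinear X_closed lspan.intros)
  next
    case (span_smult x s)
    then show ?case using kl lspan_carrier[OF L.kmodule gens_carrier]
      by (simp add: L_bilinear X_closed lspan.intros)
  qed
qed (auto intro: lspan.intros)

end

section \<open>The homomorphism to matrices\<close>

text \<open>Entries with indices outside 1..4 are carried along without constraint, so that equality
  of matrices is plain equality of functions.\<close>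

definition matmul :: "(nat \<Rightarrow> nat \<Rightarrow> 'r::ring_1) \<Rightarrow> (nat \<Rightarrow> nat \<Rightarrow> 'r) \<Rightarrow> nat \<Rightarrow> nat \<Rightarrow> 'r" where
  "matmul A B = (\<lambda>p q. \<Sum>m\<in>{1..4}. A p m * B m q)"

definition matcomm :: "(nat \<Rightarrow> nat \<Rightarrow> 'r::ring_1) \<Rightarrow> (nat \<Rightarrow> nat \<Rightarrow> 'r) \<Rightarrow> nat \<Rightarrow> nat \<Rightarrow> 'r" where
  "matcomm A B = (\<lambda>p q. matmul A B p q - matmul B A p q)"

definition mattrace :: "(nat \<Rightarrow> nat \<Rightarrow> 'r::ring_1) \<Rightarrow> 'r" where
  "mattrace A = (\<Sum>m\<in>{1..4}. A m m)"

definition matunit :: "nat \<Rightarrow> nat \<Rightarrow> 'r::ring_1 \<Rightarrow> nat \<Rightarrow> nat \<Rightarrow> 'r" where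
  "matunit i j a = (\<lambda>p q. if p = i \<and> q = j then a else 0)"

lemma matmul_assoc: "matmul (matmul A B) C = matmul A (matmul B C)"
proof (intro ext)
  fix p q
  show "matmul (matmul A B) C p q = matmul A (matmul B C) p q"
    unfolding matmul_def sum_distrib_left sum_distrib_right
    by (rule trans[OF sum.swap]) (simp only: mult.assoc)
qed

lemma matmul_diff:
  "matmul (\<lambda>p q. A p q - B p q) C = (\<lambda>p q. matmul A C p q - matmul B C p q)"
  "matmul C (\<lambda>p q. A p q - B p q) = (\<lambda>p q. matmul C A p q - matmul C B p q)"
  by (simp_all only: matmul_def left_diff_distrib right_diff_distrib sum_subtractf)

lemma matcomm_leibniz:
  "matcomm A (matcomm B C) p q = matcomm (matcomm A B) C p q - matcomm (matcomm A C) B p q"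
  by (simp only: matcomm_def matmul_diff matmul_assoc) simp

lemma matmul_matunit:
  assumes "j \<in> {1..4}"
  shows "matmul (matunit i j a) (matunit k l b) = (if j = k then matunit i l (a * b) else (\<lambda>p q. 0))"
proof (intro ext)
  fix p q
  have "matmul (matunit i j a) (matunit k l b) p q =
      (\<Sum>m\<in>{1..4}. if m = j then (if p = i \<and> j = k \<and> q = l then a * b else 0) else 0)"
    unfolding matmul_def matunit_def by (rule sum.cong) auto
  also have "\<dots> = (if p = i \<and> j = k \<and> q = l then a * b else 0)"
    using assms by (subst sum.delta) auto
  finally show "matmul (matunit i j a) (matunit k l b) p q =
      (if j = k then matunit i l (a * b) else (\<lambda>p q. 0)) p q"
    by (simp add: matunit_def)
qed

lemma matcomm_matunit:
  assumes "j \<in> {1..4}" "l \<in> {1..4}"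
  shows "matcomm (matunit i j a) (matunit k l b) =
    (\<lambda>p q. (if j = k then matunit i l (a * b) p q else 0) - (if i = l then matunit k j (b * a) p q else 0))"
  using assms by (simp only: matcomm_def matmul_matunit fun_eq_iff if_distrib[of "\<lambda>f. f _"]) simp

text \<open>The polarised minor with rows \<open>i, k\<close> and columns \<open>j, l\<close>, read in characteristic 2.\<close>

definition minor2 ::
  "nat \<Rightarrow> nat \<Rightarrow> nat \<Rightarrow> nat \<Rightarrow> (nat \<Rightarrow> nat \<Rightarrow> 'r::ring_1) \<Rightarrow> (nat \<Rightarrow> nat \<Rightarrow> 'r) \<Rightarrow> 'r" where
  "minor2 i j k l A B = A i j * B k l + A k j * B i l + A i l * B k j + A k l * B i j"

text \<open>Expanding a sum in the order of the indices of the minor makes the cocycle computation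
  uniform in all orderings of 1..4.\<close>

lemma sum_four:
  assumes "{i, j, k, l} = {1, 2, 3, 4 :: nat}"
  shows "(\<Sum>m\<in>{1..4}. f m :: 'a::comm_monoid_add) = f i + f j + f k + f l"
proof -
  have "card {i, j, k, l} = 4" using assms by simp
  then have "i \<noteq> j" "i \<noteq> k" "i \<noteq> l" "j \<noteq> k" "j \<noteq> l" "k \<noteq> l"
    by (auto simp: card_insert_if split: if_splits)
  moreover have "{1..4} = {i, j, k, l}" unfolding assms by auto
  ultimately show ?thesis by (simp add: add.assoc)
qed

context steinberg
begin

abbreviation "I \<equiv> R2I sR"

lemma sR_neg: "sR (- 1) a = - a"
  using sR_add_left[of "- 1" 1 a] sR_add_left[of 0 0 a] by (simp add: eq_neg_iff_add_eq_0)

lemma I_zero [simp]: "0 \<in> I"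
  and I_add: "x \<in> I \<Longrightarrow> y \<in> I \<Longrightarrow> x + y \<in> I"
  and I_smult: "x \<in> I \<Longrightarrow> sR c x \<in> I"
  and I_two: "2 * r \<in> I"
  and I_comm: "r * (s * t - t * s) \<in> I"
  unfolding R2I_def by (auto intro: rspan.intros)

lemma I_neg: "x \<in> I \<Longrightarrow> - x \<in> I"
  using I_smult[of x "- 1"] by (simp add: sR_neg)

lemma I_diff: "x \<in> I \<Longrightarrow> y \<in> I \<Longrightarrow> x - y \<in> I"
  using I_add[OF _ I_neg] by fastforce

lemma I_diff_comm: "x - y \<in> I \<Longrightarrow> y - x \<in> I"
  using I_neg[of "x - y"] by simp

lemma I_sum: "(\<And>m. m \<in> S \<Longrightarrow> f m \<in> I) \<Longrightarrow> sum f S \<in> I"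
  by (induction S rule: infinite_finite_induct) (auto intro: I_add)

lemma I_mult_left: "x \<in> I \<Longrightarrow> s * x \<in> I"
  unfolding R2I_def
proof (induction rule: rspan.induct)
  case (rspan_gen x)
  then consider r where "x = 2 * r" | r u v where "x = r * (u * v - v * u)" by auto
  then show ?case
  proof cases
    case 1
    then have "s * x = 2 * (s * r)" by (metis mult.assoc mult_2 mult_2_right)
    then show ?thesis using I_two unfolding R2I_def by simp
  next
    case 2
    then have "s * x = (s * r) * (u * v - v * u)" by (simp add: mult.assoc)
    then show ?thesis using I_comm[of "s * r" u v] unfolding R2I_def by simp
  qed
qed (auto intro: rspan.intros simp: distrib_left sR_mult_right)

text \<open>The definition closes commutators under left multiplication only. A right factor is
  moved inside by the derivation rule [u, v s] = [u, v] s + v [u, s].\<close>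

lemma I_mult_right: "x \<in> I \<Longrightarrow> x * s \<in> I"
  unfolding R2I_def
proof (induction rule: rspan.induct)
  case (rspan_gen x)
  then consider r where "x = 2 * r" | r u v where "x = r * (u * v - v * u)" by auto
  then show ?case
  proof cases
    case 1
    then show ?thesis using I_two[of "r * s"] unfolding R2I_def by (simp add: mult.assoc)
  next
    case 2
    have "x * s = r * (u * (v * s) - (v * s) * u) - (r * v) * (u * s - s * u)"
      unfolding 2 by (simp add: algebra_simps)
    then show ?thesis using I_diff[OF I_comm[of r u "v * s"] I_comm[of "r * v" u s]]
      unfolding R2I_def by simp
  qed
qed (auto intro: rspan.intros simp: distrib_right sR_mult_left)

lemma I_commutator: "u * v - v * u \<in> I"
  using I_comm[of 1 u v] by simp

text \<open>Modulo \<open>I\<close> signs may be dropped and factors reordered. Each product is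
  brought into the order A, B, C, so that the later comparison is one of words and needs no
  commutation.\<close>

lemma minor2_cong_ordered:
  shows "A i j * matcomm B C k l - (\<Sum>m\<in>{1..4}. A i j * B k m * C m l + A i j * B m l * C k m) \<in> I"
    and "matcomm A B i j * C k l - (\<Sum>m\<in>{1..4}. A i m * B m j * C k l + A m j * B i m * C k l) \<in> I"
    and "matcomm A C i j * B k l - (\<Sum>m\<in>{1..4}. A i m * B k l * C m j + A m j * B k l * C i m) \<in> I"
proof -
  have "A i j * matcomm B C k l - (\<Sum>m\<in>{1..4}. A i j * B k m * C m l + A i j * B m l * C k m)
      = (\<Sum>m\<in>{1..4}. A i j * (B m l * C k m - C k m * B m l) - 2 * (A i j * B m l * C k m))"
    by (simp only: matcomm_def matmul_def sum_subtractf[symmetric] sum_distrib_left right_diff_distrib)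
      (rule sum.cong, auto simp: algebra_simps mult_2)
  also have "\<dots> \<in> I" by (intro I_sum I_diff I_comm I_two)
  finally show "A i j * matcomm B C k l - (\<Sum>m\<in>{1..4}. A i j * B k m * C m l + A i j * B m l * C k m) \<in> I" .
  have "matcomm A B i j * C k l - (\<Sum>m\<in>{1..4}. A i m * B m j * C k l + A m j * B i m * C k l)
      = (\<Sum>m\<in>{1..4}. (A m j * B i m - B i m * A m j) * C k l - 2 * (A m j * B i m * C k l))"
    by (simp only: matcomm_def matmul_def sum_subtractf[symmetric] sum_distrib_right left_diff_distrib)
      (rule sum.cong, auto simp: algebra_simps mult_2)
  also have "\<dots> \<in> I" by (intro I_sum I_diff I_mult_right[OF I_commutator] I_two)
  finally show "matcomm A B i j * C k l - (\<Sum>m\<in>{1..4}. A i m * B m j * C k l + A m j * B i m * C k l) \<in> I" .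
  \<comment> \<open>The word C A B is carried to C B A, B C A and A B C by one commutator each; its
    minus sign is then reversed at the cost of twice the word A B C.\<close>
  have "matcomm A C i j * B k l - (\<Sum>m\<in>{1..4}. A i m * B k l * C m j + A m j * B k l * C i m)
      = (\<Sum>m\<in>{1..4}. A i m * (C m j * B k l - B k l * C m j)
          + (A m j * (B k l * C i m) - (B k l * C i m) * A m j)
          + (B k l * C i m - C i m * B k l) * A m j
          + C i m * (B k l * A m j - A m j * B k l) - 2 * (A m j * B k l * C i m))"
    by (simp only: matcomm_def matmul_def sum_subtractf[symmetric] sum_distrib_right left_diff_distrib)
      (rule sum.cong, auto simp: algebra_simps mult_2)
  also have "\<dots> \<in> I"
    by (intro I_sum I_diff I_add I_mult_right[OF I_commutator] I_mult_left[OF I_commutator] I_commutator I_two)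
  finally show "matcomm A C i j * B k l - (\<Sum>m\<in>{1..4}. A i m * B k l * C m j + A m j * B k l * C i m) \<in> I" .
qed

text \<open>When the summation index runs through i, j, k, l, a term contains one diagonal entry or
  none. The terms with a diagonal entry of one matrix combine to its trace times two other entries,
  the two halves of the trace coming from two different commutators. The terms without diagonal
  entry occur in equal pairs. Both contributions lie in \<open>I\<close>.\<close>

lemma minor2_cocycle:
  assumes tr: "mattrace A \<in> I" "mattrace B \<in> I" "mattrace C \<in> I"
    and idx: "{i, j, k, l} = {1, 2, 3, 4}"
  shows "minor2 i j k l A (matcomm B C) -
    (minor2 i j k l (matcomm A B) C - minor2 i j k l (matcomm A C) B) \<in> I"
proof -
  define P where "P i j k l = (\<Sum>m\<in>{1..4}. A i j * B k m * C m l + A i j * B m l * C k m)" for i j k l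
  define Q where "Q i j k l = (\<Sum>m\<in>{1..4}. A i m * B m j * C k l + A m j * B i m * C k l)" for i j k l
  define R where "R i j k l = (\<Sum>m\<in>{1..4}. A i m * B k l * C m j + A m j * B k l * C i m)" for i j k l
  define p where "p i j k l = A i j * matcomm B C k l" for i j k l
  define q where "q i j k l = matcomm A B i j * C k l" for i j k l
  define r where "r i j k l = matcomm A C i j * B k l" for i j k l
  let ?S = "\<lambda>f. f i j k l + f k j i l + f i l k j + f k l i j"
  have pP: "p i j k l - P i j k l \<in> I" and qQ: "q i j k l - Q i j k l \<in> I"
    and rR: "r i j k l - R i j k l \<in> I" for i j k l
    unfolding p_def P_def q_def Q_def r_def R_def by (rule minor2_cong_ordered)+
  \<comment> \<open>The second letter names the matrix whose diagonal entry occurs, and N stands for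
    none.\<close>
  define PB where "PB i j k l = A i j * B k k * C k l + A i j * B l l * C k l" for i j k l
  define PC where "PC i j k l = A i j * B k l * C k k + A i j * B k l * C l l" for i j k l
  define PN where "PN i j k l = A i j * B k i * C i l + A i j * B i l * C k i
      + A i j * B k j * C j l + A i j * B j l * C k j" for i j k l
  define QA where "QA i j k l = A i i * B i j * C k l + A j j * B i j * C k l" for i j k l
  define QB where "QB i j k l = A i j * B i i * C k l + A i j * B j j * C k l" for i j k l
  define QN where "QN i j k l = A i k * B k j * C k l + A k j * B i k * C k l
      + A i l * B l j * C k l + A l j * B i l * C k l" for i j k l
  define RA where "RA i j k l = A i i * B k l * C i j + A j j * B k l * C i j" for i j k l
  define RC where "RC i j k l = A i j * B k l * C i i + A i j * B k l * C j j" for i j k l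
  define RN where "RN i j k l = A i k * B k l * C k j + A k j * B k l * C i k
      + A i l * B k l * C l j + A l j * B k l * C i l" for i j k l
  have split: "P i j k l = PB i j k l + PC i j k l + PN i j k l"
    "Q i j k l = QA i j k l + QB i j k l + QN i j k l"
    "R i j k l = RA i j k l + RC i j k l + RN i j k l"
    and trA: "QA i j k l + RA k l i j \<in> I" and trB: "PB i j k l + QB i j k l \<in> I"
    and trC: "PC i j k l + RC i j k l \<in> I"
    if idx: "{i, j, k, l} = {1, 2, 3, 4}" for i j k l
  proof -
    show "P i j k l = PB i j k l + PC i j k l + PN i j k l"
      "Q i j k l = QA i j k l + QB i j k l + QN i j k l"
      "R i j k l = RA i j k l + RC i j k l + RN i j k l"
      unfolding P_def Q_def R_def sum_four[OF idx] PB_def PC_def PN_def QA_def QB_def QN_def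
        RA_def RC_def RN_def by (simp_all only: add_ac)
    have "QA i j k l + RA k l i j = mattrace A * B i j * C k l"
      unfolding mattrace_def sum_four[OF idx] QA_def RA_def by (simp add: algebra_simps)
    then show "QA i j k l + RA k l i j \<in> I" by (simp add: I_mult_right tr)
    have "PB i j k l + QB i j k l = A i j * mattrace B * C k l"
      unfolding mattrace_def sum_four[OF idx] PB_def QB_def by (simp add: algebra_simps)
    then show "PB i j k l + QB i j k l \<in> I" by (simp add: I_mult_right I_mult_left tr)
    have "PC i j k l + RC i j k l = A i j * B k l * mattrace C"
      unfolding mattrace_def sum_four[OF idx] PC_def RC_def by (simp add: algebra_simps)
    then show "PC i j k l + RC i j k l \<in> I" by (simp add: I_mult_left tr)
  qed
  have idx': "{k, j, i, l} = {1, 2, 3, 4}" "{i, l, k, j} = {1, 2, 3, 4}" "{k, l, i, j} = {1, 2, 3, 4}"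
    using idx by (auto simp: insert_commute)
  note spl = split[OF idx] split[OF idx'(1)] split[OF idx'(2)] split[OF idx'(3)]
  \<comment> \<open>The bracket on the right lists one word from each of the 24 equal pairs.\<close>
  have "?S PN + ?S QN + ?S RN = 2 * (A i j * B k i * C i l + A i j * B i l * C k i + A i j * B k j * C j l
        + A i j * B j l * C k j + A i k * B k j * C k l + A k j * B i k * C k l
        + A i k * B k l * C k j + A k j * B k l * C i k + A i l * B l j * C k l
        + A l j * B i l * C k l + A i l * B k l * C l j + A l j * B k l * C i l
        + A k j * B i j * C j l + A k j * B j l * C i j + A k i * B i j * C i l
        + A k i * B i l * C i j + A k l * B l j * C i l + A k l * B i l * C l j
        + A i l * B k i * C i j + A i l * B i j * C k i + A k l * B i k * C k j
        + A k l * B k j * C i k + A j l * B i j * C k j + A j l * B k j * C i j)"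
    unfolding PN_def QN_def RN_def mult_2 by (simp only: add_ac)
  then have N: "?S PN + ?S QN + ?S RN \<in> I" by (simp only: I_two)
  have T: "?S (\<lambda>i j k l. QA i j k l + RA k l i j) + ?S (\<lambda>i j k l. PB i j k l + QB i j k l)
      + ?S (\<lambda>i j k l. PC i j k l + RC i j k l) \<in> I"
    by (intro I_add trA trB trC idx idx')
  have "?S P + ?S Q + ?S R = ?S (\<lambda>i j k l. QA i j k l + RA k l i j)
      + ?S (\<lambda>i j k l. PB i j k l + QB i j k l) + ?S (\<lambda>i j k l. PC i j k l + RC i j k l)
      + (?S PN + ?S QN + ?S RN)"
    unfolding spl by (simp only: add_ac)
  also have "\<dots> \<in> I" using T N by (rule I_add)
  \<comment> \<open>The cocycle identity has the sign pattern p - q + r, so the sign of Q is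
    reversed by an even multiple.\<close>
  finally have "?S P + ?S Q + ?S R - 2 * ?S Q \<in> I" by (intro I_diff I_two)
  moreover have "?S (\<lambda>i j k l. p i j k l - P i j k l) - ?S (\<lambda>i j k l. q i j k l - Q i j k l)
      + ?S (\<lambda>i j k l. r i j k l - R i j k l) \<in> I"
    by (intro I_add I_diff pP qQ rR)
  ultimately have "?S P + ?S Q + ?S R - 2 * ?S Q + (?S (\<lambda>i j k l. p i j k l - P i j k l)
      - ?S (\<lambda>i j k l. q i j k l - Q i j k l) + ?S (\<lambda>i j k l. r i j k l - R i j k l)) \<in> I"
    by (rule I_add)
  also have "?S P + ?S Q + ?S R - 2 * ?S Q + (?S (\<lambda>i j k l. p i j k l - P i j k l)
      - ?S (\<lambda>i j k l. q i j k l - Q i j k l) + ?S (\<lambda>i j k l. r i j k l - R i j k l))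
      = ?S p - (?S q - ?S r)" by (simp add: mult_2)
  finally show ?thesis by (simp add: minor2_def p_def q_def r_def)
qed

text \<open>The trace is taken modulo \<open>I\<close> because the trace of a commutator of matrices
  over \<open>R\<close> is a sum of commutators in \<open>R\<close>, which is in general
  nonzero.\<close>

definition sl4 :: "('k, nat \<Rightarrow> nat \<Rightarrow> 'r) lalg" where
  "sl4 = \<lparr> lcarrier = {A. mattrace A \<in> I}, ladd = (\<lambda>A B p q. A p q + B p q), lzero = (\<lambda>p q. 0),
     lsmult = (\<lambda>c A p q. sR c (A p q)), lbr = matcomm \<rparr>"

lemma sR_sum: "sR c (sum f S) = (\<Sum>m\<in>S. sR c (f m))"
  by (induction S rule: infinite_finite_induct) (auto simp: sR_add_right)

lemma leibniz_sl4: "leibniz sl4"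
proof (rule leibnizI)
  show "kmodule sl4"
    unfolding kmodule_def sl4_def
    by (simp add: mattrace_def sum.distrib I_add I_smult sR_sum[symmetric] sR_neg sR_assoc
        sR_add_left sR_add_right add.assoc add.commute add.left_commute)
  show "kbilinear sl4 sl4 (lbr sl4)"
  proof (rule kbilinearI)
    fix A B assume "A \<in> lcarrier sl4" "B \<in> lcarrier sl4"
    have "mattrace (matcomm A B) = (\<Sum>p\<in>{1..4}. \<Sum>m\<in>{1..4}. A p m * B m p)
        - (\<Sum>m\<in>{1..4}. \<Sum>p\<in>{1..4}. B p m * A m p)"
      unfolding mattrace_def matcomm_def matmul_def sum_subtractf
      by (subst (3) sum.swap) (rule refl)
    also have "\<dots> = (\<Sum>p\<in>{1..4}. \<Sum>m\<in>{1..4}. A p m * B m p - B m p * A p m)"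
      by (simp only: sum_subtractf)
    also have "\<dots> \<in> I" by (intro I_sum I_commutator)
    finally show "A \<bullet>\<^bsub>sl4\<^esub> B \<in> lcarrier sl4" by (simp add: sl4_def)
  qed (simp_all add: sl4_def matcomm_def matmul_def fun_eq_iff algebra_simps sum.distrib sR_sum
      sR_diff sR_mult_left sR_mult_right)
  show "A \<bullet>\<^bsub>sl4\<^esub> (B \<bullet>\<^bsub>sl4\<^esub> C) = A \<bullet>\<^bsub>sl4\<^esub> B \<bullet>\<^bsub>sl4\<^esub> C \<ominus>\<^bsub>sl4\<^esub> A \<bullet>\<^bsub>sl4\<^esub> C \<bullet>\<^bsub>sl4\<^esub> B" for A B C
    by (simp add: sl4_def lsub_def sR_neg fun_eq_iff matcomm_leibniz)
qed

lemma ex_stl4_to_matrices: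
  obtains f where "lhom L sl4 f"
    "\<And>i j a. i \<in> {1..4} \<Longrightarrow> j \<in> {1..4} \<Longrightarrow> i \<noteq> j \<Longrightarrow> f (X i j a) = matunit i j a"
proof (rule stl4_lhom[OF leibniz_sl4, of matunit])
  fix i j :: nat and a :: 'r assume "i \<in> {1..4}" "j \<in> {1..4}" "i \<noteq> j"
  then have "mattrace (matunit i j a) = 0"
    unfolding mattrace_def matunit_def by (intro sum.neutral) auto
  then show "matunit i j a \<in> lcarrier sl4" by (simp add: sl4_def)
qed (simp_all del: atLeastAtMost_iff add: sl4_def matcomm_matunit,
    auto simp: matunit_def fun_eq_iff sR_neg)

definition toMat :: "((nat \<times> nat \<times> 'r) mag \<Rightarrow> 'k) set \<Rightarrow> nat \<Rightarrow> nat \<Rightarrow> 'r" where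
  "toMat = (SOME f. lhom L sl4 f \<and>
     (\<forall>i j a. i \<in> {1..4} \<longrightarrow> j \<in> {1..4} \<longrightarrow> i \<noteq> j \<longrightarrow> f (X i j a) = matunit i j a))"

lemma toMat_lhom: "lhom L sl4 toMat"
  and toMat_X: "i \<in> {1..4} \<Longrightarrow> j \<in> {1..4} \<Longrightarrow> i \<noteq> j \<Longrightarrow> toMat (X i j a) = matunit i j a"
proof -
  obtain f where "lhom L sl4 f"
    "\<And>i j a. i \<in> {1..4} \<Longrightarrow> j \<in> {1..4} \<Longrightarrow> i \<noteq> j \<Longrightarrow> f (X i j a) = matunit i j a"
    using ex_stl4_to_matrices by blast
  then have "lhom L sl4 f \<and>
     (\<forall>i j a. i \<in> {1..4} \<longrightarrow> j \<in> {1..4} \<longrightarrow> i \<noteq> j \<longrightarrow> f (X i j a) = matunit i j a)" by blast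
  from someI[of "\<lambda>f. lhom L sl4 f \<and> (\<forall>i j a. i \<in> {1..4} \<longrightarrow> j \<in> {1..4} \<longrightarrow> i \<noteq> j \<longrightarrow>
      f (X i j a) = matunit i j a)", OF this]
  have *: "lhom L sl4 toMat \<and>
     (\<forall>i j a. i \<in> {1..4} \<longrightarrow> j \<in> {1..4} \<longrightarrow> i \<noteq> j \<longrightarrow> toMat (X i j a) = matunit i j a)"
    unfolding toMat_def .
  show "lhom L sl4 toMat" using * by blast
  show "i \<in> {1..4} \<Longrightarrow> j \<in> {1..4} \<Longrightarrow> i \<noteq> j \<Longrightarrow> toMat (X i j a) = matunit i j a"
    using * by blast
qed

lemma toMat_add: "x \<in> lcarrier L \<Longrightarrow> y \<in> lcarrier L \<Longrightarrow> toMat (x \<oplus>\<^bsub>L\<^esub> y) p q = toMat x p q + toMat y p q"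
  and toMat_smult: "x \<in> lcarrier L \<Longrightarrow> toMat (c \<odot>\<^bsub>L\<^esub> x) p q = sR c (toMat x p q)"
  and toMat_br: "x \<in> lcarrier L \<Longrightarrow> y \<in> lcarrier L \<Longrightarrow> toMat (x \<bullet>\<^bsub>L\<^esub> y) = matcomm (toMat x) (toMat y)"
  and toMat_trace: "x \<in> lcarrier L \<Longrightarrow> mattrace (toMat x) \<in> I"
  using klinear_add[OF lhom_klinear[OF toMat_lhom]] klinear_smult[OF lhom_klinear[OF toMat_lhom]]
    lhom_lbr[OF toMat_lhom] klinear_closed[OF lhom_klinear[OF toMat_lhom]]
  by (auto simp: sl4_def)

text \<open>Brackets of opposite generators become diagonal matrices, while the minors in question
  read only off-diagonal entries; this is why \<psi> vanishes on \<open>stH sR\<close>.\<close>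

lemma toMat_H:
  assumes "h \<in> stH sR" "p \<noteq> q"
  shows "toMat h p q = 0"
  using assms(1) unfolding stH_def
proof induction
  case (span_gen s)
  then obtain i j a b where "i \<in> {1..4}" "j \<in> {1..4}" "i \<noteq> j" "s = X i j a \<bullet>\<^bsub>L\<^esub> X j i b" by auto
  then show ?case using assms(2)
    by (simp del: atLeastAtMost_iff add: toMat_br toMat_X X_closed matcomm_matunit) (auto simp: matunit_def)
next
  case span_zero
  then show ?case using klinear_zero[OF lhom_klinear[OF toMat_lhom] L.kmodule leibniz_kmodule[OF leibniz_sl4]]
    by (simp add: sl4_def)
next
  case (span_add x y)
  have "{X i j a \<bullet>\<^bsub>L\<^esub> X j i b | i j a b. i \<in> {1..4} \<and> j \<in> {1..4} \<and> i \<noteq> j} \<subseteq> lcarrier L"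
    by (auto simp del: atLeastAtMost_iff intro!: L_closed X_closed)
  then show ?case using span_add lspan_carrier[OF L.kmodule] by (simp add: toMat_add)
next
  case (span_smult x c)
  have "{X i j a \<bullet>\<^bsub>L\<^esub> X j i b | i j a b. i \<in> {1..4} \<and> j \<in> {1..4} \<and> i \<noteq> j} \<subseteq> lcarrier L"
    by (auto simp del: atLeastAtMost_iff intro!: L_closed X_closed)
  then show ?case using span_smult lspan_carrier[OF L.kmodule] by (simp add: toMat_smult)
qed

end

section \<open>The cocycle \<psi>\<close>

lemma one_to_four: "{1..4::nat} = {1, 2, 3, 4}"
  by auto

lemma Pset_iff: "(i, j, k, l) \<in> Pset \<longleftrightarrow> {i, j, k, l} = {1, 2, 3, 4}"
  by (simp add: Pset_def)

lemma Pset_distinct: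
  assumes "(i, j, k, l) \<in> Pset"
  shows "i \<noteq> j" "i \<noteq> k" "i \<noteq> l" "j \<noteq> k" "j \<noteq> l" "k \<noteq> l"
proof -
  have "card {i, j, k, l} = 4" using assms by (simp add: Pset_iff)
  then show "i \<noteq> j" "i \<noteq> k" "i \<noteq> l" "j \<noteq> k" "j \<noteq> l" "k \<noteq> l"
    by (auto simp: card_insert_if split: if_splits)
qed

lemma Pset_range:
  assumes "(i, j, k, l) \<in> Pset"
  shows "i \<in> {1..4}" "j \<in> {1..4}" "k \<in> {1..4}" "l \<in> {1..4}"
proof -
  have "{i, j, k, l} = {1..4}" using assms by (simp only: Pset_iff one_to_four)
  then show "i \<in> {1..4}" "j \<in> {1..4}" "k \<in> {1..4}" "l \<in> {1..4}" by (metis insert_iff)+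
qed

lemma PsetI:
  assumes "i \<in> {1..4}" "j \<in> {1..4}" "k \<in> {1..4}" "l \<in> {1..4}"
    and "i \<noteq> j" "i \<noteq> k" "i \<noteq> l" "j \<noteq> k" "j \<noteq> l" "k \<noteq> l"
  shows "(i, j, k, l) \<in> Pset"
proof -
  have "{i, j, k, l} = {1..4}"
    by (rule card_subset_eq) (use assms in auto)
  then show ?thesis by (simp only: Pset_iff one_to_four)
qed

lemma finite_Pset [simp]: "finite Pset"
proof (rule finite_subset)
  show "Pset \<subseteq> {1..4} \<times> {1..4} \<times> {1..4} \<times> {1..4}"
  proof clarify
    fix i j k l :: nat assume "(i, j, k, l) \<in> Pset"
    then show "i \<in> {1..4} \<and> (j, k, l) \<in> {1..4} \<times> {1..4} \<times> {1..4}"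
      using Pset_range[of i j k l] by (simp del: atLeastAtMost_iff)
  qed
qed simp

lemma Pset_swap:
  assumes "(i, j, k, l) \<in> Pset"
  shows "(k, j, i, l) \<in> Pset" "(i, l, k, j) \<in> Pset" "(k, l, i, j) \<in> Pset"
proof -
  have "{k, j, i, l} = {i, j, k, l}" "{i, l, k, j} = {i, j, k, l}" "{k, l, i, j} = {i, j, k, l}"
    by blast+
  then show "(k, j, i, l) \<in> Pset" "(i, l, k, j) \<in> Pset" "(k, l, i, j) \<in> Pset"
    using assms by (simp_all only: Pset_iff)
qed

lemma Pset_same_rows:
  assumes p: "(i, j, k, l) \<in> Pset" and q: "(i', j', k', l') \<in> Pset" and eq: "{i, k} = {i', k'}"
  shows "(i', j', k', l') \<in> {(i, j, k, l), (k, j, i, l), (i, l, k, j), (k, l, i, j)}"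
proof -
  have "{j, l} = {1, 2, 3, 4} - {i, k}" "{j', l'} = {1, 2, 3, 4} - {i', k'}"
    using Pset_distinct[OF p] Pset_distinct[OF q] p[unfolded Pset_iff, symmetric] q[unfolded Pset_iff, symmetric]
    by (simp_all only:) auto
  then have "{j, l} = {j', l'}" using eq by simp
  then show ?thesis using eq by (auto simp: doubleton_eq_iff)
qed

text \<open>The group exchanges position 1 with 3 and position 2 with 4, so it preserves the
  unordered pair in the first and third places, the rows of the minor. This pair is a complete
  invariant of the class and replaces the permutations from here on.\<close>

lemma Pclass_rows:
  assumes "(i, j, k, l) \<in> Pclass \<sigma>"
  shows "{i, k} = {\<sigma> 1, \<sigma> 3}"
  using assms unfolding Pclass_def Gset_def by (elim CollectE exE conjE insertE emptyE) auto

lemma Pclass_of_Pset: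
  assumes p: "(i, j, k, l) \<in> Pset"
  obtains \<sigma> where "bij_betw \<sigma> {1..4} {1..4}"
    "{(i, j, k, l), (k, j, i, l), (i, l, k, j), (k, l, i, j)} \<subseteq> Pclass \<sigma>"
proof -
  define \<sigma> where "\<sigma> x = (if x = 1 then i else if x = 2 then j else if x = 3 then k else l)" for x :: nat
  have "\<sigma> ` {1, 2, 3, 4} = {i, j, k, l}" unfolding image_insert image_empty by (auto simp: \<sigma>_def)
  moreover have "inj_on \<sigma> {1, 2, 3, 4}"
    using Pset_distinct[OF p] by (simp add: \<sigma>_def)
  ultimately have "bij_betw \<sigma> {1..4} {1..4}"
    using p by (simp only: bij_betw_def one_to_four Pset_iff)
  moreover have "{(i, j, k, l), (k, j, i, l), (i, l, k, j), (k, l, i, j)} \<subseteq> Pclass \<sigma>"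
  proof -
    have "(\<sigma> (g 1), \<sigma> (g 2), \<sigma> (g 3), \<sigma> (g 4)) \<in> Pclass \<sigma>" if "g \<in> Gset" for g
      using that unfolding Pclass_def by blast
    from this[of id] this[of "\<lambda>x. if x = 1 then 3 else if x = 3 then 1 else x"]
      this[of "\<lambda>x. if x = 2 then 4 else if x = 4 then 2 else x"]
      this[of "\<lambda>x. if x = 1 then 3 else if x = 3 then 1 else if x = 2 then 4 else if x = 4 then 2 else x"]
    show ?thesis by (simp add: Gset_def \<sigma>_def)
  qed
  ultimately show ?thesis using that by blast
qed

lemma valid_label_eq_iff:
  assumes \<theta>: "valid_label \<theta>" and p: "(i, j, k, l) \<in> Pset" and q: "(i', j', k', l') \<in> Pset"
  shows "\<theta> (i, j, k, l) = \<theta> (i', j', k', l') \<longleftrightarrow> {i, k} = {i', k'}"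
proof -
  have iff: "\<theta> (i, j, k, l) = \<theta> (i', j', k', l') \<longleftrightarrow>
    (\<exists>\<sigma>. bij_betw \<sigma> {1..4} {1..4} \<and> (i, j, k, l) \<in> Pclass \<sigma> \<and> (i', j', k', l') \<in> Pclass \<sigma>)"
    by (rule \<theta>[unfolded valid_label_def, THEN conjunct2, THEN conjunct2, THEN bspec, OF p, THEN bspec, OF q])
  show ?thesis
  proof
    assume "\<theta> (i, j, k, l) = \<theta> (i', j', k', l')"
    then obtain \<sigma> where "(i, j, k, l) \<in> Pclass \<sigma>" "(i', j', k', l') \<in> Pclass \<sigma>"
      unfolding iff by (elim exE conjE)
    then show "{i, k} = {i', k'}" by (simp only: Pclass_rows)
  next
    assume eq: "{i, k} = {i', k'}"
    obtain \<sigma> where \<sigma>: "bij_betw \<sigma> {1..4} {1..4}"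
      "{(i, j, k, l), (k, j, i, l), (i, l, k, j), (k, l, i, j)} \<subseteq> Pclass \<sigma>"
      by (rule Pclass_of_Pset[OF p])
    moreover have "(i, j, k, l) \<in> Pclass \<sigma>" using \<sigma>(2) by simp
    moreover have "(i', j', k', l') \<in> Pclass \<sigma>"
      using \<sigma>(2) Pset_same_rows[OF p q eq] by (rule subsetD)
    ultimately show "\<theta> (i, j, k, l) = \<theta> (i', j', k', l')" unfolding iff by (intro exI conjI)
  qed
qed

lemma valid_label_class:
  assumes \<theta>: "valid_label \<theta>" and p: "(i, j, k, l) \<in> Pset"
  shows "{q \<in> Pset. \<theta> q = \<theta> (i, j, k, l)} = {(i, j, k, l), (k, j, i, l), (i, l, k, j), (k, l, i, j)}"
proof
  show "{q \<in> Pset. \<theta> q = \<theta> (i, j, k, l)} \<subseteq> {(i, j, k, l), (k, j, i, l), (i, l, k, j), (k, l, i, j)}"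
  proof
    fix q assume q: "q \<in> {q \<in> Pset. \<theta> q = \<theta> (i, j, k, l)}"
    obtain i' j' k' l' where e: "q = (i', j', k', l')" by (metis prod.exhaust)
    have "{i, k} = {i', k'}" using q valid_label_eq_iff[OF \<theta> p, of i' j' k' l'] unfolding e by auto
    then show "q \<in> {(i, j, k, l), (k, j, i, l), (i, l, k, j), (k, l, i, j)}"
      using Pset_same_rows[OF p, of i' j' k' l'] q unfolding e by simp
  qed
  show "{(i, j, k, l), (k, j, i, l), (i, l, k, j), (k, l, i, j)} \<subseteq> {q \<in> Pset. \<theta> q = \<theta> (i, j, k, l)}"
    using p Pset_swap[OF p] valid_label_eq_iff[OF \<theta> _ p] insert_commute[of k i "{}"] by simp
qed

text \<open>\<open>valid_label\<close> places the labels in 1..6 and separates the classes; that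
  every label occurs follows by counting, since the six row pairs receive different labels.\<close>

lemma valid_label_surj:
  assumes \<theta>: "valid_label \<theta>" and m: "m \<in> {1..6}"
  obtains i j k l where "(i, j, k, l) \<in> Pset" "\<theta> (i, j, k, l) = m"
proof -
  \<comment> \<open>One quadruple for each two-element set of rows {i, k}.\<close>
  let ?R = "{(1, 3, 2, 4), (1, 2, 3, 4), (1, 2, 4, 3), (2, 1, 3, 4), (2, 1, 4, 3), (3, 1, 4, 2)}
    :: (nat \<times> nat \<times> nat \<times> nat) set"
  have R: "?R \<subseteq> Pset" by (auto simp: Pset_iff)
  have "inj_on \<theta> ?R"
  proof (rule inj_onI)
    fix p q assume pq: "p \<in> ?R" "q \<in> ?R" "\<theta> p = \<theta> q"
    obtain i j k l i' j' k' l' where e: "p = (i, j, k, l)" "q = (i', j', k', l')"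
      by (metis prod.exhaust)
    have "{i, k} = {i', k'}"
      using pq R valid_label_eq_iff[OF \<theta>, of i j k l i' j' k' l'] unfolding e by blast
    then show "p = q" using pq(1,2) unfolding e by (auto simp: doubleton_eq_iff)
  qed
  then have "card (\<theta> ` ?R) = 6" by (subst card_image) auto
  moreover have sub: "\<theta> ` ?R \<subseteq> {1..6}" using \<theta> R unfolding valid_label_def by blast
  ultimately have "\<theta> ` ?R = {1..6}" by (intro card_subset_eq) simp_all
  then have "m \<in> \<theta> ` ?R" using m by (simp only:)
  then obtain p where p: "m = \<theta> p" "p \<in> ?R" by (rule imageE)
  obtain i j k l where e: "p = (i, j, k, l)" by (metis prod.exhaust)
  have "(i, j, k, l) \<in> Pset" using R p(2) unfolding e by (rule subsetD)
  then show ?thesis by (rule that) (simp only: p(1) e)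
qed

section \<open>Coordinates on the module W\<close>

context steinberg
begin

abbreviation "W \<equiv> Wmod sR"

lemma R2cl_self: "a \<in> R2cl sR a"
  unfolding R2cl_def by (rule CollectI, rule exI[of _ 0]) simp

lemma R2cl_eq_iff: "R2cl sR a = R2cl sR b \<longleftrightarrow> a - b \<in> I"
proof
  assume "R2cl sR a = R2cl sR b"
  then have "a \<in> R2cl sR b" using R2cl_self[of a] by simp
  then show "a - b \<in> I" by (auto simp: R2cl_def)
next
  have *: "R2cl sR a \<subseteq> R2cl sR b" if "a - b \<in> I" for a b
    unfolding R2cl_def
  proof clarify
    fix i assume "i \<in> I"
    then show "\<exists>i'. a + i = b + i' \<and> i' \<in> I"
      using I_add[OF that, of i] by (intro exI[of _ "a - b + i"]) auto
  qed
  assume ab: "a - b \<in> I"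
  show "R2cl sR a = R2cl sR b" using *[OF ab] *[OF I_diff_comm[OF ab]] by (rule equalityI)
qed

lemma some_R2cl: "(SOME b. b \<in> R2cl sR a) - a \<in> I"
proof -
  have "(SOME b. b \<in> R2cl sR a) \<in> R2cl sR a"
    by (rule someI[of "\<lambda>b. b \<in> R2cl sR a", OF R2cl_self])
  then show ?thesis by (auto simp: R2cl_def)
qed

text \<open>Elements of \<open>W\<close> are handled through lifts to functions with values in
  \<open>R\<close>. Resetting the lift to 0 outside 1..6 makes every function a legitimate
  representative.\<close>

definition Wcl :: "(nat \<Rightarrow> 'r) \<Rightarrow> nat \<Rightarrow> 'r set" where
  "Wcl f = (\<lambda>m. R2cl sR (if m \<in> {1..6} then f m else 0))"

lemma Wcl_eq_iff: "Wcl f = Wcl g \<longleftrightarrow> (\<forall>m\<in>{1..6}. f m - g m \<in> I)"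
  unfolding Wcl_def fun_eq_iff R2cl_eq_iff by auto

lemma W_carrier: "lcarrier W = range Wcl"
proof
  show "lcarrier W \<subseteq> range Wcl"
  proof
    fix w assume "w \<in> lcarrier W"
    then have w: "\<forall>m. w m \<in> range (R2cl sR)" "\<forall>m. m \<notin> {1..6} \<longrightarrow> w m = R2cl sR 0"
      by (simp_all add: Wmod_def)
    from w(1) obtain f where "\<forall>m. w m = R2cl sR (f m)" unfolding image_def by simp metis
    then have "w = Wcl f" using w(2) by (intro ext) (auto simp: Wcl_def)
    then show "w \<in> range Wcl" by blast
  qed
  show "range Wcl \<subseteq> lcarrier W" by (auto simp: Wmod_def Wcl_def)
qed

lemma Wcl_closed [simp, intro]: "Wcl f \<in> lcarrier W"
  by (simp add: W_carrier)

lemma W_zero: "lzero W = Wcl (\<lambda>m. 0)"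
  by (simp add: Wmod_def Wcl_def)

lemma W_add: "Wcl f \<oplus>\<^bsub>W\<^esub> Wcl g = Wcl (\<lambda>m. f m + g m)"
proof
  fix m
  let ?a = "if m \<in> {1..6} then f m else 0" and ?b = "if m \<in> {1..6} then g m else 0"
  let ?a' = "SOME b. b \<in> R2cl sR ?a" and ?b' = "SOME a. a \<in> R2cl sR ?b"
  have "?a' + ?b' - (?a + ?b) = (?a' - ?a) + (?b' - ?b)" by simp
  then have "?a' + ?b' - (?a + ?b) \<in> I" by (simp only: I_add some_R2cl)
  then have "R2cl sR (?a' + ?b') = R2cl sR (?a + ?b)" unfolding R2cl_eq_iff .
  then show "(Wcl f \<oplus>\<^bsub>W\<^esub> Wcl g) m = Wcl (\<lambda>m. f m + g m) m"
    by (simp add: Wmod_def Wcl_def split: if_splits)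
qed

lemma W_smult: "c \<odot>\<^bsub>W\<^esub> Wcl f = Wcl (\<lambda>m. sR c (f m))"
proof
  fix m
  let ?a = "if m \<in> {1..6} then f m else 0"
  let ?a' = "SOME b. b \<in> R2cl sR ?a"
  have "sR c ?a' - sR c ?a \<in> I" unfolding sR_diff[symmetric] by (rule I_smult[OF some_R2cl])
  then have "R2cl sR (sR c ?a') = R2cl sR (sR c ?a)" unfolding R2cl_eq_iff .
  then show "(c \<odot>\<^bsub>W\<^esub> Wcl f) m = Wcl (\<lambda>m. sR c (f m)) m"
    by (simp add: Wmod_def Wcl_def split: if_splits)
qed

lemma kmodule_W: "kmodule W"
  unfolding kmodule_def W_carrier W_zero
  by (simp add: W_add W_smult sR_neg sR_assoc sR_add_left sR_add_right) (simp add: add_ac)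

sublocale W: kmod W
  using kmodule_W by (rule kmod.intro)

lemma W_sub: "Wcl f \<ominus>\<^bsub>W\<^esub> Wcl g = Wcl (\<lambda>m. f m - g m)"
  by (simp add: lsub_def W_smult W_add sR_neg)

lemma epsW_eq: "m \<in> {1..6} \<Longrightarrow> epsW sR m a = Wcl (\<lambda>m'. if m' = m then a else 0)"
  by (intro ext) (auto simp: epsW_def Wcl_def)

end

section \<open>The cocycle \<psi> as a family of minors\<close>

locale labelled_steinberg = steinberg sR for sR :: "'k::comm_ring_1 \<Rightarrow> 'r::ring_1 \<Rightarrow> 'r" +
  fixes \<theta> :: "nat \<times> nat \<times> nat \<times> nat \<Rightarrow> nat"
  assumes valid_label: "valid_label \<theta>"
begin

lemma theta_range: "p \<in> Pset \<Longrightarrow> \<theta> p \<in> {1..6}"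
  using valid_label unfolding valid_label_def by blast

text \<open>Summing over all quadruples with label \<open>m\<close> avoids choosing one of them; the
  four members of a class contribute the four summands of one minor.\<close>

definition psi_coord where
  "psi_coord x y = (\<lambda>m. \<Sum>(i, j, k, l)\<in>{p \<in> Pset. \<theta> p = m}. toMat x i j * toMat y k l)"

text \<open>The default outside the carrier is the one fixed in the specification of
  \<open>psi\<close>, without which that specification would not determine a function.\<close>

definition psi0 where
  "psi0 x y = (if x \<in> lcarrier L \<and> y \<in> lcarrier L then Wcl (psi_coord x y) else lzero W)"

lemma psi_coord_eq_minor2:
  assumes p: "(i, j, k, l) \<in> Pset"
  shows "psi_coord x y (\<theta> (i, j, k, l)) = minor2 i j k l (toMat x) (toMat y)"
  using Pset_distinct[OF p]
  unfolding psi_coord_def valid_label_class[OF valid_label p] minor2_def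
  by (simp add: add.assoc)

lemma psi0_bilinear: "kbilinear L W psi0"
  by (rule kbilinearI)
    (simp_all add: psi0_def W_add W_smult psi_coord_def toMat_add toMat_smult case_prod_beta
      distrib_left distrib_right sum.distrib sR_sum sR_mult_left sR_mult_right)

lemma psi0_X:
  assumes "i \<in> {1..4}" "j \<in> {1..4}" "k \<in> {1..4}" "l \<in> {1..4}" "i \<noteq> j" "k \<noteq> l"
  shows "psi0 (X i j a) (X k l b) =
    (if (i, j, k, l) \<in> Pset then epsW sR (\<theta> (i, j, k, l)) (a * b) else lzero W)"
proof -
  have "psi_coord (X i j a) (X k l b) m =
      (if (i, j, k, l) \<in> Pset then if m = \<theta> (i, j, k, l) then a * b else 0 else 0)" for m
  proof -
    have "psi_coord (X i j a) (X k l b) m =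
        (\<Sum>p\<in>{p \<in> Pset. \<theta> p = m}. if p = (i, j, k, l) then a * b else 0)"
      unfolding psi_coord_def toMat_X[OF assms(1,2,5)] toMat_X[OF assms(3,4,6)]
      by (rule sum.cong) (auto simp: matunit_def split: if_splits)
    then show ?thesis by (auto simp: sum.delta)
  qed
  then have "psi_coord (X i j a) (X k l b) =
      (\<lambda>m. if (i, j, k, l) \<in> Pset then if m = \<theta> (i, j, k, l) then a * b else 0 else 0)" by blast
  then show ?thesis using assms epsW_eq[OF theta_range]
    by (simp add: psi0_def W_zero X_closed del: atLeastAtMost_iff)
qed

lemma psi0_H:
  assumes "h \<in> stH sR"
  shows "psi0 h y = lzero W" "psi0 y h = lzero W"
proof -
  have "psi_coord h y m = 0" "psi_coord y h m = 0" for m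
    unfolding psi_coord_def
    by (rule sum.neutral; clarify; simp add: toMat_H[OF assms] Pset_distinct)+
  then have "psi_coord h y = (\<lambda>m. 0)" "psi_coord y h = (\<lambda>m. 0)" by auto
  then show "psi0 h y = lzero W" "psi0 y h = lzero W"
    by (auto simp: psi0_def W_zero)
qed

lemma psi0_cocycle:
  assumes "x \<in> lcarrier L" "y \<in> lcarrier L" "z \<in> lcarrier L"
  shows "psi0 x (y \<bullet>\<^bsub>L\<^esub> z) = psi0 (x \<bullet>\<^bsub>L\<^esub> y) z \<ominus>\<^bsub>W\<^esub> psi0 (x \<bullet>\<^bsub>L\<^esub> z) y"
proof -
  have "psi_coord x (y \<bullet>\<^bsub>L\<^esub> z) m - (psi_coord (x \<bullet>\<^bsub>L\<^esub> y) z m - psi_coord (x \<bullet>\<^bsub>L\<^esub> z) y m) \<in> I"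
    if "m \<in> {1..6}" for m
  proof -
    obtain i j k l where p: "(i, j, k, l) \<in> Pset" and m: "\<theta> (i, j, k, l) = m"
      using valid_label_surj[OF valid_label \<open>m \<in> {1..6}\<close>] .
    show ?thesis unfolding m[symmetric] psi_coord_eq_minor2[OF p] using assms p
      by (simp add: toMat_br minor2_cocycle toMat_trace Pset_iff)
  qed
  then show ?thesis using assms by (simp add: psi0_def L_closed W_sub Wcl_eq_iff)
qed

lemma H_in_stH: "i \<in> {1..4} \<Longrightarrow> j \<in> {1..4} \<Longrightarrow> i \<noteq> j \<Longrightarrow> X i j a \<bullet>\<^bsub>L\<^esub> X j i b \<in> stH sR"
  unfolding stH_def by (rule span_gen) blast

lemma kbilinear_eq_on_gens:
  assumes N: "kmodule N" and B: "kbilinear L N B" and B': "kbilinear L N B'"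
    and eq: "\<And>g g'. g \<in> gens \<Longrightarrow> g' \<in> gens \<Longrightarrow> B g g' = B' g g'"
    and x: "x \<in> lcarrier L" and y: "y \<in> lcarrier L"
  shows "B x y = B' x y"
proof -
  have 1: "B x g = B' x g" if "g \<in> gens" for g
    by (rule klinear_eq_on_lspan[OF kbilinear_left[OF B] kbilinear_left[OF B'] L.kmodule N gens_carrier eq
          stl4_span[OF x]]) (use that gens_carrier in auto)
  show ?thesis
    by (rule klinear_eq_on_lspan[OF kbilinear_right[OF B x] kbilinear_right[OF B' x] L.kmodule N gens_carrier 1
          stl4_span[OF y]])
qed

text \<open>\<open>psi0\<close> gives existence. Uniqueness holds because the prescribed values
  cover all pairs of elements of the spanning set \<open>gens\<close>: two generators, or at least
  one bracket of opposite generators.\<close>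

lemma psi_eq_psi0: "psi sR \<theta> = psi0"
  unfolding psi_def
proof (rule the_equality, goal_cases)
  case 1
  show ?case
    using psi0_bilinear psi0_X psi0_H
    by (auto simp: kbilinear_closed kbilinear_add_left kbilinear_add_right kbilinear_smult_left
        kbilinear_smult_right simp del: atLeastAtMost_iff) (auto simp: psi0_def)
next
  case (2 \<psi>)
  then have bil: "kbilinear L W \<psi>" by (intro kbilinearI) simp_all
  have val_X: "\<psi> (X i j a) (X k l b) =
      (if (i, j, k, l) \<in> Pset then epsW sR (\<theta> (i, j, k, l)) (a * b) else lzero W)"
    if "i \<in> {1..4}" "j \<in> {1..4}" "k \<in> {1..4}" "l \<in> {1..4}" "i \<noteq> j" "k \<noteq> l" for i j k l a b
    using 2 that by blast
  have val_H: "\<psi> h y = lzero W" "\<psi> y h = lzero W" if "h \<in> stH sR" "y \<in> lcarrier L" for h y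
    using 2 that by blast+
  have out: "\<psi> x y = lzero W" if "x \<notin> lcarrier L \<or> y \<notin> lcarrier L" for x y
    using 2 that by blast
  have gens: "\<psi> g g' = psi0 g g'" if "g \<in> gens" "g' \<in> gens" for g g'
    using that(1)
  proof (cases rule: gens_cases)
    case (H i j a b)
    then have "g \<in> stH sR" using H_in_stH by blast
    then show ?thesis using \<open>g' \<in> gens\<close> gens_carrier by (auto simp: psi0_H val_H)
  next
    case g: (X i j a)
    from \<open>g' \<in> gens\<close> show ?thesis
    proof (cases rule: gens_cases)
      case (H i' j' a b)
      then have "g' \<in> stH sR" using H_in_stH by blast
      then show ?thesis using \<open>g \<in> gens\<close> gens_carrier by (auto simp: psi0_H val_H)
    next
      case (X k l b)
      then show ?thesis using g by (simp add: psi0_X val_X del: atLeastAtMost_iff)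
    qed
  qed
  show ?case
  proof (rule ext, rule ext)
    fix x y
    show "\<psi> x y = psi0 x y"
    proof (cases "x \<in> lcarrier L \<and> y \<in> lcarrier L")
      case True
      then show ?thesis using kbilinear_eq_on_gens[OF kmodule_W bil psi0_bilinear gens] by blast
    next
      case False
      then show ?thesis using out by (auto simp: psi0_def)
    qed
  qed
qed

abbreviation "\<Psi> \<equiv> psi sR \<theta>"

lemmas psi_bilinear = psi0_bilinear[folded psi_eq_psi0]
  and psi_X = psi0_X[folded psi_eq_psi0]
  and psi_cocycle = psi0_cocycle[folded psi_eq_psi0]

end

section \<open>Splitting a central extension\<close>

lemma Pset_completion3:
  assumes "i \<in> {1..4}" "j \<in> {1..4}" "k \<in> {1..4}" "i \<noteq> j" "j \<noteq> k" "i \<noteq> k"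
  obtains l where "(i, j, k, l) \<in> Pset"
proof -
  have "card ({1..4} - {i, j, k}) = 1" using assms by (subst card_Diff_subset) auto
  then obtain l where "{1..4} - {i, j, k} = {l}" by (auto simp: card_1_singleton_iff)
  then have "l \<in> {1..4} - {i, j, k}" by blast
  then have "(i, j, k, l) \<in> Pset" using assms by (intro PsetI) auto
  then show ?thesis using that by blast
qed

locale stl4_cocycle = labelled_steinberg sR \<theta> + N: kmod N
  for sR :: "'k::comm_ring_1 \<Rightarrow> 'r::ring_1 \<Rightarrow> 'r" and \<theta> and N :: "('k, 'c) lalg" +
  fixes B d
  assumes B_bilinear: "kbilinear L N B"
    and B_cocycle: "\<And>x y z. x \<in> lcarrier L \<Longrightarrow> y \<in> lcarrier L \<Longrightarrow> z \<in> lcarrier L \<Longrightarrow>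
      B x (y \<bullet>\<^bsub>L\<^esub> z) = B (x \<bullet>\<^bsub>L\<^esub> y) z \<ominus>\<^bsub>N\<^esub> B (x \<bullet>\<^bsub>L\<^esub> z) y"
    and d_linear: "klinear N L d"
    and d_B: "\<And>x y. x \<in> lcarrier L \<Longrightarrow> y \<in> lcarrier L \<Longrightarrow> d (B x y) = x \<bullet>\<^bsub>L\<^esub> y"
begin

declare atLeastAtMost_iff [simp del] One_nat_def [simp del]

lemmas B_closed [simp, intro] = kbilinear_closed[OF B_bilinear]
lemmas B_lin = kbilinear_add_left[OF B_bilinear] kbilinear_add_right[OF B_bilinear]
  kbilinear_smult_left[OF B_bilinear] kbilinear_smult_right[OF B_bilinear]

lemma B_zero [simp]:
  assumes "x \<in> lcarrier L"
  shows "B \<zero>\<^bsub>L\<^esub> x = \<zero>\<^bsub>N\<^esub>" "B x \<zero>\<^bsub>L\<^esub> = \<zero>\<^bsub>N\<^esub>"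
  using klinear_zero[OF kbilinear_left[OF B_bilinear assms] L.kmodule N.kmodule]
    klinear_zero[OF kbilinear_right[OF B_bilinear assms] L.kmodule N.kmodule] by auto

lemma B_cocycle_left:
  assumes "x \<in> lcarrier L" "y \<in> lcarrier L" "z \<in> lcarrier L"
  shows "B (x \<bullet>\<^bsub>L\<^esub> y) z = B x (y \<bullet>\<^bsub>L\<^esub> z) \<oplus>\<^bsub>N\<^esub> B (x \<bullet>\<^bsub>L\<^esub> z) y"
  using N.sub_eq_iff[of "B (x \<bullet>\<^bsub>L\<^esub> y) z" "B (x \<bullet>\<^bsub>L\<^esub> z) y" "B x (y \<bullet>\<^bsub>L\<^esub> z)"] B_cocycle[OF assms] assms by simp

text \<open>Factoring the second argument through the fourth index moves the middle index from
  \<open>k\<close> to \<open>l\<close>; the other term of the cocycle identity contains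
  \<open>X i k a \<bullet> X l j c\<close>, which is zero.\<close>

lemma B_shift:
  assumes p: "(i, j, k, l) \<in> Pset"
  shows "B (X i k a) (X k j (b * c)) = B (X i l (a * b)) (X l j c)"
proof -
  note P = Pset_range[OF p] Pset_distinct[OF p]
  have "B (X i k a) (X k j (b * c)) = B (X i k a) (X k l b \<bullet>\<^bsub>L\<^esub> X l j c)"
    using P by (simp add: X_br1)
  also have "\<dots> = B (X i l (a * b)) (X l j c)"
    using P by (subst B_cocycle) (simp_all add: X_br1 X_br0)
  finally show ?thesis .
qed

definition Y :: "nat \<Rightarrow> nat \<Rightarrow> 'r \<Rightarrow> 'c" where
  "Y i j a = (let m = SOME m. m \<in> {1..4} \<and> m \<noteq> i \<and> m \<noteq> j in B (X i m a) (X m j 1))"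

text \<open>Besides the first relation this shows that the middle index chosen in \<open>Y\<close>
  is immaterial and that only the product of the two coefficients counts.\<close>

lemma Y1:
  assumes "i \<in> {1..4}" "j \<in> {1..4}" "k \<in> {1..4}" "i \<noteq> j" "j \<noteq> k" "i \<noteq> k"
  shows "B (X i j a) (X j k b) = Y i k (a * b)"
proof -
  define m where "m = (SOME m. m \<in> {1..4} \<and> m \<noteq> i \<and> m \<noteq> k)"
  have "m \<in> {1..4} \<and> m \<noteq> i \<and> m \<noteq> k" unfolding m_def
    by (rule someI[of _ j]) (use assms in auto)
  then have m: "m \<in> {1..4}" "m \<noteq> i" "m \<noteq> k" by auto
  have Y: "Y i k (a * b) = B (X i m (a * b)) (X m k 1)" by (simp add: Y_def m_def Let_def)
  show ?thesis
  proof (cases "m = j")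
    case True
    \<comment> \<open>Even with the right middle index the coefficient \<open>b\<close> has to move
      into the first factor; passing to the fourth index and back achieves this.\<close>
    obtain l where p: "(i, k, j, l) \<in> Pset" using assms by (metis Pset_completion3)
    have "B (X i j a) (X j k b) = B (X i l (a * b)) (X l k 1)"
      using B_shift[OF p, of a b 1] by simp
    moreover have "B (X i j (a * b)) (X j k 1) = B (X i l (a * b)) (X l k 1)"
      using B_shift[OF p, of "a * b" 1 1] by simp
    ultimately show ?thesis using Y True by simp
  next
    case False
    have "(i, k, j, m) \<in> Pset" using assms m False by (intro PsetI) auto
    then show ?thesis using B_shift[of i k j m a b 1] Y by simp
  qed
qed

text \<open>Factoring the first argument through the fourth index \<open>l\<close> reduces this to
  \<open>Y1\<close>: \<open>X k i b\<close> then acts on \<open>X i l a\<close> but not on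
  \<open>X l j 1\<close>.\<close>

lemma Y2:
  assumes "i \<in> {1..4}" "j \<in> {1..4}" "k \<in> {1..4}" "i \<noteq> j" "j \<noteq> k" "i \<noteq> k"
  shows "B (X i j a) (X k i b) = (- 1) \<odot>\<^bsub>N\<^esub> Y k j (b * a)"
proof -
  obtain l where p: "(i, j, k, l) \<in> Pset" using assms by (metis Pset_completion3)
  note P = Pset_range[OF p] Pset_distinct[OF p]
  have "B (X i j a) (X k i b) = B (X i l a \<bullet>\<^bsub>L\<^esub> X l j 1) (X k i b)"
    using P by (simp add: X_br1)
  also have "\<dots> = (- 1) \<odot>\<^bsub>N\<^esub> B (X k l (b * a)) (X l j 1)"
    using P by (subst B_cocycle_left) (simp_all add: X_br0 X_br2 B_lin)
  also have "\<dots> = (- 1) \<odot>\<^bsub>N\<^esub> Y k j (b * a)" using P by (simp add: Y1)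
  finally show ?thesis .
qed

text \<open>Outside \<open>Pset\<close> a row or column index is repeated, so some \<open>m\<close>
  differs from all of i, j, k, l. Once \<open>X k l b\<close> is factored through \<open>m\<close>,
  both terms of the cocycle identity contain a vanishing bracket.\<close>

lemma Y0:
  assumes "i \<in> {1..4}" "j \<in> {1..4}" "k \<in> {1..4}" "l \<in> {1..4}"
    "i \<noteq> j" "k \<noteq> l" "j \<noteq> k" "i \<noteq> l" "(i, j, k, l) \<notin> Pset"
  shows "B (X i j a) (X k l b) = \<zero>\<^bsub>N\<^esub>"
proof -
  have eq: "i = k \<or> j = l" using PsetI[of i j k l] assms by auto
  obtain m where m: "m \<in> {1..4}" "m \<noteq> i" "m \<noteq> j" "m \<noteq> k" "m \<noteq> l"
  proof (cases "i = k \<and> j = l")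
    case True
    then show ?thesis using that third_index[of i j] by metis
  next
    case False
    then have "i = k \<and> j \<noteq> l \<or> i \<noteq> k \<and> j = l" using eq by auto
    then show ?thesis
    proof
      assume e: "i = k \<and> j \<noteq> l"
      obtain m where "(i, j, l, m) \<in> Pset" using assms e by (metis Pset_completion3)
      then show ?thesis using that[of m] Pset_range Pset_distinct e by metis
    next
      assume e: "i \<noteq> k \<and> j = l"
      obtain m where "(i, j, k, m) \<in> Pset" using assms e by (metis Pset_completion3)
      then show ?thesis using that[of m] Pset_range Pset_distinct e by metis
    qed
  qed
  have "B (X i j a) (X k l b) = B (X i j a) (X k m b \<bullet>\<^bsub>L\<^esub> X m l 1)"
    using m assms by (simp add: X_br1)
  also have "\<dots> = \<zero>\<^bsub>N\<^esub>"
    using m assms by (subst B_cocycle) (simp_all add: X_br0)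
  finally show ?thesis .
qed

section \<open>The obstruction on four distinct indices\<close>

definition h :: "nat \<Rightarrow> nat \<Rightarrow> nat \<Rightarrow> nat \<Rightarrow> 'r \<Rightarrow> 'c" where
  "h i j k l a = B (X i j a) (X k l 1)"

context
  fixes i j k l assumes p: "(i, j, k, l) \<in> Pset"
begin

lemmas P = Pset_range[OF p] Pset_distinct[OF p]

text \<open>With no fifth index available, one argument is factored through an index of the other:
  here \<open>X k l\<close> through \<open>i\<close>, then \<open>X k l\<close> through
  \<open>j\<close>, and finally \<open>X i j\<close> through \<open>k\<close>. Each choice exchanges
  rows or columns.\<close>

lemma h_rows: "B (X i j a) (X k l (b * c)) = (- 1) \<odot>\<^bsub>N\<^esub> B (X k j (b * a)) (X i l c)"
proof -
  have "B (X i j a) (X k l (b * c)) = B (X i j a) (X k i b \<bullet>\<^bsub>L\<^esub> X i l c)"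
    using P by (simp add: X_br1)
  also have "\<dots> = (- 1) \<odot>\<^bsub>N\<^esub> B (X k j (b * a)) (X i l c)"
    using P by (subst B_cocycle) (simp_all add: X_br0 X_br2 B_lin)
  finally show ?thesis .
qed

lemma h_columns: "B (X i j a) (X k l (b * c)) = (- 1) \<odot>\<^bsub>N\<^esub> B (X i l (a * c)) (X k j b)"
proof -
  have "B (X i j a) (X k l (b * c)) = B (X i j a) (X k j b \<bullet>\<^bsub>L\<^esub> X j l c)"
    using P by (simp add: X_br1)
  also have "\<dots> = (- 1) \<odot>\<^bsub>N\<^esub> B (X i l (a * c)) (X k j b)"
    using P by (subst B_cocycle) (simp_all add: X_br0 X_br1 N.sub_zero_left)
  finally show ?thesis .
qed

lemma h_columns_pos: "B (X i j a) (X k l b) = B (X i l (a * b)) (X k j 1)"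
proof -
  have "B (X i j a) (X k l b) = B (X i k a \<bullet>\<^bsub>L\<^esub> X k j 1) (X k l b)"
    using P by (simp add: X_br1)
  also have "\<dots> = B (X i l (a * b)) (X k j 1)"
    using P by (subst B_cocycle_left) (simp_all add: X_br0 X_br1)
  finally show ?thesis .
qed

end

lemma h_closed [simp, intro]: "(i, j, k, l) \<in> Pset \<Longrightarrow> h i j k l a \<in> lcarrier N"
  using Pset_range[of i j k l] Pset_distinct[of i j k l] by (simp add: h_def)

text \<open>The columns can be exchanged with a minus sign by factoring the second argument and
  without one by factoring the first. Comparing the two is the source of the 2 in
  \<open>R2I\<close>.\<close>

lemma h_neg:
  assumes p: "(i, j, k, l) \<in> Pset"
  shows "(- 1) \<odot>\<^bsub>N\<^esub> h i j k l a = h i j k l a"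
proof -
  have "h i j k l a = (- 1) \<odot>\<^bsub>N\<^esub> h i l k j a"
    using h_columns[OF p, of a 1 1] by (simp add: h_def)
  moreover have "h i j k l a = h i l k j a"
    using h_columns_pos[OF p, of a 1] by (simp add: h_def)
  ultimately show ?thesis by simp
qed

lemma h_swap_columns: "(i, j, k, l) \<in> Pset \<Longrightarrow> h i l k j a = h i j k l a"
  using h_columns_pos[of i j k l a 1] by (simp add: h_def)

lemma h_swap_rows:
  assumes p: "(i, j, k, l) \<in> Pset"
  shows "h k j i l a = h i j k l a"
  using h_rows[OF p, of a 1 1] h_neg[OF Pset_swap(1)[OF p]] by (simp add: h_def)

lemma B_eq_h:
  assumes p: "(i, j, k, l) \<in> Pset"
  shows "B (X i j a) (X k l b) = h i j k l (a * b)"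
  using h_columns_pos[OF p] h_swap_columns[OF p] by (simp add: h_def)

text \<open>The row exchange carries \<open>b\<close> from the second argument to the left of
  \<open>a\<close>, while \<open>h\<close> itself is unchanged by that exchange. This is the source
  of the commutators in \<open>R2I\<close>.\<close>

lemma h_mult_commute:
  assumes p: "(i, j, k, l) \<in> Pset"
  shows "h i j k l (a * (b * c)) = h i j k l (b * a * c)"
  using h_rows[OF p, of a b c] B_eq_h[OF p, of a "b * c"] B_eq_h[OF Pset_swap(1)[OF p], of "b * a" c]
    h_neg[OF Pset_swap(1)[OF p]] h_swap_rows[OF p] by simp

lemma h_add: "(i, j, k, l) \<in> Pset \<Longrightarrow> h i j k l (a + b) = h i j k l a \<oplus>\<^bsub>N\<^esub> h i j k l b"
  and h_smult: "(i, j, k, l) \<in> Pset \<Longrightarrow> h i j k l (sR c a) = c \<odot>\<^bsub>N\<^esub> h i j k l a"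
  using Pset_range[of i j k l] Pset_distinct[of i j k l]
  by (simp_all add: h_def X_add X_smult B_lin)

lemma h_zero: "(i, j, k, l) \<in> Pset \<Longrightarrow> h i j k l 0 = \<zero>\<^bsub>N\<^esub>"
  using Pset_range[of i j k l] Pset_distinct[of i j k l]
  by (simp add: h_def X_zero)

lemma h_diff: "(i, j, k, l) \<in> Pset \<Longrightarrow> h i j k l (a - b) = h i j k l a \<ominus>\<^bsub>N\<^esub> h i j k l b"
  using h_add[of i j k l a "- b"] h_smult[of i j k l "- 1" b] by (simp add: lsub_def sR_neg)

lemma h_I:
  assumes p: "(i, j, k, l) \<in> Pset" and a: "a \<in> I"
  shows "h i j k l a = \<zero>\<^bsub>N\<^esub>"
  using a unfolding R2I_def
proof induction
  case (rspan_gen s)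
  then consider r where "s = 2 * r" | r u v where "s = r * (u * v - v * u)" by auto
  then show ?case
  proof cases
    case 1
    have "h i j k l r \<oplus>\<^bsub>N\<^esub> h i j k l r = h i j k l r \<oplus>\<^bsub>N\<^esub> (- 1) \<odot>\<^bsub>N\<^esub> h i j k l r"
      by (simp only: h_neg[OF p])
    then show ?thesis using p unfolding 1 mult_2 by (simp add: h_add)
  next
    case 2
    \<comment> \<open>First \<open>v\<close> passes the block \<open>r * u\<close>, giving v r u;
      exchanging the first two factors then gives r v u.\<close>
    have "h i j k l (r * (u * v)) = h i j k l (r * (v * u))"
      using h_mult_commute[OF p, of r u v] h_mult_commute[OF p, of u r v]
        h_mult_commute[OF p, of r v u] h_mult_commute[OF p, of v r u]
        h_mult_commute[OF p, of "r * u" v 1] h_mult_commute[OF p, of "u * r" v 1]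
        h_mult_commute[OF p, of "u" "v * r" 1] h_mult_commute[OF p, of "v" "r * u" 1]
        h_mult_commute[OF p, of "u * v" r 1] h_mult_commute[OF p, of "v * u" r 1]
        h_mult_commute[OF p, of "v" "u" r]
      by (simp add: mult.assoc)
    then show ?thesis using p unfolding 2 by (simp add: h_diff right_diff_distrib)
  qed
next
  case (rspan_add x y)
  then show ?case using p by (simp add: h_add)
next
  case (rspan_smult x c)
  then show ?case using p by (simp add: h_smult)
qed (use p in \<open>simp add: h_zero\<close>)

definition hlabel :: "nat \<Rightarrow> 'r \<Rightarrow> 'c" where
  "hlabel m = (case SOME p. p \<in> Pset \<and> \<theta> p = m of (i, j, k, l) \<Rightarrow> h i j k l)"

lemma hlabel_eq:
  assumes p: "(i, j, k, l) \<in> Pset"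
  shows "hlabel (\<theta> (i, j, k, l)) a = h i j k l a"
proof -
  define q where "q = (SOME p. p \<in> Pset \<and> \<theta> p = \<theta> (i, j, k, l))"
  have "q \<in> Pset \<and> \<theta> q = \<theta> (i, j, k, l)" unfolding q_def
    by (rule someI[of _ "(i, j, k, l)"]) (use p in simp)
  then have "q \<in> {q \<in> Pset. \<theta> q = \<theta> (i, j, k, l)}" by simp
  then have q: "q \<in> {(i, j, k, l), (k, j, i, l), (i, l, k, j), (k, l, i, j)}"
    unfolding valid_label_class[OF valid_label p] .
  have "h k l i j a = h i l k j a" using h_swap_rows[OF Pset_swap(2)[OF p]] .
  with q show ?thesis
    using h_swap_rows[OF p] h_swap_columns[OF p] unfolding hlabel_def q_def[symmetric] by auto
qed

text \<open>The linear extension of the obstruction values to the six coordinates;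
  \<open>hlabel_I\<close> makes it independent of the representatives picked.\<close>

definition E :: "(nat \<Rightarrow> 'r set) \<Rightarrow> 'c" where
  "E w = (let e = (\<lambda>m. hlabel m (SOME a. a \<in> w m)) in
     e 1 \<oplus>\<^bsub>N\<^esub> (e 2 \<oplus>\<^bsub>N\<^esub> (e 3 \<oplus>\<^bsub>N\<^esub> (e 4 \<oplus>\<^bsub>N\<^esub> (e 5 \<oplus>\<^bsub>N\<^esub> e 6)))))"

lemma
  assumes "m \<in> {1..6}"
  shows hlabel_closed: "hlabel m a \<in> lcarrier N"
    and hlabel_zero: "hlabel m 0 = \<zero>\<^bsub>N\<^esub>"
    and hlabel_add: "hlabel m (a + b) = hlabel m a \<oplus>\<^bsub>N\<^esub> hlabel m b"
    and hlabel_smult: "hlabel m (sR c a) = c \<odot>\<^bsub>N\<^esub> hlabel m a"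
    and hlabel_I: "a - b \<in> I \<Longrightarrow> hlabel m a = hlabel m b"
    and d_hlabel: "d (hlabel m a) = \<zero>\<^bsub>L\<^esub>"
proof -
  obtain i j k l where p: "(i, j, k, l) \<in> Pset" and m: "\<theta> (i, j, k, l) = m"
    using valid_label_surj[OF valid_label assms] .
  show "hlabel m a \<in> lcarrier N" "hlabel m 0 = \<zero>\<^bsub>N\<^esub>"
    "hlabel m (a + b) = hlabel m a \<oplus>\<^bsub>N\<^esub> hlabel m b"
    "hlabel m (sR c a) = c \<odot>\<^bsub>N\<^esub> hlabel m a"
    unfolding m[symmetric] hlabel_eq[OF p] using p by (simp_all add: h_zero h_add h_smult)
  show "a - b \<in> I \<Longrightarrow> hlabel m a = hlabel m b"
    unfolding m[symmetric] hlabel_eq[OF p]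
    using h_I[OF p, of "a - b"] p by (simp add: h_diff N.sub_eq_zero_iff)
  show "d (hlabel m a) = \<zero>\<^bsub>L\<^esub>"
    unfolding m[symmetric] hlabel_eq[OF p] h_def using Pset_range[OF p] Pset_distinct[OF p]
    by (simp add: d_B X_br0)
qed

lemma E_Wcl: "E (Wcl f) = hlabel 1 (f 1) \<oplus>\<^bsub>N\<^esub> (hlabel 2 (f 2) \<oplus>\<^bsub>N\<^esub> (hlabel 3 (f 3) \<oplus>\<^bsub>N\<^esub>
    (hlabel 4 (f 4) \<oplus>\<^bsub>N\<^esub> (hlabel 5 (f 5) \<oplus>\<^bsub>N\<^esub> hlabel 6 (f 6)))))"
proof -
  have "hlabel m (SOME a. a \<in> Wcl f m) = hlabel m (f m)" if m: "m \<in> {1..6}" for m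
    using m by (intro hlabel_I) (simp_all add: Wcl_def some_R2cl)
  then show ?thesis by (simp add: E_def Let_def atLeastAtMost_iff)
qed

lemma six_labels: "1 \<in> {1..6::nat}" "2 \<in> {1..6::nat}" "3 \<in> {1..6::nat}" "4 \<in> {1..6::nat}"
    "5 \<in> {1..6::nat}" "6 \<in> {1..6::nat}"
  by (simp_all add: atLeastAtMost_iff)

lemma E_linear: "klinear W N E"
  by (rule klinearI)
    (auto simp: W_carrier W_add W_smult E_Wcl hlabel_closed hlabel_add hlabel_smult six_labels
      N.smult_add_right N.add_ac)

text \<open>The obstruction values lie over brackets of generators with four distinct indices, which
  are zero in \<open>L\<close>. Correcting \<open>B\<close> by \<open>E\<close> therefore does not
  disturb its image under \<open>d\<close>.\<close>

lemma d_E: "w \<in> lcarrier W \<Longrightarrow> d (E w) = \<zero>\<^bsub>L\<^esub>"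
  by (auto simp: W_carrier E_Wcl hlabel_closed d_hlabel six_labels klinear_add[OF d_linear])

lemma E_epsW:
  assumes p: "(i, j, k, l) \<in> Pset"
  shows "E (epsW sR (\<theta> (i, j, k, l)) a) = h i j k l a"
proof -
  define m where "m = \<theta> (i, j, k, l)"
  have m: "m \<in> {1..6}" unfolding m_def by (rule theta_range[OF p])
  then have "m = 1 \<or> m = 2 \<or> m = 3 \<or> m = 4 \<or> m = 5 \<or> m = 6" by (auto simp: atLeastAtMost_iff)
  then have "E (epsW sR m a) = hlabel m a"
    using m by (elim disjE) (simp_all add: epsW_eq E_Wcl hlabel_zero hlabel_closed six_labels)
  then show ?thesis unfolding m_def hlabel_eq[OF p] .
qed

lemma E_zero: "E \<zero>\<^bsub>W\<^esub> = \<zero>\<^bsub>N\<^esub>"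
  by (rule klinear_zero[OF E_linear W.kmodule N.kmodule])

text \<open>Subtracting the part of \<open>B\<close> that comes from \<open>\<psi>\<close> leaves a cocycle satisfying the defining
  relations of \<open>stl4\<close>, so that it splits.\<close>

definition B' where
  "B' x y = B x y \<ominus>\<^bsub>N\<^esub> E (\<Psi> x y)"

lemmas psi_closed [simp, intro] = kbilinear_closed[OF psi_bilinear]
lemmas E_closed [simp, intro] = klinear_closed[OF E_linear]

lemma B'_bilinear: "kbilinear L N B'"
  by (rule kbilinearI)
    (simp_all add: B'_def B_lin klinear_add[OF E_linear] klinear_smult[OF E_linear]
      kbilinear_add_left[OF psi_bilinear] kbilinear_add_right[OF psi_bilinear]
      kbilinear_smult_left[OF psi_bilinear] kbilinear_smult_right[OF psi_bilinear]
      N.sub_sub_swap N.smult_sub)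

lemma B'_cocycle:
  assumes "x \<in> lcarrier L" "y \<in> lcarrier L" "z \<in> lcarrier L"
  shows "B' x (y \<bullet>\<^bsub>L\<^esub> z) = B' (x \<bullet>\<^bsub>L\<^esub> y) z \<ominus>\<^bsub>N\<^esub> B' (x \<bullet>\<^bsub>L\<^esub> z) y"
  using assms by (simp add: B'_def B_cocycle psi_cocycle klinear_sub[OF E_linear W.kmodule]
      N.sub_sub_swap(1))

lemma d_B':
  assumes "x \<in> lcarrier L" "y \<in> lcarrier L"
  shows "d (B' x y) = x \<bullet>\<^bsub>L\<^esub> y"
  using assms by (simp add: B'_def klinear_sub[OF d_linear N.kmodule] d_E d_B)

text \<open>Because this bracket reads its arguments only through \<open>d\<close>, the Leibniz
  identity for it is the cocycle identity of \<open>B'\<close>, and \<open>d\<close> becomes a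
  homomorphism onto its image in \<open>L\<close>.\<close>

definition N' :: "('k, 'c) lalg" where
  "N' = N\<lparr>lbr := \<lambda>n m. B' (d n) (d m)\<rparr>"

lemma N'_simps [simp]:
  "lcarrier N' = lcarrier N" "ladd N' = ladd N" "lzero N' = lzero N" "lsmult N' = lsmult N"
  "lsub N' = lsub N" "lbr N' n m = B' (d n) (d m)"
  by (simp_all add: N'_def lsub_def fun_eq_iff)

lemmas d_closed [simp, intro] = klinear_closed[OF d_linear]
lemmas B'_closed [simp, intro] = kbilinear_closed[OF B'_bilinear]

lemma leibniz_N': "leibniz N'"
proof (rule leibnizI)
  show "kmodule N'" using N.kmodule unfolding kmodule_def N'_simps .
  show "kbilinear N' N' (lbr N')"
    by (rule kbilinearI)
      (simp_all add: klinear_add[OF d_linear] klinear_smult[OF d_linear]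
        kbilinear_add_left[OF B'_bilinear] kbilinear_add_right[OF B'_bilinear]
        kbilinear_smult_left[OF B'_bilinear] kbilinear_smult_right[OF B'_bilinear])
qed (simp add: d_B' B'_cocycle)

lemma Y_eq:
  assumes "i \<in> {1..4}" "j \<in> {1..4}" "i \<noteq> j"
  obtains m where "m \<in> {1..4}" "m \<noteq> i" "m \<noteq> j" "\<And>a. Y i j a = B (X i m a) (X m j 1)"
proof -
  obtain m where m: "m \<in> {1..4}" "m \<noteq> i" "m \<noteq> j" by (rule third_index)
  then have "Y i j a = B (X i m a) (X m j 1)" for a
    using Y1[of i m j a 1] assms by simp
  then show ?thesis using that m by blast
qed

lemma
  assumes "i \<in> {1..4}" "j \<in> {1..4}" "i \<noteq> j"
  shows Y_closed: "Y i j a \<in> lcarrier N"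
    and Y_linear: "Y i j (sR c a + b) = c \<odot>\<^bsub>N\<^esub> Y i j a \<oplus>\<^bsub>N\<^esub> Y i j b"
    and d_Y: "d (Y i j a) = X i j a"
proof -
  obtain m where "m \<in> {1..4}" "m \<noteq> i" "m \<noteq> j" "\<And>a. Y i j a = B (X i m a) (X m j 1)"
    using Y_eq assms by metis
  with assms show "Y i j a \<in> lcarrier N" "d (Y i j a) = X i j a"
    "Y i j (sR c a + b) = c \<odot>\<^bsub>N\<^esub> Y i j a \<oplus>\<^bsub>N\<^esub> Y i j b"
    by (simp_all add: d_B X_br1 X_linear B_lin)
qed

lemma B'_X:
  assumes "i \<in> {1..4}" "j \<in> {1..4}" "k \<in> {1..4}" "l \<in> {1..4}" "i \<noteq> j" "k \<noteq> l"
  shows "B' (X i j a) (X k l b) = (if (i, j, k, l) \<in> Pset then \<zero>\<^bsub>N\<^esub> else B (X i j a) (X k l b))"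
  using assms by (simp add: B'_def psi_X E_epsW B_eq_h E_zero)

text \<open>The elements \<open>Y\<close> satisfy the defining relations in \<open>N'\<close> and
  lie over the generators, so the homomorphism they define is a section of \<open>d\<close>.
  Multiplicativity then evaluates it on brackets, since \<open>d (\<phi> x) = x\<close>.\<close>

lemma ex_section:
  obtains \<phi> where "klinear L N \<phi>" "\<And>x. x \<in> lcarrier L \<Longrightarrow> d (\<phi> x) = x"
    "\<And>x y. x \<in> lcarrier L \<Longrightarrow> y \<in> lcarrier L \<Longrightarrow> \<phi> (x \<bullet>\<^bsub>L\<^esub> y) = B' x y"
proof -
  \<comment> \<open>On pairs with a repeated index \<open>B'\<close> agrees with \<open>B\<close>,
    so that the relations already obtained for \<open>B\<close> carry over.\<close>
  have P: "(i, j, i, l) \<notin> Pset" "(i, j, j, l) \<notin> Pset" "(i, j, k, i) \<notin> Pset" "(i, j, k, j) \<notin> Pset" for i j k l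
    using Pset_distinct by metis+
  obtain \<phi> where \<phi>: "lhom L N' \<phi>"
    and \<phi>X: "\<And>i j a. i \<in> {1..4} \<Longrightarrow> j \<in> {1..4} \<Longrightarrow> i \<noteq> j \<Longrightarrow> \<phi> (X i j a) = Y i j a"
  proof (rule stl4_lhom[OF leibniz_N', of Y])
    show "Y i j a \<bullet>\<^bsub>N'\<^esub> Y k l b = \<zero>\<^bsub>N'\<^esub>"
      if "i \<in> {1..4}" "j \<in> {1..4}" "k \<in> {1..4}" "l \<in> {1..4}" "i \<noteq> j" "k \<noteq> l" "j \<noteq> k" "i \<noteq> l"
      for i j k l a b
      using that Y0[of i j k l] by (simp add: d_Y B'_X)
  qed (simp_all add: Y_closed Y_linear d_Y B'_X Y1 Y2 P)
  have lin: "klinear L N \<phi>" using \<phi> by (simp add: lhom_def klinear_def)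
  have d: "d (\<phi> x) = x" if "x \<in> lcarrier L" for x
    using that
  proof (induction x rule: stl4_induct)
    case zero
    then show ?case
      using klinear_zero[OF lin L.kmodule N.kmodule] klinear_zero[OF d_linear N.kmodule L.kmodule] by simp
  next
    case (lbr x y)
    then show ?case using lhom_lbr[OF \<phi>] by (simp add: d_B')
  qed (simp_all add: \<phi>X d_Y klinear_add[OF lin] klinear_add[OF d_linear] klinear_closed[OF lin]
      klinear_smult[OF lin] klinear_smult[OF d_linear])
  moreover have "\<phi> (x \<bullet>\<^bsub>L\<^esub> y) = B' x y" if "x \<in> lcarrier L" "y \<in> lcarrier L" for x y
    using lhom_lbr[OF \<phi>] that d by simp
  ultimately show ?thesis using that lin by blast
qed

text \<open>As \<open>N\<close> has no bracket of its own, the value on brackets takes the place of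
  multiplicativity. It amounts to a homomorphism when \<open>B\<close> is the bracket of lifts, and
  to a retraction when \<open>B\<close> is the universal cocycle.\<close>

lemma ex_lift:
  obtains \<eta> where "klinear (stlhat sR \<theta>) N \<eta>"
    "\<And>c x. c \<in> lcarrier W \<Longrightarrow> x \<in> lcarrier L \<Longrightarrow> d (\<eta> (c, x)) = x"
    "\<And>x y. x \<in> lcarrier L \<Longrightarrow> y \<in> lcarrier L \<Longrightarrow> \<eta> (\<Psi> x y, x \<bullet>\<^bsub>L\<^esub> y) = B x y"
proof -
  obtain \<phi> where lin: "klinear L N \<phi>" and d: "\<And>x. x \<in> lcarrier L \<Longrightarrow> d (\<phi> x) = x"
    and \<phi>: "\<And>x y. x \<in> lcarrier L \<Longrightarrow> y \<in> lcarrier L \<Longrightarrow> \<phi> (x \<bullet>\<^bsub>L\<^esub> y) = B' x y"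
    using ex_section by blast
  let ?\<eta> = "\<lambda>(c, x). E c \<oplus>\<^bsub>N\<^esub> \<phi> x"
  note cl = klinear_closed[OF lin]
  have "klinear (stlhat sR \<theta>) N ?\<eta>"
    by (rule klinearI)
      (auto simp: stlhat_def cl klinear_add[OF lin] klinear_add[OF E_linear] klinear_smult[OF lin]
        klinear_smult[OF E_linear] N.smult_add_right N.add_ac)
  moreover have "d (?\<eta> (c, x)) = x" if "c \<in> lcarrier W" "x \<in> lcarrier L" for c x
    using that by (simp add: cl klinear_add[OF d_linear] d d_E)
  moreover have "?\<eta> (\<Psi> x y, x \<bullet>\<^bsub>L\<^esub> y) = B x y" if "x \<in> lcarrier L" "y \<in> lcarrier L" for x y
    using that by (simp add: \<phi> B'_def N.add_sub_cancel)
  ultimately show ?thesis using that by blast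
qed

end

section \<open>The universal central extension\<close>

context labelled_steinberg
begin

abbreviation "Lhat \<equiv> stlhat sR \<theta>"

lemma Lhat_simps [simp]:
  "(c, x) \<in> lcarrier Lhat \<longleftrightarrow> c \<in> lcarrier W \<and> x \<in> lcarrier L"
  "lzero Lhat = (\<zero>\<^bsub>W\<^esub>, \<zero>\<^bsub>L\<^esub>)"
  "(c, x) \<oplus>\<^bsub>Lhat\<^esub> (c', y) = (c \<oplus>\<^bsub>W\<^esub> c', x \<oplus>\<^bsub>L\<^esub> y)"
  "k \<odot>\<^bsub>Lhat\<^esub> (c, x) = (k \<odot>\<^bsub>W\<^esub> c, k \<odot>\<^bsub>L\<^esub> x)"
  "(c, x) \<ominus>\<^bsub>Lhat\<^esub> (c', y) = (c \<ominus>\<^bsub>W\<^esub> c', x \<ominus>\<^bsub>L\<^esub> y)"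
  "(c, x) \<bullet>\<^bsub>Lhat\<^esub> (c', y) = (\<Psi> x y, x \<bullet>\<^bsub>L\<^esub> y)"
  by (simp_all add: stlhat_def lsub_def)

lemma Lhat_carrier: "lcarrier Lhat = lcarrier W \<times> lcarrier L"
  by (simp add: stlhat_def)

lemma kmodule_Lhat: "kmodule Lhat"
  unfolding kmodule_def Lhat_carrier
  by (auto simp: W.smult_assoc L.smult_assoc W.smult_add_left L.smult_add_left
      W.smult_add_right L.smult_add_right W.add_assoc L.add_assoc W.add_comm L.add_comm
      W.add_left_comm L.add_left_comm)

lemma leibniz_Lhat: "leibniz Lhat"
proof (rule leibnizI[OF kmodule_Lhat])
  show "kbilinear Lhat Lhat (lbr Lhat)"
    by (rule kbilinearI)
      (auto simp: Lhat_carrier L_bilinear kbilinear_closed[OF psi_bilinear]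
        kbilinear_add_left[OF psi_bilinear] kbilinear_add_right[OF psi_bilinear]
        kbilinear_smult_left[OF psi_bilinear] kbilinear_smult_right[OF psi_bilinear])
qed (auto simp: Lhat_carrier psi_cocycle L_leibniz)

lemma psi_zero:
  assumes "x \<in> lcarrier L"
  shows "\<Psi> \<zero>\<^bsub>L\<^esub> x = \<zero>\<^bsub>W\<^esub>" "\<Psi> x \<zero>\<^bsub>L\<^esub> = \<zero>\<^bsub>W\<^esub>"
  using klinear_zero[OF kbilinear_left[OF psi_bilinear assms] L.kmodule W.kmodule]
    klinear_zero[OF kbilinear_right[OF psi_bilinear assms] L.kmodule W.kmodule] by auto

lemma central_ext_Lhat: "central_ext Lhat L snd"
  unfolding central_ext_def
proof (intro conjI)
  show "lhom Lhat L snd"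
    by (intro lhomI klinearI) (auto simp: Lhat_carrier)
  show "snd ` lcarrier Lhat = lcarrier L"
    using W.zero_closed by (auto simp: Lhat_carrier)
  show "\<forall>z\<in>lcarrier Lhat. snd z = lzero L \<longrightarrow>
      (\<forall>x\<in>lcarrier Lhat. z \<bullet>\<^bsub>Lhat\<^esub> x = lzero Lhat \<and> x \<bullet>\<^bsub>Lhat\<^esub> z = lzero Lhat)"
    by (auto simp: Lhat_carrier psi_zero)
  have "klinear L Lhat (\<lambda>x. (\<zero>\<^bsub>W\<^esub>, x))" by (rule klinearI) auto
  then show "\<exists>s. klinear L Lhat s \<and> (\<forall>x\<in>lcarrier L. snd (s x) = x)" by (intro exI conjI) auto
qed (rule leibniz_Lhat leibniz_stl4)+

lemma Wcl_eq_sum_epsW: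
  "Wcl f = epsW sR 1 (f 1) \<oplus>\<^bsub>W\<^esub> (epsW sR 2 (f 2) \<oplus>\<^bsub>W\<^esub> (epsW sR 3 (f 3) \<oplus>\<^bsub>W\<^esub>
    (epsW sR 4 (f 4) \<oplus>\<^bsub>W\<^esub> (epsW sR 5 (f 5) \<oplus>\<^bsub>W\<^esub> epsW sR 6 (f 6)))))"
proof -
  have "f m - ((if m = 1 then f 1 else 0) + ((if m = 2 then f 2 else 0) + ((if m = 3 then f 3 else 0) +
    ((if m = 4 then f 4 else 0) + ((if m = 5 then f 5 else 0) + (if m = 6 then f 6 else 0)))))) = 0"
    if "m \<in> {1..6}" for m
  proof -
    have "m = 1 \<or> m = 2 \<or> m = 3 \<or> m = 4 \<or> m = 5 \<or> m = 6" using that by auto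
    then show ?thesis by (elim disjE) simp_all
  qed
  then have "Wcl f = Wcl (\<lambda>m. (if m = 1 then f 1 else 0) + ((if m = 2 then f 2 else 0) +
    ((if m = 3 then f 3 else 0) + ((if m = 4 then f 4 else 0) + ((if m = 5 then f 5 else 0) +
    (if m = 6 then f 6 else 0))))))"
    unfolding Wcl_eq_iff by (intro ballI) (simp only: I_zero)
  then show ?thesis by (simp add: epsW_eq W_add del: One_nat_def)
qed

definition brackets where
  "brackets = {u \<bullet>\<^bsub>Lhat\<^esub> v | u v. u \<in> lcarrier Lhat \<and> v \<in> lcarrier Lhat}"

lemma brackets_carrier: "brackets \<subseteq> lcarrier Lhat"
  by (auto simp: brackets_def Lhat_carrier kbilinear_closed[OF psi_bilinear])

lemma bracketI:
  assumes "x \<in> lcarrier L" "y \<in> lcarrier L"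
  shows "(\<Psi> x y, x \<bullet>\<^bsub>L\<^esub> y) \<in> lspan Lhat brackets"
proof (rule span_gen)
  have "(\<Psi> x y, x \<bullet>\<^bsub>L\<^esub> y) = (\<zero>\<^bsub>W\<^esub>, x) \<bullet>\<^bsub>Lhat\<^esub> (\<zero>\<^bsub>W\<^esub>, y)" by simp
  moreover have "(\<zero>\<^bsub>W\<^esub>, x) \<in> lcarrier Lhat" "(\<zero>\<^bsub>W\<^esub>, y) \<in> lcarrier Lhat" using assms by simp_all
  ultimately show "(\<Psi> x y, x \<bullet>\<^bsub>L\<^esub> y) \<in> brackets" unfolding brackets_def by blast
qed

text \<open>Generators with four distinct indices have zero bracket in \<open>L\<close>, so their
  bracket in \<open>Lhat\<close> is purely central, and it runs through all coordinate vectors of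
  \<open>W\<close>.\<close>

lemma epsW_in_brackets:
  assumes "m \<in> {1..6}"
  shows "(epsW sR m a, \<zero>\<^bsub>L\<^esub>) \<in> lspan Lhat brackets"
proof -
  obtain i j k l where p: "(i, j, k, l) \<in> Pset" and m: "\<theta> (i, j, k, l) = m"
    using valid_label_surj[OF valid_label assms] .
  note P = Pset_range[OF p] Pset_distinct[OF p]
  have "(\<Psi> (X i j a) (X k l 1), X i j a \<bullet>\<^bsub>L\<^esub> X k l 1) \<in> lspan Lhat brackets"
    using P by (intro bracketI X_closed)
  then show ?thesis using P p m psi_X[of i j k l a 1] X_br0[of i j k l a 1] by simp
qed

text \<open>Each element of \<open>gens\<close> is a bracket of two generators with a common index.
  There \<psi> vanishes, so the same bracket in \<open>Lhat\<close> has no component in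
  \<open>W\<close>.\<close>

lemma stl4_in_brackets:
  assumes "x \<in> lcarrier L"
  shows "(\<zero>\<^bsub>W\<^esub>, x) \<in> lspan Lhat brackets"
  using stl4_span[OF assms]
proof induction
  case (span_gen g)
  then show ?case
  proof (cases rule: gens_cases)
    case (X i j a)
    obtain m where m: "m \<in> {1..4}" "m \<noteq> i" "m \<noteq> j" by (rule third_index)
    have "(i, m, m, j) \<notin> Pset" using Pset_distinct by metis
    then have "(\<zero>\<^bsub>W\<^esub>, g) = (\<Psi> (X i m a) (X m j 1), X i m a \<bullet>\<^bsub>L\<^esub> X m j 1)"
      using X m psi_X[of i m m j a 1] X_br1[of i m j a 1] by simp
    also have "\<dots> \<in> lspan Lhat brackets" using X m by (intro bracketI X_closed) auto
    finally show ?thesis .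
  next
    case (H i j a b)
    have "(i, j, j, i) \<notin> Pset" using Pset_distinct by metis
    then have "(\<zero>\<^bsub>W\<^esub>, g) = (\<Psi> (X i j a) (X j i b), X i j a \<bullet>\<^bsub>L\<^esub> X j i b)"
      using H psi_X[of i j j i a b] by simp
    also have "\<dots> \<in> lspan Lhat brackets" using H by (intro bracketI X_closed) auto
    finally show ?thesis .
  qed
next
  case span_zero
  then show ?case using lspan.span_zero[of Lhat brackets] by simp
next
  case (span_add x y)
  from lspan.span_add[OF span_add.IH] show ?case by simp
next
  case (span_smult x c)
  from lspan.span_smult[OF span_smult.IH, of c] show ?case by simp
qed

lemma Lhat_perfect:
  assumes "u \<in> lcarrier Lhat"
  shows "u \<in> lspan Lhat brackets"
proof -
  obtain f x where u: "u = (Wcl f, x)" and x: "x \<in> lcarrier L"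
    using assms by (auto simp: Lhat_carrier W_carrier)
  have six: "1 \<in> {1..6::nat}" "2 \<in> {1..6::nat}" "3 \<in> {1..6::nat}" "4 \<in> {1..6::nat}"
    "5 \<in> {1..6::nat}" "6 \<in> {1..6::nat}" by simp_all
  have add: "(c, \<zero>\<^bsub>L\<^esub>) \<oplus>\<^bsub>Lhat\<^esub> (c', y) = (c \<oplus>\<^bsub>W\<^esub> c', y)" if "y \<in> lcarrier L" for c c' y
    using that by simp
  have "u = (Wcl f, \<zero>\<^bsub>L\<^esub>) \<oplus>\<^bsub>Lhat\<^esub> (\<zero>\<^bsub>W\<^esub>, x)" using u x by simp
  also have "(Wcl f, \<zero>\<^bsub>L\<^esub>) = (epsW sR 1 (f 1), \<zero>\<^bsub>L\<^esub>) \<oplus>\<^bsub>Lhat\<^esub> ((epsW sR 2 (f 2), \<zero>\<^bsub>L\<^esub>) \<oplus>\<^bsub>Lhat\<^esub>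
      ((epsW sR 3 (f 3), \<zero>\<^bsub>L\<^esub>) \<oplus>\<^bsub>Lhat\<^esub> ((epsW sR 4 (f 4), \<zero>\<^bsub>L\<^esub>) \<oplus>\<^bsub>Lhat\<^esub>
      ((epsW sR 5 (f 5), \<zero>\<^bsub>L\<^esub>) \<oplus>\<^bsub>Lhat\<^esub> (epsW sR 6 (f 6), \<zero>\<^bsub>L\<^esub>)))))"
    by (simp only: add[OF L.zero_closed] Wcl_eq_sum_epsW[of f])
  finally show ?thesis
    by (simp only: lspan.span_add epsW_in_brackets stl4_in_brackets x six)
qed

text \<open>Elements with the same image differ by a central element. So the bracket depends on
  images alone, which makes \<open>B\<close> independent of the lifts and forces uniqueness of
  homomorphisms.\<close>

lemma central_ext_lbr_cong:
  assumes ext: "central_ext Lt L t"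
    and "u \<in> lcarrier Lt" "u' \<in> lcarrier Lt" "v \<in> lcarrier Lt" "v' \<in> lcarrier Lt"
    and "t u = t u'" "t v = t v'"
  shows "u \<bullet>\<^bsub>Lt\<^esub> v = u' \<bullet>\<^bsub>Lt\<^esub> v'"
proof -
  have leib: "leibniz Lt" and lin: "klinear Lt L t"
    and ker: "\<And>z x. z \<in> lcarrier Lt \<Longrightarrow> t z = \<zero>\<^bsub>L\<^esub> \<Longrightarrow> x \<in> lcarrier Lt \<Longrightarrow>
      z \<bullet>\<^bsub>Lt\<^esub> x = \<zero>\<^bsub>Lt\<^esub> \<and> x \<bullet>\<^bsub>Lt\<^esub> z = \<zero>\<^bsub>Lt\<^esub>"
    using ext by (simp_all add: central_ext_def lhom_def)
  interpret T: kmod Lt using leibniz_kmodule[OF leib] by (rule kmod.intro)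
  note bil = leibniz_kbilinear[OF leib]
  have z: "t (u \<ominus>\<^bsub>Lt\<^esub> u') = \<zero>\<^bsub>L\<^esub>" if "u \<in> lcarrier Lt" "u' \<in> lcarrier Lt" "t u = t u'" for u u'
    using that klinear_sub[OF lin T.kmodule that(1,2)] klinear_closed[OF lin] by simp
  have "u \<bullet>\<^bsub>Lt\<^esub> v \<ominus>\<^bsub>Lt\<^esub> u' \<bullet>\<^bsub>Lt\<^esub> v = (u \<ominus>\<^bsub>Lt\<^esub> u') \<bullet>\<^bsub>Lt\<^esub> v"
    using klinear_sub[OF kbilinear_left[OF bil] T.kmodule] assms by simp
  also have "\<dots> = \<zero>\<^bsub>Lt\<^esub>" using ker z assms by blast
  finally have 1: "u \<bullet>\<^bsub>Lt\<^esub> v = u' \<bullet>\<^bsub>Lt\<^esub> v"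
    using assms kbilinear_closed[OF bil] by (simp add: T.sub_eq_zero_iff)
  have "u' \<bullet>\<^bsub>Lt\<^esub> v \<ominus>\<^bsub>Lt\<^esub> u' \<bullet>\<^bsub>Lt\<^esub> v' = u' \<bullet>\<^bsub>Lt\<^esub> (v \<ominus>\<^bsub>Lt\<^esub> v')"
    using klinear_sub[OF kbilinear_right[OF bil] T.kmodule] assms by simp
  also have "\<dots> = \<zero>\<^bsub>Lt\<^esub>" using ker z assms by blast
  finally show ?thesis
    using 1 assms kbilinear_closed[OF bil] by (simp add: T.sub_eq_zero_iff)
qed

lemma ex_hom_from_Lhat:
  assumes ext: "central_ext Lt L t"
  shows "\<exists>e. lhom Lhat Lt e \<and> (\<forall>x\<in>lcarrier Lhat. t (e x) = snd x)"
proof -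
  have leib: "leibniz Lt" and hom: "lhom Lt L t" and surj: "t ` lcarrier Lt = lcarrier L"
    using ext by (simp_all add: central_ext_def)
  note lin = lhom_klinear[OF hom]
  interpret T: kmod Lt using leibniz_kmodule[OF leib] by (rule kmod.intro)
  note bil = leibniz_kbilinear[OF leib]
  note cong = central_ext_lbr_cong[OF ext]
  note closed = kbilinear_closed[OF bil]
  \<comment> \<open>The lifts are chosen point by point; bilinearity of \<open>B\<close> comes from
    the bracket depending on images alone.\<close>
  define s where "s u = (SOME y. y \<in> lcarrier Lt \<and> t y = u)" for u
  have s: "s u \<in> lcarrier Lt \<and> t (s u) = u" if "u \<in> lcarrier L" for u
  proof -
    have "u \<in> t ` lcarrier Lt" using that surj by simp
    then obtain y where "y \<in> lcarrier Lt \<and> t y = u" by auto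
    then show ?thesis unfolding s_def by (rule someI)
  qed
  then have s1: "\<And>u. u \<in> lcarrier L \<Longrightarrow> s u \<in> lcarrier Lt" and s2: "\<And>u. u \<in> lcarrier L \<Longrightarrow> t (s u) = u"
    by blast+
  define B where "B u v = s u \<bullet>\<^bsub>Lt\<^esub> s v" for u v
  have B: "u \<bullet>\<^bsub>Lt\<^esub> v = B (t u) (t v)" if "u \<in> lcarrier Lt" "v \<in> lcarrier Lt" for u v
    unfolding B_def using that s1 s2 klinear_closed[OF lin] by (intro cong) auto
  have B1: "B (t u) y = u \<bullet>\<^bsub>Lt\<^esub> s y" "B y (t u) = s y \<bullet>\<^bsub>Lt\<^esub> u" if "u \<in> lcarrier Lt" "y \<in> lcarrier L" for u y
    using B[of u "s y"] B[of "s y" u] that s1 s2 by simp_all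
  \<comment> \<open>Sums, brackets and multiples of lifts lift the corresponding elements. Rewriting
    the arguments of \<open>B\<close> as images under \<open>t\<close> lets \<open>B1\<close> trade
    the chosen lift for these.\<close>
  have tadd: "x \<oplus>\<^bsub>L\<^esub> y = t (s x \<oplus>\<^bsub>Lt\<^esub> s y)" and tbr: "x \<bullet>\<^bsub>L\<^esub> y = t (s x \<bullet>\<^bsub>Lt\<^esub> s y)"
    if "x \<in> lcarrier L" "y \<in> lcarrier L" for x y
    using that s1 s2 by (simp_all add: klinear_add[OF lin] lhom_lbr[OF hom])
  have tsm: "c \<odot>\<^bsub>L\<^esub> x = t (c \<odot>\<^bsub>Lt\<^esub> s x)" if "x \<in> lcarrier L" for c x
    using that s1 s2 by (simp add: klinear_smult[OF lin])
  interpret C: stl4_cocycle sR \<theta> Lt B t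
  proof
    show "kbilinear L Lt B"
    proof (rule kbilinearI)
      show "B x y \<in> lcarrier Lt" if "x \<in> lcarrier L" "y \<in> lcarrier L" for x y
        using that s1 by (simp add: B_def closed)
      fix x y z assume xyz: "x \<in> lcarrier L" "y \<in> lcarrier L" "z \<in> lcarrier L"
      show "B (x \<oplus>\<^bsub>L\<^esub> y) z = B x z \<oplus>\<^bsub>Lt\<^esub> B y z" "B z (x \<oplus>\<^bsub>L\<^esub> y) = B z x \<oplus>\<^bsub>Lt\<^esub> B z y"
        unfolding tadd[OF xyz(1,2)] using xyz s1
        by (simp_all add: B1 kbilinear_add_left[OF bil] kbilinear_add_right[OF bil]) (simp_all add: B_def)
    next
      fix c x y assume xy: "x \<in> lcarrier L" "y \<in> lcarrier L"
      show "B (c \<odot>\<^bsub>L\<^esub> x) y = c \<odot>\<^bsub>Lt\<^esub> B x y" "B x (c \<odot>\<^bsub>L\<^esub> y) = c \<odot>\<^bsub>Lt\<^esub> B x y"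
        unfolding tsm[OF xy(1)] tsm[OF xy(2)] using xy s1
        by (simp_all add: B1 kbilinear_smult_left[OF bil] kbilinear_smult_right[OF bil]) (simp_all add: B_def)
    qed
    show "klinear Lt L t" by (rule lin)
    show "t (B x y) = x \<bullet>\<^bsub>L\<^esub> y" if "x \<in> lcarrier L" "y \<in> lcarrier L" for x y
      using tbr[OF that] by (simp add: B_def)
    show "B x (y \<bullet>\<^bsub>L\<^esub> z) = B (x \<bullet>\<^bsub>L\<^esub> y) z \<ominus>\<^bsub>Lt\<^esub> B (x \<bullet>\<^bsub>L\<^esub> z) y"
      if xyz: "x \<in> lcarrier L" "y \<in> lcarrier L" "z \<in> lcarrier L" for x y z
      unfolding tbr[OF xyz(2,3)] tbr[OF xyz(1,2)] tbr[OF xyz(1,3)] using xyz s1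
      by (simp add: B1 closed leibniz_identity[OF leib])
  qed
  obtain \<eta> where \<eta>: "klinear Lhat Lt \<eta>"
    "\<And>c x. c \<in> lcarrier W \<Longrightarrow> x \<in> lcarrier L \<Longrightarrow> t (\<eta> (c, x)) = x"
    "\<And>x y. x \<in> lcarrier L \<Longrightarrow> y \<in> lcarrier L \<Longrightarrow> \<eta> (\<Psi> x y, x \<bullet>\<^bsub>L\<^esub> y) = B x y"
    using C.ex_lift by blast
  have "lhom Lhat Lt \<eta>"
    using \<eta>(1)
  proof (rule lhomI)
    fix u v assume uv: "u \<in> lcarrier Lhat" "v \<in> lcarrier Lhat"
    then have "\<eta> u \<bullet>\<^bsub>Lt\<^esub> \<eta> v = B (snd u) (snd v)"
      using B[of "\<eta> u" "\<eta> v"] klinear_closed[OF \<eta>(1)] \<eta>(2) by (auto simp: Lhat_carrier)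
    also have "\<dots> = \<eta> (u \<bullet>\<^bsub>Lhat\<^esub> v)"
      using uv \<eta>(3) by (auto simp: Lhat_carrier)
    finally show "\<eta> (u \<bullet>\<^bsub>Lhat\<^esub> v) = \<eta> u \<bullet>\<^bsub>Lt\<^esub> \<eta> v" by simp
  qed
  then show ?thesis using \<eta>(2) by (intro exI conjI) (auto simp: Lhat_carrier)
qed

text \<open>The values of the two homomorphisms at a point differ by a central element, so the
  homomorphisms agree on brackets, and brackets span \<open>Lhat\<close>.\<close>

lemma hom_from_Lhat_unique:
  assumes ext: "central_ext Lt L t"
    and e1: "lhom Lhat Lt e1" "\<forall>x\<in>lcarrier Lhat. t (e1 x) = snd x"
    and e2: "lhom Lhat Lt e2" "\<forall>x\<in>lcarrier Lhat. t (e2 x) = snd x"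
    and u: "u \<in> lcarrier Lhat"
  shows "e1 u = e2 u"
proof (rule klinear_eq_on_lspan[OF _ _ kmodule_Lhat _ brackets_carrier _ Lhat_perfect[OF u]])
  show "klinear Lhat Lt e1" "klinear Lhat Lt e2" by (rule lhom_klinear[OF e1(1)], rule lhom_klinear[OF e2(1)])
  show "kmodule Lt" using ext by (simp add: central_ext_def leibniz_kmodule)
  fix w assume "w \<in> brackets"
  then obtain u v where w: "w = u \<bullet>\<^bsub>Lhat\<^esub> v" and uv: "u \<in> lcarrier Lhat" "v \<in> lcarrier Lhat"
    by (auto simp: brackets_def)
  have "e1 u \<bullet>\<^bsub>Lt\<^esub> e1 v = e2 u \<bullet>\<^bsub>Lt\<^esub> e2 v"
    using uv e1(2) e2(2) klinear_closed[OF lhom_klinear[OF e1(1)]] klinear_closed[OF lhom_klinear[OF e2(1)]]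
    by (intro central_ext_lbr_cong[OF ext]) auto
  then show "e1 w = e2 w" using uv w lhom_lbr[OF e1(1)] lhom_lbr[OF e2(1)] by simp
qed

lemma universal_central_ext_Lhat: "universal_central_ext TYPE('c) Lhat L snd"
  unfolding universal_central_ext_def
proof (intro conjI allI impI)
  show "central_ext Lhat L snd" by (rule central_ext_Lhat)
  fix Lt :: "('k, 'c) lalg" and t assume ext: "central_ext Lt L t"
  show "\<exists>e. lhom Lhat Lt e \<and> (\<forall>x\<in>lcarrier Lhat. t (e x) = snd x)"
    by (rule ex_hom_from_Lhat[OF ext])
  fix e1 e2
  assume "lhom Lhat Lt e1 \<and> (\<forall>x\<in>lcarrier Lhat. t (e1 x) = snd x) \<and>
    lhom Lhat Lt e2 \<and> (\<forall>x\<in>lcarrier Lhat. t (e2 x) = snd x)"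
  then show "\<forall>x\<in>lcarrier Lhat. e1 x = e2 x"
    using hom_from_Lhat_unique[OF ext] by (elim conjE) (intro ballI)
qed

end

section \<open>Tensor powers and the second homology\<close>

definition tens_index :: "('k::comm_ring_1, 'a) lalg \<Rightarrow> nat \<Rightarrow> 'a list set" where
  "tens_index M n = {xs. length xs = n \<and> set xs \<subseteq> lcarrier M}"

lemma free_on_ftens: "free_on (tens_index M n) (ftens M n)"
  unfolding free_on_def ftens_def fsupp_def tens_index_def by auto

lemma fvec_eq_delta: "fvec xs = delta xs"
  by (simp add: fvec_def delta_def)

definition multilinear ::
  "('k::comm_ring_1, 'a) lalg \<Rightarrow> ('k, 'b) lalg \<Rightarrow> nat \<Rightarrow> ('a list \<Rightarrow> 'b) \<Rightarrow> bool" where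
  "multilinear M N n g \<longleftrightarrow> (\<forall>xs\<in>tens_index M n. g xs \<in> lcarrier N) \<and>
     (\<forall>xs\<in>tens_index M n. \<forall>p<n. \<forall>x\<in>lcarrier M. \<forall>y\<in>lcarrier M.
        g (xs[p := x \<oplus>\<^bsub>M\<^esub> y]) = g (xs[p := x]) \<oplus>\<^bsub>N\<^esub> g (xs[p := y])) \<and>
     (\<forall>xs\<in>tens_index M n. \<forall>p<n. \<forall>c. \<forall>x\<in>lcarrier M.
        g (xs[p := c \<odot>\<^bsub>M\<^esub> x]) = c \<odot>\<^bsub>N\<^esub> g (xs[p := x]))"

lemma tens_index_update:
  "xs \<in> tens_index M n \<Longrightarrow> x \<in> lcarrier M \<Longrightarrow> xs[p := x] \<in> tens_index M n"
  unfolding tens_index_def using set_update_subset_insert[of xs p x] by auto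

text \<open>The relations are rewritten with the module operations of \<open>ftens M n\<close>, the
  form to which a linear map can be applied.\<close>

lemma mlrel_cases:
  assumes "f \<in> mlrel M n"
  obtains (add) xs p x y where "xs \<in> tens_index M n" "p < n" "x \<in> lcarrier M" "y \<in> lcarrier M"
    "f = (fvec (xs[p := x \<oplus>\<^bsub>M\<^esub> y]) \<ominus>\<^bsub>ftens M n\<^esub> fvec (xs[p := x])) \<ominus>\<^bsub>ftens M n\<^esub> fvec (xs[p := y])"
  | (smult) xs p c x where "xs \<in> tens_index M n" "p < n" "x \<in> lcarrier M"
    "f = fvec (xs[p := c \<odot>\<^bsub>M\<^esub> x]) \<ominus>\<^bsub>ftens M n\<^esub> c \<odot>\<^bsub>ftens M n\<^esub> fvec (xs[p := x])"
proof -
  have f: "f \<in> {(\<lambda>ys. fvec (xs[p := ladd M x y]) ys - fvec (xs[p := x]) ys - fvec (xs[p := y]) ys)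
       | xs p x y. length xs = n \<and> p < n \<and> set xs \<subseteq> lcarrier M \<and> x \<in> lcarrier M \<and> y \<in> lcarrier M} \<or>
    f \<in> {(\<lambda>ys. fvec (xs[p := lsmult M c x]) ys - c * fvec (xs[p := x]) ys)
       | xs p c x. length xs = n \<and> p < n \<and> set xs \<subseteq> lcarrier M \<and> x \<in> lcarrier M}"
    using assms unfolding mlrel_def by (rule UnE) simp_all
  show ?thesis
    using f
  proof
    assume "f \<in> {(\<lambda>ys. fvec (xs[p := ladd M x y]) ys - fvec (xs[p := x]) ys - fvec (xs[p := y]) ys)
       | xs p x y. length xs = n \<and> p < n \<and> set xs \<subseteq> lcarrier M \<and> x \<in> lcarrier M \<and> y \<in> lcarrier M}"
    then obtain xs p x y where "length xs = n" "p < n" "set xs \<subseteq> lcarrier M" "x \<in> lcarrier M" "y \<in> lcarrier M"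
      "f = (\<lambda>ys. fvec (xs[p := ladd M x y]) ys - fvec (xs[p := x]) ys - fvec (xs[p := y]) ys)"
      by (elim CollectE exE conjE)
    then show ?thesis
      by (intro add[of xs p x y]) (simp_all add: tens_index_def ftens_def lsub_def)
  next
    assume "f \<in> {(\<lambda>ys. fvec (xs[p := lsmult M c x]) ys - c * fvec (xs[p := x]) ys)
       | xs p c x. length xs = n \<and> p < n \<and> set xs \<subseteq> lcarrier M \<and> x \<in> lcarrier M}"
    then obtain xs p c x where "length xs = n" "p < n" "set xs \<subseteq> lcarrier M" "x \<in> lcarrier M"
      "f = (\<lambda>ys. fvec (xs[p := lsmult M c x]) ys - c * fvec (xs[p := x]) ys)"
      by (elim CollectE exE conjE)
    then show ?thesis
      by (intro smult[of xs p x c]) (simp_all add: tens_index_def ftens_def lsub_def)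
  qed
qed

lemma mlrelI:
  fixes M :: "('k::comm_ring_1, 'a) lalg"
  assumes "xs \<in> tens_index M n" "p < n" "x \<in> lcarrier M"
  shows "y \<in> lcarrier M \<Longrightarrow> (fvec (xs[p := x \<oplus>\<^bsub>M\<^esub> y]) \<ominus>\<^bsub>ftens M n\<^esub> fvec (xs[p := x]))
      \<ominus>\<^bsub>ftens M n\<^esub> fvec (xs[p := y]) \<in> mlrel M n"
    and "fvec (xs[p := c \<odot>\<^bsub>M\<^esub> x]) \<ominus>\<^bsub>ftens M n\<^esub> c \<odot>\<^bsub>ftens M n\<^esub> fvec (xs[p := x]) \<in> mlrel M n"
proof -
  have xs: "length xs = n" "set xs \<subseteq> lcarrier M" using assms(1) by (auto simp: tens_index_def)
  show "(fvec (xs[p := x \<oplus>\<^bsub>M\<^esub> y]) \<ominus>\<^bsub>ftens M n\<^esub> fvec (xs[p := x]))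
      \<ominus>\<^bsub>ftens M n\<^esub> fvec (xs[p := y]) \<in> mlrel M n" if "y \<in> lcarrier M"
    unfolding mlrel_def
    by (rule UnI1, rule CollectI, rule exI[of _ xs], rule exI[of _ p], rule exI[of _ x], rule exI[of _ y])
      (use assms xs that in \<open>simp add: ftens_def lsub_def\<close>)
  show "fvec (xs[p := c \<odot>\<^bsub>M\<^esub> x]) \<ominus>\<^bsub>ftens M n\<^esub> c \<odot>\<^bsub>ftens M n\<^esub> fvec (xs[p := x]) \<in> mlrel M n"
    unfolding mlrel_def
    by (rule UnI2, rule CollectI, rule exI[of _ xs], rule exI[of _ p], rule exI[of _ c], rule exI[of _ x])
      (use assms xs in \<open>simp add: ftens_def lsub_def\<close>)
qed

section \<open>The universal property of tensor powers\<close>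

locale tensor_power = kmod M for M :: "('k::comm_ring_1, 'a) lalg" (structure) and n :: nat
begin

lemma kmodule_ftens: "kmodule (ftens M n)"
  using free_on_ftens by (rule free_on_kmodule)

sublocale FT: kmod "ftens M n"
  using kmodule_ftens by (rule kmod.intro)

lemma fvec_closed: "xs \<in> tens_index M n \<Longrightarrow> fvec xs \<in> lcarrier (ftens M n)"
  using free_on_ftens[of M n] by (simp add: fvec_eq_delta free_on_def delta_fsupp)

lemma mlrel_closed: "mlrel M n \<subseteq> lcarrier (ftens M n)"
proof
  fix f assume "f \<in> mlrel M n"
  then show "f \<in> lcarrier (ftens M n)"
    by (cases rule: mlrel_cases) (simp_all add: fvec_closed tens_index_update)
qed

sublocale T: quotient_module "ftens M n" "lspan (ftens M n) (mlrel M n)"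
  using kmodule_ftens mlrel_closed by (rule quotient_module_lspan)

lemma kmodule_tpow: "kmodule (tpow M n)"
  unfolding tpow_def by (rule T.kmodule_lquot)

lemma tens_closed [simp, intro]: "xs \<in> tens_index M n \<Longrightarrow> tens M n xs \<in> lcarrier (tpow M n)"
  unfolding tens_def tpow_def by (intro T.lcoset_carrier fvec_closed)

lemma multilinear_tens: "multilinear M (tpow M n) n (tens M n)"
  unfolding multilinear_def
proof (intro conjI ballI allI impI)
  fix xs p x assume xs: "xs \<in> tens_index M n" "p < n" "x \<in> lcarrier M"
  note c = fvec_closed[OF tens_index_update[OF xs(1)]]
  show "tens M n (xs[p := x \<oplus> y]) = tens M n (xs[p := x]) \<oplus>\<^bsub>tpow M n\<^esub> tens M n (xs[p := y])"
    if "y \<in> lcarrier M" for y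
  proof -
    have "(fvec (xs[p := x \<oplus> y]) \<ominus>\<^bsub>ftens M n\<^esub> fvec (xs[p := x])) \<ominus>\<^bsub>ftens M n\<^esub> fvec (xs[p := y])
        \<in> lspan (ftens M n) (mlrel M n)"
      using mlrelI(1)[OF xs that] by (rule span_gen)
    then have "T.cls (fvec (xs[p := x \<oplus> y]) \<ominus>\<^bsub>ftens M n\<^esub> fvec (xs[p := x])) = T.cls (fvec (xs[p := y]))"
      using c xs that by (subst T.lcoset_eq_iff) simp_all
    then have "T.cls (fvec (xs[p := x]) \<oplus>\<^bsub>ftens M n\<^esub> (fvec (xs[p := x \<oplus> y]) \<ominus>\<^bsub>ftens M n\<^esub> fvec (xs[p := x])))
        = T.cls (fvec (xs[p := x])) \<oplus>\<^bsub>lquot (ftens M n) (lspan (ftens M n) (mlrel M n))\<^esub> T.cls (fvec (xs[p := y]))"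
      using c xs that by (subst T.lquot_add[symmetric]) simp_all
    then show ?thesis using c xs that by (simp add: tens_def tpow_def FT.add_sub_cancel)
  qed
  show "tens M n (xs[p := s \<odot> x]) = s \<odot>\<^bsub>tpow M n\<^esub> tens M n (xs[p := x])" for s
  proof -
    have "fvec (xs[p := s \<odot> x]) \<ominus>\<^bsub>ftens M n\<^esub> s \<odot>\<^bsub>ftens M n\<^esub> fvec (xs[p := x])
        \<in> lspan (ftens M n) (mlrel M n)"
      using mlrelI(2)[OF xs] by (rule span_gen)
    then have "T.cls (fvec (xs[p := s \<odot> x])) = T.cls (s \<odot>\<^bsub>ftens M n\<^esub> fvec (xs[p := x]))"
      using c xs by (subst T.lcoset_eq_iff) simp_all
    then show ?thesis using c xs by (simp add: tens_def tpow_def T.lquot_smult)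
  qed
qed simp

lemma tpow_lift:
  assumes N: "kmodule N" and g: "multilinear M N n g"
  obtains F where "klinear (tpow M n) N F" "\<And>xs. xs \<in> tens_index M n \<Longrightarrow> F (tens M n xs) = g xs"
proof -
  interpret N: kmod N using N by (rule kmod.intro)
  let ?h = "kspan_sum N g"
  have gc: "g xs \<in> lcarrier N" if "xs \<in> tens_index M n" for xs
    using g that by (simp add: multilinear_def)
  have lin: "klinear (ftens M n) N ?h"
    by (rule N.kspan_sum_klinear[OF free_on_ftens]) (use gc in auto)
  have hv: "?h (fvec xs) = g xs" if "xs \<in> tens_index M n" for xs
    unfolding fvec_eq_delta using N.kspan_sum_delta[where g = g and s = xs] gc[OF that] by simp
  have gen: "?h f = \<zero>\<^bsub>N\<^esub>" if "f \<in> mlrel M n" for f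
    using that
  proof (cases rule: mlrel_cases)
    case (add xs p x y)
    have "g (xs[p := x \<oplus> y]) = g (xs[p := x]) \<oplus>\<^bsub>N\<^esub> g (xs[p := y])"
      using g add by (simp add: multilinear_def)
    then show ?thesis using add gc
      by (simp add: klinear_sub[OF lin FT.kmodule] fvec_closed tens_index_update hv
          N.sub_eq_iff N.add_comm)
  next
    case (smult xs p c x)
    have "g (xs[p := c \<odot> x]) = c \<odot>\<^bsub>N\<^esub> g (xs[p := x])"
      using g smult by (simp add: multilinear_def)
    then show ?thesis using smult gc
      by (simp add: klinear_sub[OF lin FT.kmodule] klinear_smult[OF lin] fvec_closed tens_index_update hv)
  qed
  have ker: "?h f = \<zero>\<^bsub>N\<^esub>" if "f \<in> lspan (ftens M n) (mlrel M n)" for f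
    using that
  proof induction
    case span_zero
    then show ?case by (rule klinear_zero[OF lin FT.kmodule N])
  qed (use gen lspan_carrier[OF kmodule_ftens mlrel_closed] in \<open>simp_all add: klinear_add[OF lin] klinear_smult[OF lin]\<close>)
  have "klinear (tpow M n) N (quot_lift ?h)"
    unfolding tpow_def by (rule T.klinear_quot_lift[OF lin N ker])
  moreover have "quot_lift ?h (tens M n xs) = g xs" if "xs \<in> tens_index M n" for xs
    unfolding tens_def using T.quot_lift_lcoset[OF lin N ker fvec_closed[OF that]] hv[OF that] by simp
  ultimately show ?thesis using that by blast
qed

lemma klinear_eq_on_tens:
  assumes N: "kmodule N" and f: "klinear (tpow M n) N f" and g: "klinear (tpow M n) N g"
    and eq: "\<And>xs. xs \<in> tens_index M n \<Longrightarrow> f (tens M n xs) = g (tens M n xs)"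
    and z: "z \<in> lcarrier (tpow M n)"
  shows "f z = g z"
proof -
  obtain u where u: "u \<in> lcarrier (ftens M n)" and zu: "z = T.cls u"
    using z by (auto simp: tpow_def T.lcarrier_lquot)
  have f': "klinear (ftens M n) N (\<lambda>u. f (T.cls u))" and g': "klinear (ftens M n) N (\<lambda>u. g (T.cls u))"
    using klinear_comp[OF T.klinear_lcoset] f g by (simp_all add: tpow_def)
  have "f (T.cls u) = g (T.cls u)"
    using free_on_ftens u
  proof (induction u rule: free_on_induct)
    case zero
    then show ?case using klinear_zero[OF f' FT.kmodule N] klinear_zero[OF g' FT.kmodule N] by simp
  next
    case (delta s)
    then show ?case using eq by (simp add: tens_def fvec_eq_delta)
  qed (simp_all add: klinear_add[OF f'] klinear_add[OF g'] klinear_smult[OF f'] klinear_smult[OF g'])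
  then show ?thesis by (simp add: zu)
qed

text \<open>Fixing the value outside the carrier turns the universal property into unique existence
  of a total function, the form in which \<open>delta2\<close> and \<open>delta3\<close> are
  specified.\<close>

lemma ex1_tpow_lift:
  assumes N: "kmodule N" and g: "multilinear M N n g"
  shows "\<exists>!d. klinear (tpow M n) N d \<and> (\<forall>xs\<in>tens_index M n. d (tens M n xs) = g xs) \<and>
     (\<forall>z. z \<notin> lcarrier (tpow M n) \<longrightarrow> d z = lzero N)"
proof -
  interpret TP: kmod "tpow M n" using kmodule_tpow by (rule kmod.intro)
  obtain F where F: "klinear (tpow M n) N F" "\<And>xs. xs \<in> tens_index M n \<Longrightarrow> F (tens M n xs) = g xs"
    using tpow_lift[OF N g] by blast
  let ?d = "\<lambda>z. if z \<in> lcarrier (tpow M n) then F z else lzero N"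
  show ?thesis
  proof (rule ex1I[of _ ?d])
    have "klinear (tpow M n) N ?d"
      by (rule klinearI) (simp_all add: klinear_closed[OF F(1)] klinear_add[OF F(1)] klinear_smult[OF F(1)])
    then show "klinear (tpow M n) N ?d \<and> (\<forall>xs\<in>tens_index M n. ?d (tens M n xs) = g xs) \<and>
     (\<forall>z. z \<notin> lcarrier (tpow M n) \<longrightarrow> ?d z = lzero N)" using F(2) by simp
    fix d assume d: "klinear (tpow M n) N d \<and> (\<forall>xs\<in>tens_index M n. d (tens M n xs) = g xs) \<and>
     (\<forall>z. z \<notin> lcarrier (tpow M n) \<longrightarrow> d z = lzero N)"
    show "d = ?d"
    proof
      fix z
      show "d z = ?d z"
      proof (cases "z \<in> lcarrier (tpow M n)")
        case True
        then show ?thesis using klinear_eq_on_tens[OF N, of d F z] d F by simp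
      qed (use d in simp)
    qed
  qed
qed

end

lemma tens_index_2:
  "(\<forall>xs\<in>tens_index M 2. Q xs) \<longleftrightarrow> (\<forall>x\<in>lcarrier M. \<forall>y\<in>lcarrier M. Q [x, y])"
  unfolding tens_index_def
  by (auto simp: numeral_2_eq_2 length_Suc_conv)

lemma tens_index_3:
  "(\<forall>xs\<in>tens_index M 3. Q xs) \<longleftrightarrow>
    (\<forall>x\<in>lcarrier M. \<forall>y\<in>lcarrier M. \<forall>z\<in>lcarrier M. Q [x, y, z])"
  unfolding tens_index_def
  by (auto simp: numeral_3_eq_3 length_Suc_conv)

lemma multilinear_2I:
  assumes "kbilinear M N B"
  shows "multilinear M N 2 (\<lambda>xs. B (xs ! 0) (xs ! 1))"
  unfolding multilinear_def tens_index_2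
  by (auto simp: less_2_cases_iff kbilinear_closed[OF assms] kbilinear_add_left[OF assms]
      kbilinear_add_right[OF assms] kbilinear_smult_left[OF assms] kbilinear_smult_right[OF assms])

lemma less_3_cases_iff: "p < (3::nat) \<longleftrightarrow> p = 0 \<or> p = 1 \<or> p = 2"
  by auto

text \<open>The operations of \<open>lquot\<close> do not refer to the carrier. Hence cycles modulo
  boundaries are literally a submodule of all 2-tensors modulo boundaries, which is how
  \<open>HL2\<close> is treated below.\<close>

lemma lquot_restrict_carrier:
  "lquot (A\<lparr>lcarrier := Z\<rparr>) I = (lquot A I)\<lparr>lcarrier := lcoset A I ` Z\<rparr>"
  by (simp add: lquot_def lcoset_def)

section \<open>The cokernel of the third differential\<close>

locale leibniz_algebra =
  fixes L :: "('k::comm_ring_1, 'a) lalg" (structure)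
  assumes leibniz: "leibniz L"
begin

sublocale kmod L
  using leibniz by (simp add: kmod_def leibniz_kmodule)

sublocale T2: tensor_power L 2 ..
sublocale T3: tensor_power L 3 ..

sublocale TP2: kmod "tpow L 2"
  by (rule kmod.intro) (rule T2.kmodule_tpow)

sublocale TP3: kmod "tpow L 3"
  by (rule kmod.intro) (rule T3.kmodule_tpow)

lemmas bil = leibniz_kbilinear[OF leibniz]
lemmas br_closed [simp, intro] = kbilinear_closed[OF bil]

abbreviation "t2 x y \<equiv> tens L 2 [x, y]"

lemma t2_bilinear: "kbilinear L (tpow L 2) t2"
proof (rule kbilinearI)
  note m = T2.multilinear_tens[unfolded multilinear_def tens_index_2]
  show "x \<in> lcarrier L \<Longrightarrow> y \<in> lcarrier L \<Longrightarrow> t2 x y \<in> lcarrier (tpow L 2)" for x y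
    using m by blast
  fix x y z assume "x \<in> lcarrier L" "y \<in> lcarrier L" "z \<in> lcarrier L"
  then show "t2 (x \<oplus> y) z = t2 x z \<oplus>\<^bsub>tpow L 2\<^esub> t2 y z" "t2 z (x \<oplus> y) = t2 z x \<oplus>\<^bsub>tpow L 2\<^esub> t2 z y"
    using m[THEN conjunct2, THEN conjunct1, rule_format, of x z 0 x y]
      m[THEN conjunct2, THEN conjunct1, rule_format, of z x 1 x y] by simp_all
next
  note m = T2.multilinear_tens[unfolded multilinear_def tens_index_2]
  fix c x y assume "x \<in> lcarrier L" "y \<in> lcarrier L"
  then show "t2 (c \<odot> x) y = c \<odot>\<^bsub>tpow L 2\<^esub> t2 x y" "t2 x (c \<odot> y) = c \<odot>\<^bsub>tpow L 2\<^esub> t2 x y"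
    using m[THEN conjunct2, THEN conjunct2, rule_format, of x y 0 x c]
      m[THEN conjunct2, THEN conjunct2, rule_format, of x y 1 y c] by simp_all
qed

lemmas t2_closed [simp, intro] = kbilinear_closed[OF t2_bilinear]
lemmas t2_lin = kbilinear_add_left[OF t2_bilinear] kbilinear_add_right[OF t2_bilinear]
  kbilinear_smult_left[OF t2_bilinear] kbilinear_smult_right[OF t2_bilinear]

lemma delta2:
  shows delta2_linear: "klinear (tpow L 2) L (delta2 L)"
    and delta2_tens: "x \<in> lcarrier L \<Longrightarrow> y \<in> lcarrier L \<Longrightarrow> delta2 L (t2 x y) = (- 1) \<odot> (x \<bullet> y)"
proof -
  have "kbilinear L L (\<lambda>x y. (- 1) \<odot> (x \<bullet> y))"
    by (rule kbilinearI)
      (simp_all add: kbilinear_add_left[OF bil] kbilinear_add_right[OF bil] kbilinear_smult_left[OF bil]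
        kbilinear_smult_right[OF bil] smult_add_right smult_neg)
  from T2.ex1_tpow_lift[OF kmodule multilinear_2I[OF this], THEN theI']
  have "klinear (tpow L 2) L (delta2 L) \<and> (\<forall>x\<in>lcarrier L. \<forall>y\<in>lcarrier L. delta2 L (t2 x y) = (- 1) \<odot> (x \<bullet> y)) \<and>
     (\<forall>z. z \<notin> lcarrier (tpow L 2) \<longrightarrow> delta2 L z = \<zero>)"
    unfolding delta2_def tens_index_2 by simp
  then show "klinear (tpow L 2) L (delta2 L)"
    "x \<in> lcarrier L \<Longrightarrow> y \<in> lcarrier L \<Longrightarrow> delta2 L (t2 x y) = (- 1) \<odot> (x \<bullet> y)"
    by blast+
qed

definition boundary3 where
  "boundary3 x y z = ladd (tpow L 2)
     (ladd (tpow L 2) (lsmult (tpow L 2) (-1) (t2 (x \<bullet> y) z)) (t2 (x \<bullet> z) y)) (t2 x (y \<bullet> z))"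

lemma multilinear_boundary3:
  "multilinear L (tpow L 2) 3 (\<lambda>xs. boundary3 (xs ! 0) (xs ! 1) (xs ! 2))"
  unfolding multilinear_def tens_index_3
  by (auto simp: less_3_cases_iff boundary3_def t2_lin kbilinear_add_left[OF bil]
      kbilinear_add_right[OF bil] kbilinear_smult_left[OF bil] kbilinear_smult_right[OF bil]
      TP2.smult_add_right TP2.smult_neg TP2.add_ac)

lemma delta3:
  shows delta3_linear: "klinear (tpow L 3) (tpow L 2) (delta3 L)"
    and delta3_tens: "x \<in> lcarrier L \<Longrightarrow> y \<in> lcarrier L \<Longrightarrow> z \<in> lcarrier L \<Longrightarrow>
      delta3 L (tens L 3 [x, y, z]) = boundary3 x y z"
proof -
  from T3.ex1_tpow_lift[OF T2.kmodule_tpow multilinear_boundary3, THEN theI']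
  have "klinear (tpow L 3) (tpow L 2) (delta3 L) \<and>
     (\<forall>x\<in>lcarrier L. \<forall>y\<in>lcarrier L. \<forall>z\<in>lcarrier L. delta3 L (tens L 3 [x, y, z]) = boundary3 x y z) \<and>
     (\<forall>z. z \<notin> lcarrier (tpow L 3) \<longrightarrow> delta3 L z = lzero (tpow L 2))"
    unfolding delta3_def tens_index_3 boundary3_def by simp
  then show "klinear (tpow L 3) (tpow L 2) (delta3 L)"
    "x \<in> lcarrier L \<Longrightarrow> y \<in> lcarrier L \<Longrightarrow> z \<in> lcarrier L \<Longrightarrow>
      delta3 L (tens L 3 [x, y, z]) = boundary3 x y z"
    by blast+
qed

abbreviation "J \<equiv> delta3 L ` lcarrier (tpow L 3)"
abbreviation "Q \<equiv> lquot (tpow L 2) J"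

sublocale Q: quotient_module "tpow L 2" J
proof
  show "submodule (tpow L 2) J"
    unfolding submodule_def
  proof (intro conjI ballI allI)
    note lin = delta3_linear
    show "J \<subseteq> lcarrier (tpow L 2)" using klinear_closed[OF lin] by blast
    show "lzero (tpow L 2) \<in> J"
      using klinear_zero[OF lin TP3.kmodule TP2.kmodule] TP3.zero_closed by (metis imageI)
    show "x \<oplus>\<^bsub>tpow L 2\<^esub> y \<in> J" if "x \<in> J" "y \<in> J" for x y
      using that by (auto simp: klinear_add[OF lin, symmetric])
    show "c \<odot>\<^bsub>tpow L 2\<^esub> x \<in> J" if "x \<in> J" for c x
      using that by (auto simp: klinear_smult[OF lin, symmetric])
  qed
qed

lemma kmodule_Q: "kmodule Q"
  by (rule Q.kmodule_lquot)

sublocale QM: kmod Q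
  using kmodule_Q by (rule kmod.intro)

abbreviation "b x y \<equiv> Q.cls (t2 x y)"

lemma b_bilinear: "kbilinear L Q b"
  by (rule kbilinearI) (simp_all add: t2_lin Q.lquot_add Q.lquot_smult)

text \<open>The boundary of x, y, z is, up to the order of its terms, the defect of the cocycle
  identity, so dividing by boundaries imposes precisely this identity on the tensor product.\<close>

lemma b_cocycle:
  assumes "x \<in> lcarrier L" "y \<in> lcarrier L" "z \<in> lcarrier L"
  shows "b x (y \<bullet> z) = b (x \<bullet> y) z \<ominus>\<^bsub>Q\<^esub> b (x \<bullet> z) y"
proof -
  have "delta3 L (tens L 3 [x, y, z]) \<in> J"
    using assms by (intro imageI T3.tens_closed) (simp add: tens_index_def)
  then have "boundary3 x y z \<in> J" using assms by (simp add: delta3_tens)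
  moreover have "boundary3 x y z = t2 x (y \<bullet> z) \<ominus>\<^bsub>tpow L 2\<^esub> (t2 (x \<bullet> y) z \<ominus>\<^bsub>tpow L 2\<^esub> t2 (x \<bullet> z) y)"
    using assms by (simp add: boundary3_def lsub_def TP2.smult_add_right TP2.add_ac)
  ultimately have "b x (y \<bullet> z) = Q.cls (t2 (x \<bullet> y) z \<ominus>\<^bsub>tpow L 2\<^esub> t2 (x \<bullet> z) y)"
    using assms by (subst Q.lcoset_eq_iff) simp_all
  then show ?thesis
    using assms by (simp add: klinear_sub[OF Q.klinear_lcoset TP2.kmodule])
qed

lemma klinear_eq_on_Q:
  assumes N: "kmodule N" and f: "klinear Q N f" and g: "klinear Q N g"
    and eq: "\<And>x y. x \<in> lcarrier L \<Longrightarrow> y \<in> lcarrier L \<Longrightarrow> f (b x y) = g (b x y)"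
    and z: "z \<in> lcarrier Q"
  shows "f z = g z"
proof -
  obtain u where u: "u \<in> lcarrier (tpow L 2)" and zu: "z = Q.cls u"
    using z by (auto simp: Q.lcarrier_lquot)
  have eq': "\<forall>xs\<in>tens_index L 2. f (Q.cls (tens L 2 xs)) = g (Q.cls (tens L 2 xs))"
    unfolding tens_index_2 by (intro ballI eq)
  show ?thesis unfolding zu
    by (rule T2.klinear_eq_on_tens[where f = "\<lambda>u. f (Q.cls u)" and g = "\<lambda>u. g (Q.cls u)",
          OF N klinear_comp[OF Q.klinear_lcoset f] klinear_comp[OF Q.klinear_lcoset g] bspec[OF eq'] u])
qed

text \<open>Makes \<open>b\<close> the universal cocycle: a bilinear map satisfying the identity
  kills all boundaries, since it does so on those of pure tensors. The bracket of \<open>L\<close>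
  and \<psi> are both factored in this way.\<close>

lemma Q_lift:
  assumes N: "kmodule N" and B: "kbilinear L N B"
    and coc: "\<And>x y z. x \<in> lcarrier L \<Longrightarrow> y \<in> lcarrier L \<Longrightarrow> z \<in> lcarrier L \<Longrightarrow>
      B x (y \<bullet> z) = B (x \<bullet> y) z \<ominus>\<^bsub>N\<^esub> B (x \<bullet> z) y"
  shows "\<exists>F. klinear Q N F \<and> (\<forall>x\<in>lcarrier L. \<forall>y\<in>lcarrier L. F (b x y) = B x y)"
proof -
  interpret N: kmod N using N by (rule kmod.intro)
  from ex1_implies_ex[OF T2.ex1_tpow_lift[OF N multilinear_2I[OF B]]]
  obtain F where lin: "klinear (tpow L 2) N F"
    and F: "\<forall>xs\<in>tens_index L 2. F (tens L 2 xs) = B (xs ! 0) (xs ! 1)"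
    by (elim exE conjE)
  then have Ft: "F (t2 x y) = B x y" if "x \<in> lcarrier L" "y \<in> lcarrier L" for x y
    using that unfolding tens_index_2 by simp
  note Bc = kbilinear_closed[OF B]
  have F0: "\<forall>xs\<in>tens_index L 3. F (delta3 L (tens L 3 xs)) = \<zero>\<^bsub>N\<^esub>"
    unfolding tens_index_3
  proof (intro ballI)
    fix x y z assume xyz: "x \<in> lcarrier L" "y \<in> lcarrier L" "z \<in> lcarrier L"
    then have "F (delta3 L (tens L 3 [x, y, z])) =
        ((- 1) \<odot>\<^bsub>N\<^esub> B (x \<bullet> y) z \<oplus>\<^bsub>N\<^esub> B (x \<bullet> z) y) \<oplus>\<^bsub>N\<^esub> B x (y \<bullet> z)"
      by (simp add: delta3_tens boundary3_def klinear_add[OF lin] klinear_smult[OF lin] Ft)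
    also have "\<dots> = B x (y \<bullet> z) \<ominus>\<^bsub>N\<^esub> (B (x \<bullet> y) z \<ominus>\<^bsub>N\<^esub> B (x \<bullet> z) y)"
      using xyz by (simp add: lsub_def N.smult_add_right N.add_ac Bc)
    also have "\<dots> = \<zero>\<^bsub>N\<^esub>" using xyz coc[OF xyz] by (simp add: Bc)
    finally show "F (delta3 L (tens L 3 [x, y, z])) = \<zero>\<^bsub>N\<^esub>" .
  qed
  have const: "klinear (tpow L 3) N (\<lambda>z. \<zero>\<^bsub>N\<^esub>)" by (rule klinearI) simp_all
  have zero: "F (delta3 L z) = \<zero>\<^bsub>N\<^esub>" if "z \<in> lcarrier (tpow L 3)" for z
    by (rule T3.klinear_eq_on_tens[where f = "\<lambda>z. F (delta3 L z)" and g = "\<lambda>z. \<zero>\<^bsub>N\<^esub>",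
          OF N klinear_comp[OF delta3_linear lin] const bspec[OF F0] that])
  have ker: "F j = \<zero>\<^bsub>N\<^esub>" if "j \<in> J" for j
    using that by (elim imageE) (simp only: zero)
  have "klinear Q N (quot_lift F)" by (rule Q.klinear_quot_lift[OF lin N ker])
  moreover have "quot_lift F (b x y) = B x y" if "x \<in> lcarrier L" "y \<in> lcarrier L" for x y
    using that Q.quot_lift_lcoset[OF lin N ker, of "t2 x y"] Ft by simp
  ultimately show ?thesis by (intro exI conjI ballI)
qed

text \<open>On classes \<open>delta2\<close> is \<open>d\<close> up to sign, so the classes of
  cycles form the kernel of \<open>d\<close>.\<close>

lemma HL2_eq:
  assumes d: "klinear Q L d"
    and db: "\<And>x y. x \<in> lcarrier L \<Longrightarrow> y \<in> lcarrier L \<Longrightarrow> d (b x y) = x \<bullet> y"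
  shows "HL2 L = Q\<lparr>lcarrier := {z \<in> lcarrier Q. d z = \<zero>}\<rparr>"
proof -
  let ?Z = "{z \<in> lcarrier (tpow L 2). delta2 L z = \<zero>}"
  have dc: "klinear (tpow L 2) L (\<lambda>z. d (Q.cls z))"
    by (rule klinear_comp[OF Q.klinear_lcoset d])
  have neg: "klinear (tpow L 2) L (\<lambda>z. (- 1) \<odot> d (Q.cls z))"
    by (rule klinearI)
      (simp_all add: klinear_add[OF dc] klinear_smult[OF dc] klinear_closed[OF dc] smult_add_right smult_neg)
  have eq: "\<forall>xs\<in>tens_index L 2. delta2 L (tens L 2 xs) = (- 1) \<odot> d (Q.cls (tens L 2 xs))"
    unfolding tens_index_2 by (simp add: delta2_tens db)
  have d2: "delta2 L z = (- 1) \<odot> d (Q.cls z)" if "z \<in> lcarrier (tpow L 2)" for z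
    by (rule T2.klinear_eq_on_tens[where f = "delta2 L" and g = "\<lambda>z. (- 1) \<odot> d (Q.cls z)",
          OF kmodule delta2_linear neg bspec[OF eq] that])
  have "delta2 L z = \<zero> \<longleftrightarrow> d (Q.cls z) = \<zero>" if "z \<in> lcarrier (tpow L 2)" for z
    unfolding d2[OF that] using neg_neg[OF klinear_closed[OF dc that]] by (metis smult_zero_right)
  then have "Q.cls ` ?Z = {z \<in> lcarrier Q. d z = \<zero>}"
    by (auto simp: Q.lcarrier_lquot)
  then show ?thesis
    unfolding HL2_def lquot_restrict_carrier by (simp only:)
qed

end

section \<open>The second homology of stl4\<close>

context labelled_steinberg
begin

lemma W_induct [consumes 1, case_names eps add]:
  assumes w: "w \<in> lcarrier W"
    and eps: "\<And>m a. m \<in> {1..6} \<Longrightarrow> P (epsW sR m a)"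
    and add: "\<And>v w. P v \<Longrightarrow> P w \<Longrightarrow> P (v \<oplus>\<^bsub>W\<^esub> w)"
  shows "P w"
proof -
  obtain f where "w = Wcl f" using w by (auto simp: W_carrier)
  then show ?thesis unfolding Wcl_eq_sum_epsW[of f] by (simp add: eps add)
qed

lemma HL2_iso: "\<exists>f. kiso (HL2 L) W f"
proof -
  interpret H: leibniz_algebra L using leibniz_stl4 by (rule leibniz_algebra.intro)
  have "\<exists>d. klinear H.Q L d \<and> (\<forall>x\<in>lcarrier L. \<forall>y\<in>lcarrier L. d (H.b x y) = x \<bullet>\<^bsub>L\<^esub> y)"
    by (rule H.Q_lift[OF L.kmodule bilinear_L]) (rule L_leibniz)
  then obtain d where d: "klinear H.Q L d"
    and "\<forall>x\<in>lcarrier L. \<forall>y\<in>lcarrier L. d (H.b x y) = x \<bullet>\<^bsub>L\<^esub> y" by (elim exE conjE)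
  then have db: "d (H.b x y) = x \<bullet>\<^bsub>L\<^esub> y" if "x \<in> lcarrier L" "y \<in> lcarrier L" for x y
    using that by simp
  have "\<exists>f. klinear H.Q W f \<and> (\<forall>x\<in>lcarrier L. \<forall>y\<in>lcarrier L. f (H.b x y) = \<Psi> x y)"
    by (rule H.Q_lift[OF W.kmodule psi_bilinear]) (rule psi_cocycle)
  then obtain f where f: "klinear H.Q W f"
    and "\<forall>x\<in>lcarrier L. \<forall>y\<in>lcarrier L. f (H.b x y) = \<Psi> x y" by (elim exE conjE)
  then have fb: "f (H.b x y) = \<Psi> x y" if "x \<in> lcarrier L" "y \<in> lcarrier L" for x y
    using that by simp
  interpret C: stl4_cocycle sR \<theta> H.Q H.b d
  proof unfold_locales
    show "kbilinear L H.Q H.b" by (rule H.b_bilinear)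
    show "klinear H.Q L d" by (rule d)
    show "H.b x (y \<bullet>\<^bsub>L\<^esub> z) = H.b (x \<bullet>\<^bsub>L\<^esub> y) z \<ominus>\<^bsub>H.Q\<^esub> H.b (x \<bullet>\<^bsub>L\<^esub> z) y"
      if "x \<in> lcarrier L" "y \<in> lcarrier L" "z \<in> lcarrier L" for x y z
      using that by (rule H.b_cocycle)
    show "d (H.b x y) = x \<bullet>\<^bsub>L\<^esub> y" if "x \<in> lcarrier L" "y \<in> lcarrier L" for x y
      using that by (rule db)
  qed
  obtain \<eta> where \<eta>: "klinear Lhat H.Q \<eta>"
    "\<And>x y. x \<in> lcarrier L \<Longrightarrow> y \<in> lcarrier L \<Longrightarrow> \<eta> (\<Psi> x y, x \<bullet>\<^bsub>L\<^esub> y) = H.b x y"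
    by (rule C.ex_lift) (rule that)
  have "klinear H.Q Lhat (\<lambda>q. (f q, d q))"
    by (rule klinearI)
      (simp_all add: klinear_closed[OF f] klinear_closed[OF d] klinear_add[OF f] klinear_add[OF d]
        klinear_smult[OF f] klinear_smult[OF d])
  from klinear_comp[OF this \<eta>(1)] have "klinear H.Q H.Q (\<lambda>q. \<eta> (f q, d q))" .
  moreover have "klinear H.Q H.Q (\<lambda>q. q)" by (rule klinearI) simp_all
  \<comment> \<open>Both sides are linear, and on a class \<open>b x y\<close> the value is
    \<open>\<eta> (\<Psi> x y, x \<bullet> y)\<close>, which is \<open>b x y\<close> again.\<close>
  ultimately have retract: "\<eta> (f q, d q) = q" if "q \<in> lcarrier H.Q" for q
    using H.klinear_eq_on_Q[OF H.kmodule_Q, of "\<lambda>q. \<eta> (f q, d q)" "\<lambda>q. q" q] that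
    by (simp add: fb db \<eta>(2))
  let ?K = "{q \<in> lcarrier H.Q. d q = \<zero>\<^bsub>L\<^esub>}"
  have HL2: "HL2 L = H.Q\<lparr>lcarrier := ?K\<rparr>" by (rule H.HL2_eq[OF d db])
  have "klinear (HL2 L) W f"
    unfolding HL2 by (rule klinearI)
      (simp_all add: klinear_closed[OF f] klinear_add[OF f] klinear_smult[OF f])
  moreover have "bij_betw f (lcarrier (HL2 L)) (lcarrier W)"
    unfolding bij_betw_def
  proof
    show "inj_on f (lcarrier (HL2 L))"
    proof (rule inj_onI)
      \<comment> \<open>On the kernel of \<open>d\<close> an element is recovered as \<eta> of the
        pair consisting of its value under \<open>f\<close> and zero.\<close>
      fix p q assume "p \<in> lcarrier (HL2 L)" "q \<in> lcarrier (HL2 L)" "f p = f q"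
      then show "p = q" using retract[of p] retract[of q] by (simp add: HL2)
    qed
    have "w \<in> f ` ?K" if "w \<in> lcarrier W" for w
      using that
    proof (induction w rule: W_induct)
      case (eps m a)
      obtain i j k l where p: "(i, j, k, l) \<in> Pset" and m: "\<theta> (i, j, k, l) = m"
        using valid_label_surj[OF valid_label eps] .
      note P = Pset_range[OF p] Pset_distinct[OF p]
      \<comment> \<open>The indices are distinct, so the bracket is zero and this class lies in the
        kernel of \<open>d\<close>, while \<psi> takes the required value.\<close>
      let ?q = "H.b (X i j a) (X k l 1)"
      have c: "X i j a \<in> lcarrier L" "X k l 1 \<in> lcarrier L" using P by (simp_all add: X_closed del: atLeastAtMost_iff)
      have "f ?q = epsW sR m a" using fb[OF c] psi_X[of i j k l a 1] P p m by simp
      moreover have "d ?q = \<zero>\<^bsub>L\<^esub>" using db[OF c] X_br0[of i j k l a 1] P by simp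
      moreover have "?q \<in> lcarrier H.Q" using c by blast
      ultimately show ?case by (intro image_eqI[of _ _ ?q]) simp_all
    next
      case (add v w)
      then obtain p q where "p \<in> ?K" "q \<in> ?K" "v = f p" "w = f q" by (elim imageE)
      then show ?case
        by (intro image_eqI[of _ _ "p \<oplus>\<^bsub>H.Q\<^esub> q"]) (simp_all add: klinear_add[OF f] klinear_add[OF d])
    qed
    then show "f ` lcarrier (HL2 L) = lcarrier W"
      using klinear_closed[OF f] by (auto simp: HL2)
  qed
  ultimately show ?thesis unfolding kiso_def by blast
qed

end

theorem theorem3p5:
  fixes sR :: "'k::comm_ring_1 \<Rightarrow> 'r::ring_1 \<Rightarrow> 'r"
    and \<theta> :: "nat \<times> nat \<times> nat \<times> nat \<Rightarrow> nat"
  assumes "k_algebra sR"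
    and "free_basis_one sR"
    and "valid_label \<theta>"
  shows "universal_central_ext TYPE('c) (stlhat sR \<theta>) (stl4 sR) snd
         \<and> (\<exists>f. kiso (HL2 (stl4 sR)) (Wmod sR) f)"
proof -
  interpret labelled_steinberg sR \<theta>
    using assms(1,3) by unfold_locales
  show ?thesis using universal_central_ext_Lhat HL2_iso by (rule conjI)
qed

end
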